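(* The set $$\mathfrak{B}_{W_{1,\mathsf q}}=\big\{x(z)_{l_m}\cdots x(z)_{l_1}\mathcal{Y}(z)\;:\;m\in\mathbb{Z}_{\ge0},\ l_1,\dots,l_m\in\mathbb{Z},\ l_1\le-2,\ l_r\le-3\text{ for }r=2,3,\dots,m\big\}$$ forms a basis for $W_{1,\mathsf q}$.
   Context: Let $q$ be an indeterminate, $F=\mathbb{C}(q^{1/2})$, $[m]=\frac{q^m-q^{-m}}{q-q^{-1}}$. Let $K(1)=F[a(-1),a(-2),\dots]$ be the polynomial algebra on which $a(-r)$ ($r\ge1$) acts by multiplication and $a(r)$ ($r\ge1$) acts as the derivation with $a(r)\cdot a(-s)=\delta_{rs}\frac{[2r][r]}{r}$. Let $Q=\mathbb{Z}\alpha$, $\lambda=\alpha/2$, $(\alpha,\alpha)=2$; $F\{Q\}$ is the group algebra with basis $e^\beta$; $L_0=K(1)\otimes F\{Q\}$, $L_1=K(1)\otimes F\{Q\}e^\lambda$; $z^{\partial_\mu}e^\beta=z^{(\mu,\beta)}e^\beta$ (similarly $(-z)^{\partial_\mu}$). On $L_0$ and on $L_1$ define the Frenkel–Jing operator $$x(z)=\exp\Big(\sum_{r\ge1}\tfrac{q^{-r/2}}{[r]}a(-r)z^r\Big)\exp\Big(-\sum_{r\ge1}\tfrac{q^{-r/2}}{[r]}a(r)z^{-r}\Big)\otimes e^\alpha z^{\partial_\alpha},$$ and Koyama's operator $$\mathcal{Y}(z)=\exp\Big(\sum_{r\ge1}\tfrac{q^{r/2}}{[2r]}a(-r)z^r\Big)\exp\Big(-\sum_{r\ge1}\tfrac{q^{r/2}}{[2r]}a(r)z^{-r}\Big)\otimes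 e^\lambda(-z)^{\partial_\lambda}\in\mathrm{Hom}(L_0,L_1((z))).$$ Set $\mathsf q=q^2$, $[m]_{\mathsf q}=\frac{\mathsf q^m-1}{\mathsf q-1}$, $[l]_{\mathsf q}!=[l]_{\mathsf q}\cdots[1]_{\mathsf q}$; the $\mathsf q$-derivation is $a^{[1]}(z)=\frac{a(z\mathsf q)-a(z)}{z(\mathsf q-1)}$ and $a^{[n]}$ is its $n$-th iterate. For $l\le-1$ put $x(z)_l\,b(z)=\frac{1}{[-l-1]_{\mathsf q}!}x^{[-l-1]}(z)\,b(z\mathsf q^{-l-1})$; iterated expressions are nested to the right. $W_{1,\mathsf q}\subset\mathrm{Hom}(L_0,L_1((z)))$ is the $F$-span of all $x(z)_{l_m}\cdots x(z)_{l_1}\mathcal{Y}(z)$ with $m\in\mathbb{Z}_{\ge0}$ and $l_j\le-1$ for $j=1,\dots,m$. *)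

theory Defs
  imports
    "HOL-Computational_Algebra.Fraction_Field"
    "HOL-Computational_Algebra.Polynomial"
    "HOL-Library.Poly_Mapping"
    "HOL-Library.Function_Algebras"
begin

section \<open>The ground field\<close>

text \<open>\<open>qhalf\<close> is the indeterminate \<open>q\<^sup>1\<^sup>/\<^sup>2\<close> of \<open>F = \<complex>(q\<^sup>1\<^sup>/\<^sup>2)\<close>;
  \<open>qvar\<close> is \<open>q\<close> and \<open>qq\<close> is \<open>q\<^sup>2\<close>
  (sans-serif \<open>q\<close> in the literature).\<close>

type_synonym qfield = "complex poly fract"

definition qhalf :: qfield where
  "qhalf = Fraction_Field.Fract [:0, 1:] 1"

definition qvar :: qfield where
  "qvar = qhalf\<^sup>2"

definition qq :: qfield where
  "qq = qvar\<^sup>2"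

definition qint :: "int \<Rightarrow> qfield" where
  "qint m = (qvar powi m - qvar powi (- m)) / (qvar - inverse qvar)"

definition qqint :: "nat \<Rightarrow> qfield" where
  "qqint m = (qq ^ m - 1) / (qq - 1)"

definition qqfact :: "nat \<Rightarrow> qfield" where
  "qqfact l = (\<Prod>m=1..l. qqint m)"


section \<open>The Heisenberg module \<open>K(1)\<close>\<close>

text \<open>Polynomials in the variables \<open>a(-1), a(-2), \<dots>\<close>, a monomial being the finitely supported
  function of its exponents. The variable \<open>a(-r)\<close> has index \<open>r - 1\<close>.\<close>

type_synonym heis_module = "(nat \<Rightarrow>\<^sub>0 nat) \<Rightarrow>\<^sub>0 qfield"

definition avar :: "nat \<Rightarrow> heis_module" where
  "avar r = Poly_Mapping.single (Poly_Mapping.single (r - 1) 1) 1"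

definition scaleK :: "qfield \<Rightarrow> heis_module \<Rightarrow> heis_module" where
  "scaleK c p = Poly_Mapping.single 0 c * p"

definition pdiff :: "nat \<Rightarrow> heis_module \<Rightarrow> heis_module" where
  "pdiff i p = (\<Sum>m\<in>Poly_Mapping.keys p.
     Poly_Mapping.single (m - Poly_Mapping.single i 1)
       (of_nat (Poly_Mapping.lookup m i) * Poly_Mapping.lookup p m))"

text \<open>\<open>heis n\<close> is \<open>a(n)\<close>, for \<open>n \<noteq> 0\<close>.\<close>

definition heis :: "int \<Rightarrow> heis_module \<Rightarrow> heis_module" where
  "heis n p =
     (if n < 0 then avar (nat (- n)) * p
      else scaleK (qint (2 * n) * qint n / of_int n) (pdiff (nat n - 1) p))"

lemma pdiff_eq_sum:
  assumes "finite S" "Poly_Mapping.keys p \<subseteq> S"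
  shows "pdiff i p = (\<Sum>m\<in>S. Poly_Mapping.single (m - Poly_Mapping.single i 1)
    (of_nat (Poly_Mapping.lookup m i) * Poly_Mapping.lookup p m))"
  unfolding pdiff_def
  by (rule sum.mono_neutral_left[OF assms]) (auto simp: in_keys_iff)

lemma pdiff_add: "pdiff i (p + p') = pdiff i p + pdiff i p'"
proof -
  let ?S = "Poly_Mapping.keys p \<union> Poly_Mapping.keys p'"
  have sub: "Poly_Mapping.keys (p + p') \<subseteq> ?S"
    by (rule Poly_Mapping.keys_add)
  show ?thesis
    by (subst (1 2 3) pdiff_eq_sum[where S = ?S])
       (use sub in \<open>auto simp: lookup_add ring_distribs single_add sum.distrib\<close>)
qed

lemma pdiff_single:
  "pdiff i (Poly_Mapping.single m c) =
     Poly_Mapping.single (m - Poly_Mapping.single i 1) (of_nat (Poly_Mapping.lookup m i) * c)"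
  by (subst pdiff_eq_sum[where S = "{m}"]) auto

lemma pdiff_0: "pdiff i 0 = 0"
  by (simp add: pdiff_def)

lemma update_eq_add_single:
  fixes f :: "'a \<Rightarrow>\<^sub>0 'b :: comm_monoid_add"
  assumes "k \<notin> Poly_Mapping.keys f"
  shows "Poly_Mapping.update k b f = f + Poly_Mapping.single k b"
  using assms
  by (intro poly_mapping_eqI)
     (auto simp: lookup_update lookup_add lookup_single in_keys_iff when_def)

lemma monomial_minus_var:
  fixes m m' :: "nat \<Rightarrow>\<^sub>0 nat"
  assumes "Poly_Mapping.lookup m i \<noteq> 0"
  shows "(m - Poly_Mapping.single i 1) + m' = m + m' - Poly_Mapping.single i 1"
  using assms
  by (intro poly_mapping_eqI) (auto simp: lookup_add lookup_minus lookup_single when_def)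

lemma pdiff_mult_single:
  "pdiff i (Poly_Mapping.single m c * Poly_Mapping.single m' c') =
     pdiff i (Poly_Mapping.single m c) * Poly_Mapping.single m' c' +
     Poly_Mapping.single m c * pdiff i (Poly_Mapping.single m' c')"
proof -
  have 1: "Poly_Mapping.single ((m - Poly_Mapping.single i 1) + m')
        (of_nat (Poly_Mapping.lookup m i) * c * c') =
      Poly_Mapping.single (m + m' - Poly_Mapping.single i 1)
        (of_nat (Poly_Mapping.lookup m i) * c * c')"
  proof (cases "Poly_Mapping.lookup m i = 0")
    case False
    then show ?thesis by (simp only: monomial_minus_var[OF False])
  qed simp
  have 2: "Poly_Mapping.single (m + (m' - Poly_Mapping.single i 1))
        (c * (of_nat (Poly_Mapping.lookup m' i) * c')) =
      Poly_Mapping.single (m + m' - Poly_Mapping.single i 1)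
        (c * (of_nat (Poly_Mapping.lookup m' i) * c'))"
  proof (cases "Poly_Mapping.lookup m' i = 0")
    case False
    then show ?thesis
      using monomial_minus_var[OF False, of m] by (simp only: add.commute[of m])
  qed simp
  show ?thesis
    unfolding mult_single pdiff_single 1 2
    by (simp add: single_add[symmetric] lookup_add algebra_simps)
qed

lemma pdiff_mult: "pdiff i (p * p') = pdiff i p * p' + p * pdiff i p'"
proof (induction p rule: update_induct)
  case const
  show ?case by (simp add: pdiff_0)
next
  case (update f k b)
  have "pdiff i (Poly_Mapping.single k b * p') =
      pdiff i (Poly_Mapping.single k b) * p' + Poly_Mapping.single k b * pdiff i p'"
  proof (induction p' rule: update_induct)
    case const
    show ?case by (simp add: pdiff_0)
  next
    case (update f' k' b')
    then show ?case
      by (simp add: update_eq_add_single pdiff_add pdiff_mult_single algebra_simps)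
  qed
  with update show ?case
    by (simp add: update_eq_add_single pdiff_add algebra_simps)
qed

lemma heis_derivation:
  assumes "r > 0"
  shows "heis r (p + p') = heis r p + heis r p'"
    and "heis r (scaleK c p) = scaleK c (heis r p)"
    and "heis r (p * p') = heis r p * p' + p * heis r p'"
    and "s \<ge> 1 \<Longrightarrow> heis r (avar s) =
           (if r = int s then Poly_Mapping.single 0 (qint (2 * r) * qint r / of_int r) else 0)"
proof -
  show "heis r (p + p') = heis r p + heis r p'"
    using assms by (simp add: heis_def scaleK_def pdiff_add algebra_simps)
  show "heis r (p * p') = heis r p * p' + p * heis r p'"
    using assms by (simp add: heis_def scaleK_def pdiff_mult algebra_simps)
  show "heis r (scaleK c p) = scaleK c (heis r p)"
    using assms by (simp add: heis_def scaleK_def pdiff_mult pdiff_single algebra_simps)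
  show "heis r (avar s) =
      (if r = int s then Poly_Mapping.single 0 (qint (2 * r) * qint r / of_int r) else 0)"
    if "s \<ge> 1"
    using assms that
    by (auto simp: heis_def scaleK_def avar_def pdiff_single mult_single lookup_single when_def)
qed


section \<open>The Fock spaces \<open>L\<^sub>0\<close>, \<open>L\<^sub>1\<close> and operator-valued formal series\<close>

text \<open>An element \<open>v\<close> stands for \<open>\<Sum>k. v\<^sub>k \<otimes> e\<^bsup>k\<alpha>\<^esup>\<close> in \<open>L\<^sub>0 = K(1) \<otimes> F{Q}\<close>, and for
  \<open>\<Sum>k. v\<^sub>k \<otimes> e\<^bsup>k\<alpha>+\<lambda>\<^esup>\<close> in \<open>L\<^sub>1 = K(1) \<otimes> F{Q}e\<^bsup>\<lambda>\<^esup>\<close>. Multiplication by \<open>e\<^bsup>\<alpha>\<^esup>\<close> is then the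
  shift \<open>k \<mapsto> k + 1\<close> on either space, and \<open>e\<^bsup>\<lambda>\<^esup> : L\<^sub>0 \<rightarrow> L\<^sub>1\<close> does not change coordinates.\<close>

type_synonym fock = "int \<Rightarrow>\<^sub>0 heis_module"

definition scaleL :: "qfield \<Rightarrow> fock \<Rightarrow> fock" where
  "scaleL c v = Poly_Mapping.single 0 (Poly_Mapping.single 0 c) * v"

definition heisL :: "int \<Rightarrow> fock \<Rightarrow> fock" where
  "heisL n v = Poly_Mapping.map (heis n) v"

text \<open>\<open>A v n\<close> is the coefficient of \<open>z\<^sup>n\<close> in \<open>A(z)v\<close>.\<close>

type_synonym fseries = "fock \<Rightarrow> int \<Rightarrow> fock"

text \<open>The product \<open>A(z)B(z)\<close>. \<open>Sum_any\<close> is the sum over the support of the summand, which is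
  finite for every product formed below. For \<open>x(z\<^sub>1)b(z\<^sub>2)\<close>, with \<open>b\<close> an iterated product, this
  is the statement \<open>x(z\<^sub>1)b(z\<^sub>2)v \<in> L\<^sub>1((z\<^sub>1, z\<^sub>2))\<close>, a consequence of
  \<open>x(z\<^sub>1)x(z\<^sub>2) = (z\<^sub>1 - z\<^sub>2)(z\<^sub>1 - q\<^sup>-\<^sup>2z\<^sub>2) :x(z\<^sub>1)x(z\<^sub>2):\<close> and
  \<open>x(z\<^sub>1)Y(z\<^sub>2) = (z\<^sub>1 - z\<^sub>2) :x(z\<^sub>1)Y(z\<^sub>2):\<close>.\<close>

definition fmult :: "fseries \<Rightarrow> fseries \<Rightarrow> fseries" where
  "fmult A B v n = Sum_any (\<lambda>j. A (B v j) (n - j))"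

definition fone :: fseries where
  "fone v n = (if n = 0 then v else 0)"

primrec fpow :: "fseries \<Rightarrow> nat \<Rightarrow> fseries" where
  "fpow A 0 = fone"
| "fpow A (Suc k) = fmult A (fpow A k)"

definition fexp :: "fseries \<Rightarrow> fseries" where
  "fexp A v n = Sum_any (\<lambda>k. scaleL (inverse (of_nat (fact k))) (fpow A k v n))"

definition fscale :: "qfield \<Rightarrow> fseries \<Rightarrow> fseries" where
  "fscale c A = (\<lambda>v n. scaleL c (A v n))"

text \<open>\<open>dilate c A\<close> is \<open>A(cz)\<close>.\<close>

definition dilate :: "qfield \<Rightarrow> fseries \<Rightarrow> fseries" where
  "dilate c A v n = scaleL (c powi n) (A v n)"

definition qderiv :: "fseries \<Rightarrow> fseries" where
  "qderiv A v n = scaleL (1 / (qq - 1)) (dilate qq A v (n + 1) - A v (n + 1))"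

interpretation fseries: vector_space fscale
proof
  show "fscale a (x + y) = fscale a x + fscale a y" for a x y
    by (simp add: fscale_def scaleL_def fun_eq_iff algebra_simps)
  show "fscale (a + b) x = fscale a x + fscale b x" for a b x
    by (simp add: fscale_def scaleL_def fun_eq_iff single_add algebra_simps)
  show "fscale a (fscale b x) = fscale (a * b) x" for a b x
    by (simp add: fscale_def scaleL_def fun_eq_iff mult_single mult.assoc[symmetric])
  show "fscale 1 x = x" for x
    by (simp add: fscale_def scaleL_def fun_eq_iff)
qed


section \<open>Vertex operators\<close>

text \<open>\<open>exp (\<Sum>r\<ge>1. c\<^sub>r a(-r) z\<^sup>r) exp (- \<Sum>r\<ge>1. c\<^sub>r a(r) z\<^sup>-\<^sup>r)\<close>\<close>

definition heis_exp :: "(int \<Rightarrow> qfield) \<Rightarrow> fseries" where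
  "heis_exp c = fmult
     (fexp (\<lambda>v n. if n \<ge> 1 then scaleL (c n) (heisL (- n) v) else 0))
     (fexp (\<lambda>v n. if n \<le> - 1 then - scaleL (c (- n)) (heisL (- n) v) else 0))"

text \<open>\<open>e\<^bsup>\<alpha>\<^esup> z\<^bsup>\<partial>\<alpha>\<^esup>\<close> on \<open>L\<^sub>i\<close>, using \<open>(\<alpha>, k\<alpha> + i\<lambda>) = 2k + i\<close>.\<close>

definition lattice_alpha :: "int \<Rightarrow> fseries" where
  "lattice_alpha i v n =
     (\<Sum>k\<in>{k\<in>Poly_Mapping.keys v. 2 * k + i = n}.
        Poly_Mapping.single (k + 1) (Poly_Mapping.lookup v k))"

text \<open>\<open>e\<^bsup>\<lambda>\<^esup> (-z)\<^bsup>\<partial>\<lambda>\<^esup> : L\<^sub>0 \<rightarrow> L\<^sub>1((z))\<close>, using \<open>(\<lambda>, k\<alpha>) = k\<close>.\<close>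

definition lattice_lambda :: fseries where
  "lattice_lambda v n =
     (\<Sum>k\<in>{k\<in>Poly_Mapping.keys v. k = n}.
        Poly_Mapping.single k (scaleK ((- 1) powi k) (Poly_Mapping.lookup v k)))"

text \<open>The Frenkel--Jing operator on \<open>L\<^sub>i\<close>, \<open>i \<in> {0, 1}\<close>.\<close>

definition frenkel_jing :: "int \<Rightarrow> fseries" where
  "frenkel_jing i = fmult (heis_exp (\<lambda>r. qhalf powi (- r) / qint r)) (lattice_alpha i)"

definition koyama :: fseries where
  "koyama = fmult (heis_exp (\<lambda>r. qhalf powi r / qint (2 * r))) lattice_lambda"

text \<open>\<open>x(z)\<^sub>l b(z)\<close> for \<open>l \<le> -1\<close> and \<open>b(z) \<in> Hom(L\<^sub>0, L\<^sub>1((z)))\<close>, so that \<open>x(z)\<close> acts on \<open>L\<^sub>1\<close>.\<close>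

definition xprod :: "int \<Rightarrow> fseries \<Rightarrow> fseries" where
  "xprod l b = fscale (1 / qqfact (nat (- l - 1)))
     (fmult ((qderiv ^^ nat (- l - 1)) (frenkel_jing 1)) (dilate (qq powi (- l - 1)) b))"

text \<open>\<open>xmonomial [l\<^sub>1, \<dots>, l\<^sub>m]\<close> is \<open>x(z)\<^bsub>l\<^sub>m\<^esub> \<dots> x(z)\<^bsub>l\<^sub>1\<^esub> Y(z)\<close>.\<close>

definition xmonomial :: "int list \<Rightarrow> fseries" where
  "xmonomial ls = fold xprod ls koyama"

text \<open>\<open>Hom(L\<^sub>0, L\<^sub>1((z)))\<close> is a linear subspace of the space of all functions of type
  \<open>fseries\<close>, so spans and linear independence may be taken in the latter.\<close>

definition W1 :: "fseries set" where
  "W1 = fseries.span {xmonomial ls | ls. \<forall>l\<in>set ls. l \<le> - 1}"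

definition basisW1 :: "fseries set" where
  "basisW1 = {xmonomial ls | ls.
     (\<forall>j<length ls. if j = 0 then ls ! j \<le> - 2 else ls ! j \<le> - 3)}"

end

theory Submission
  imports Defs "HOL-Computational_Algebra.Polynomial_FPS"
begin

text \<open>
  A product \<open>x(u\<^sub>1z) \<dots> x(u\<^sub>mz)Y(wz)\<close> is a scalar times a normally ordered product, the scalar being
  \<open>\<Prod>\<^bsub>i<j\<^esub> (1 - u\<^sub>j/u\<^sub>i)(1 - u\<^sub>j/(qq u\<^sub>i)) \<Prod>\<^sub>i (1 - w/u\<^sub>i)\<close>. It vanishes if \<open>u\<^sub>j \<in> {u\<^sub>i, qq u\<^sub>i}\<close> for some
  \<open>i < j\<close>. Up to a power of \<open>z\<close>, a \<open>qq\<close>-derivative is a divided difference at powers of \<open>qq\<close>, so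
  every monomial is a finite combination of such normally ordered products.

  Spanning. With \<open>x\<^sub>n\<close> for the operation \<open>x(z)\<^sub>-\<^sub>n\<^sub>-\<^sub>1\<close>, the two zeros of the contraction give
  \<open>\<Sum>\<^sub>n x\<^sub>n x\<^bsub>N-n\<^esub> b = 0\<close> (the Leibniz rule for divided differences) and
  \<open>\<Sum>\<^sub>n qq\<^sup>-\<^sup>n x\<^sub>n x\<^bsub>N-n\<^esub> b = 0\<close>. They eliminate the terms with \<open>n \<in> {0, 1}\<close>, and \<open>x\<^sub>0 Y = 0\<close>.

  Independence. On the vacuum, the coefficients of \<open>a(-1)\<^sup>j\<close> are combinations of \<open>j\<close>-th powers of
  pairwise distinct scalars, one for each set of exponents \<open>e\<^sub>1, \<dots>, e\<^sub>m\<close> with \<open>u\<^sub>i = qq\<^bsup>e\<^sub>i\<^esup>\<close>. So each set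
  of exponents can be read off separately, and the smallest exponents occurring in a monomial
  determine it.
\<close>

section \<open>The ground field\<close>

text \<open>Write \<open>n = -l - 1\<close>; the bounds on \<open>l\<close> become
  \<open>n >= 1\<close> for the innermost index and \<open>n >= 2\<close> for the others. Both
  halves of the proof meet these bounds through the zeros of the contraction. For a fixed sum of two
  adjacent indices, each of the two zeros yields one linear relation, so exactly the two values 0
  and 1 of the outer index can be eliminated. Conversely, the smallest exponents of a monomial are
  the partial sums of its indices, outermost first and starting with 0; their contraction survives
  because all their gaps are at least 2 and the innermost index is at least 1. The partial sums omit
  the innermost index. It is recovered from the total index \<open>N\<close>, which is visible in
  the power of \<open>z\<close>; this is why monomials are compared only after fixing the number of
  factors and \<open>N\<close>. The obstacle is that a product of series is a
  \<open>Sum_any\<close>, so linearity of \<open>x(z)_l\<close> depends on finite supports. The work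
  therefore stays inside the span of the normally ordered products, where supports are finite
  because the contraction is a polynomial.\<close>

lemma of_nat_qfield_nonzero [simp]:
  assumes "n \<noteq> 0"
  shows "(of_nat n :: qfield) \<noteq> 0"
proof -
  have "Fraction_Field.Fract (of_nat n :: complex poly) 1 \<noteq> Fraction_Field.Fract 0 1"
    using assms by (simp only: eq_fract one_neq_zero not_False_eq_True) simp
  then show ?thesis
    by (simp only: of_nat_fract Zero_fract_def not_False_eq_True)
qed

lemma fact_qfield_nonzero [simp]: "(of_nat (fact n) :: qfield) \<noteq> 0"
  by (rule of_nat_qfield_nonzero) simp

lemma qhalf_power: "qhalf ^ n = Fraction_Field.Fract (monom 1 n) 1"
proof (induction n)
  case 0
  show ?case by (simp only: power_0 One_fract_def monom_eq_1)
next
  case (Suc n)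
  have "[:0, 1:] * monom 1 n = (monom 1 (Suc n) :: complex poly)"
    by (simp add: monom_Suc)
  with Suc show ?case by (simp add: qhalf_def)
qed

lemma qhalf_nonzero [simp]: "qhalf \<noteq> 0"
proof -
  have "Fraction_Field.Fract ([:0, 1:] :: complex poly) 1 \<noteq> Fraction_Field.Fract 0 1"
    by (simp only: eq_fract one_neq_zero not_False_eq_True) simp
  then show ?thesis
    by (simp only: qhalf_def Zero_fract_def not_False_eq_True)
qed

lemma qvar_nonzero [simp]: "qvar \<noteq> 0"
  by (simp add: qvar_def)

lemma qq_nonzero [simp]: "qq \<noteq> 0"
  by (simp add: qq_def)

lemma qq_eq_qhalf_power: "qq = qhalf ^ 4"
  by (simp only: qq_def qvar_def power_mult[symmetric]) simp

lemma qhalf_power_eq_iff [simp]: "qhalf ^ m = qhalf ^ n \<longleftrightarrow> m = n"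
proof -
  have "monom 1 m = (monom 1 n :: complex poly) \<longleftrightarrow> m = n"
    by (metis degree_monom_eq one_neq_zero)
  then show ?thesis by (simp add: qhalf_power eq_fract)
qed

lemma qq_power_eq_iff [simp]: "qq ^ m = qq ^ n \<longleftrightarrow> m = n"
  by (simp only: qq_eq_qhalf_power power_mult[symmetric] qhalf_power_eq_iff) simp

lemma qq_power_eq_1_iff [simp]: "qq ^ n = 1 \<longleftrightarrow> n = 0"
  using qq_power_eq_iff[of n 0] by simp

lemma qvar_power_eq_iff [simp]: "qvar ^ m = qvar ^ n \<longleftrightarrow> m = n"
  by (simp only: qvar_def power_mult[symmetric] qhalf_power_eq_iff) simp

lemma qint_nonzero:
  assumes "r \<ge> 1"
  shows "qint (int r) \<noteq> 0"
proof -
  have "qvar ^ r - inverse (qvar ^ r) \<noteq> 0" if "r \<ge> 1" for r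
  proof
    assume "qvar ^ r - inverse (qvar ^ r) = 0"
    then have "qvar ^ r * qvar ^ r = 1"
      by (simp add: field_simps)
    then have "qvar ^ (r + r) = qvar ^ 0"
      by (simp only: power_add power_0)
    then show False using that by (simp only: qvar_power_eq_iff)
  qed
  from this[OF assms] this[of 1] show ?thesis
    by (simp add: qint_def power_int_minus)
qed

text \<open>The two summands of the first factor become the two linear factors in the contraction of
  \<open>x\<close> with \<open>x\<close>.\<close>

lemma qint_double:
  assumes "r \<ge> 1"
  shows "qint (2 * int r) = (qvar ^ r + inverse (qvar ^ r)) * qint (int r)"
proof -
  have "qvar powi (2 * int r) = qvar ^ r * qvar ^ r"
    using power_int_of_nat[of qvar "2 * r"] by (simp add: power_mult power2_eq_square flip: power_mult_distrib)
  then have "qvar powi (2 * int r) - inverse (qvar powi (2 * int r)) =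
      (qvar ^ r + inverse (qvar ^ r)) * (qvar ^ r - inverse (qvar ^ r))"
    by (simp add: algebra_simps)
  then show ?thesis
    by (simp add: qint_def power_int_minus)
qed


section \<open>The polynomial algebra \<open>K(1)\<close>\<close>

definition cst :: "qfield \<Rightarrow> heis_module" where
  "cst c = Poly_Mapping.single 0 c"

text \<open>The value of the commutator of \<open>a(r)\<close> and \<open>a(-r)\<close>.\<close>

definition heis_norm :: "nat \<Rightarrow> qfield" where
  "heis_norm r = qint (2 * int r) * qint (int r) / of_nat r"

lemma cst_0 [simp]: "cst 0 = 0" and cst_1 [simp]: "cst 1 = 1"
  by (simp_all add: cst_def)

lemma cst_add: "cst (c + d) = cst c + cst d"
  by (simp add: cst_def single_add)

lemma cst_mult: "cst (c * d) = cst c * cst d"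
  by (simp add: cst_def mult_single)

lemma cst_uminus: "cst (- c) = - cst c"
  by (simp add: cst_def single_uminus)

lemma cst_of_nat: "cst (of_nat n) = of_nat n"
  by (induction n) (simp_all add: cst_add)

lemma cst_sum: "cst (sum f A) = (\<Sum>x\<in>A. cst (f x))"
  by (induction A rule: infinite_finite_induct) (simp_all add: cst_add)

lemma lookup_single_0_mult:
  fixes p :: "'a::comm_monoid_add \<Rightarrow>\<^sub>0 'b::semiring_0"
  shows "Poly_Mapping.lookup (Poly_Mapping.single 0 c * p) m = c * Poly_Mapping.lookup p m"
proof (induction p rule: update_induct)
  case (update f k b)
  then show ?case
    by (simp add: update_eq_add_single lookup_add ring_distribs mult_single lookup_single when_def)
qed simp

lemma lookup_cst_mult: "Poly_Mapping.lookup (cst c * p) m = c * Poly_Mapping.lookup p m"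
  by (simp add: cst_def lookup_single_0_mult)

lemma scaleK_eq_cst_mult: "scaleK c p = cst c * p"
  by (simp add: scaleK_def cst_def)

lemma of_nat_mult_cancel_heis_module:
  fixes p p' :: heis_module
  assumes "of_nat n * p = of_nat n * p'" "n \<noteq> 0"
  shows "p = p'"
proof -
  have "cst (inverse (of_nat n)) * (of_nat n * q) = q" for q
    using assms(2) by (simp add: mult.assoc[symmetric] flip: cst_of_nat cst_mult)
  with assms(1) show ?thesis by metis
qed

text \<open>Operators on \<open>K(1)\<close> are known through their behaviour on constants and
  their commutation with the generators, so identities between them are proved along multiplication
  by \<open>avar r\<close>.\<close>

lemma heis_module_induct [case_names cst add avar]:
  assumes cst: "\<And>c. P (cst c)"
    and add: "\<And>p p'. P p \<Longrightarrow> P p' \<Longrightarrow> P (p + p')"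
    and avar: "\<And>r p. r \<ge> 1 \<Longrightarrow> P p \<Longrightarrow> P (avar r * p)"
  shows "P p"
proof (induction p rule: update_induct)
  case const
  show ?case using cst[of 0] by simp
next
  case (update f k b)
  have "P (Poly_Mapping.single k b)"
  proof (induction k rule: update_induct)
    case const
    show ?case using cst[of b] by (simp add: cst_def)
  next
    case (update g i n)
    have "P (Poly_Mapping.single (g + Poly_Mapping.single i n) b)" for n
    proof (induction n)
      case 0
      show ?case using update by simp
    next
      case (Suc n)
      have "Poly_Mapping.single (g + Poly_Mapping.single i (Suc n)) b =
          avar (Suc i) * Poly_Mapping.single (g + Poly_Mapping.single i n) b"
        by (simp add: avar_def mult_single algebra_simps flip: single_add)
      then show ?case using Suc avar[of "Suc i"] by simp
    qed
    then show ?case using update by (simp add: update_eq_add_single)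
  qed
  then show ?case using update add by (simp add: update_eq_add_single)
qed

lemma heis_pos:
  assumes "r \<ge> 1"
  shows heis_pos_add: "heis (int r) (p + p') = heis (int r) p + heis (int r) p'"
    and heis_pos_cst_mult: "heis (int r) (cst c * p) = cst c * heis (int r) p"
    and heis_pos_avar_mult: "s \<ge> 1 \<Longrightarrow> heis (int r) (avar s * p) =
      avar s * heis (int r) p + (if r = s then cst (heis_norm r) * p else 0)"
  using heis_derivation[of "int r"] assms
  by (auto simp: scaleK_eq_cst_mult heis_norm_def cst_def)

lemma heis_pos_0: "r \<ge> 1 \<Longrightarrow> heis (int r) 0 = 0"
  using heis_pos_cst_mult[of r 0 0] by simp

lemma heis_pos_cst: "r \<ge> 1 \<Longrightarrow> heis (int r) (cst c) = 0"
  by (simp add: heis_def cst_def pdiff_single scaleK_def)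

lemma heis_neg: "r \<ge> 1 \<Longrightarrow> heis (- int r) p = avar r * p"
  by (simp add: heis_def)

lemma heis_0: "n \<noteq> 0 \<Longrightarrow> heis n 0 = 0"
  by (simp add: heis_def pdiff_0 scaleK_def)


section \<open>Exponentials of annihilation operators\<close>

text \<open>\<open>dcoeff b k n p\<close> is the coefficient of \<open>z\<^sup>-\<^sup>n\<close> in
  \<open>(- \<Sum>r\<ge>1. b\<^sub>r a(r) z\<^sup>-\<^sup>r)\<^sup>k p\<close>, and \<open>anni b n p\<close> is that of the exponential series.\<close>

primrec dcoeff :: "(int \<Rightarrow> qfield) \<Rightarrow> nat \<Rightarrow> nat \<Rightarrow> heis_module \<Rightarrow> heis_module" where
  "dcoeff b 0 n p = (if n = 0 then p else 0)"
| "dcoeff b (Suc k) n p = (\<Sum>r=1..n. - cst (b (int r)) * heis (int r) (dcoeff b k (n - r) p))"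

definition anni :: "(int \<Rightarrow> qfield) \<Rightarrow> nat \<Rightarrow> heis_module \<Rightarrow> heis_module" where
  "anni b n p = (\<Sum>k\<le>n. cst (inverse (of_nat (fact k))) * dcoeff b k n p)"

lemma dcoeff_eq_0: "n < k \<Longrightarrow> dcoeff b k n p = 0"
proof (induction k arbitrary: n)
  case (Suc k)
  then show ?case by (auto intro!: sum.neutral simp: heis_pos_0)
qed simp

lemma anni_eq_sum:
  assumes "n \<le> N"
  shows "anni b n p = (\<Sum>k\<le>N. cst (inverse (of_nat (fact k))) * dcoeff b k n p)"
  unfolding anni_def
  by (rule sum.mono_neutral_left) (use assms in \<open>auto simp: dcoeff_eq_0 not_le\<close>)

lemma dcoeff_add: "dcoeff b k n (p + p') = dcoeff b k n p + dcoeff b k n p'"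
  by (induction k arbitrary: n)
     (simp_all add: heis_pos_add algebra_simps flip: sum.distrib)

lemma dcoeff_cst_mult: "dcoeff b k n (cst c * p) = cst c * dcoeff b k n p"
proof (induction k arbitrary: n)
  case (Suc k)
  then show ?case
    by (simp add: heis_pos_cst_mult sum_distrib_left mult_ac)
qed simp

lemma anni_add: "anni b n (p + p') = anni b n p + anni b n p'"
  by (simp add: anni_def dcoeff_add algebra_simps sum.distrib)

lemma anni_cst_mult: "anni b n (cst c * p) = cst c * anni b n p"
  unfolding anni_def dcoeff_cst_mult by (simp add: sum_distrib_left mult_ac)

lemma anni_0 [simp]: "anni b n 0 = 0"
  using anni_cst_mult[of b n 0 0] by simp

lemma anni_sum: "anni b n (sum f A) = (\<Sum>x\<in>A. anni b n (f x))"
  by (induction A rule: infinite_finite_induct) (simp_all add: anni_add)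

lemma dcoeff_1: "dcoeff b k n 1 = (if k = 0 \<and> n = 0 then 1 else 0)"
proof (induction k arbitrary: n)
  case (Suc k)
  have "heis (int r) (dcoeff b k (n - r) 1) = 0" if "r \<ge> 1" for r
    using heis_pos_cst[OF that, of 1] heis_pos_0[OF that] by (auto simp: Suc)
  then show ?case by (auto intro!: sum.neutral)
qed simp

lemma anni_1: "anni b n 1 = (if n = 0 then 1 else 0)"
proof -
  have "anni b n 1 = (\<Sum>k\<le>n. if k = 0 then if n = 0 then 1 else 0 else 0)"
    unfolding anni_def by (rule sum.cong) (auto simp: dcoeff_1)
  then show ?thesis by simp
qed

text \<open>The exponent \<open>D\<close> is a derivation that sends \<open>avar s\<close> to a
  scalar, so the commutator of \<open>D\<close> with multiplication by \<open>avar s\<close> is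
  central and the commutator of its \<open>k\<close>-th power is \<open>k\<close> times that scalar
  times the power \<open>k - 1\<close>.\<close>

lemma dcoeff_avar_mult:
  assumes "s \<ge> 1"
  shows "dcoeff b k n (avar s * p) = avar s * dcoeff b k n p -
    (if k = 0 \<or> n < s then 0
     else of_nat k * cst (b (int s) * heis_norm s) * dcoeff b (k - 1) (n - s) p)"
proof (induction k arbitrary: n)
  case (Suc k)
  let ?B = "cst (b (int s) * heis_norm s)"
  let ?h = "\<lambda>r k m. - cst (b (int r)) * heis (int r) (dcoeff b k m p)"
  have "dcoeff b (Suc k) n (avar s * p) = (\<Sum>r=1..n. avar s * ?h r k (n - r)
      - (if r = s then ?B * dcoeff b k (n - r) p else 0)
      - (if k = 0 \<or> n - r < s then 0 else of_nat k * ?B * ?h r (k - 1) (n - r - s)))"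
    unfolding dcoeff.simps
  proof (rule sum.cong[OF refl])
    fix r assume "r \<in> {1..n}"
    then have r: "r \<ge> 1" by simp
    have lin: "heis (int r) (p - p') = heis (int r) p - heis (int r) p'" for p p'
      using heis_pos_add[OF r, of p "cst (-1) * p'"] heis_pos_cst_mult[OF r, of "-1" p']
      by (simp add: cst_uminus)
    have nat: "heis (int r) (of_nat k * cst c * q) = of_nat k * cst c * heis (int r) q" for c q
      using heis_pos_cst_mult[OF r, of "of_nat k * c" q] by (simp add: cst_mult cst_of_nat)
    have if_heis: "heis (int r) (if Q then 0 else of_nat k * cst c * q) =
        (if Q then 0 else of_nat k * cst c * heis (int r) q)" for Q c q
      using heis_pos_0[OF r] by (simp add: nat)
    show "- cst (b (int r)) * heis (int r) (dcoeff b k (n - r) (avar s * p)) =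
      avar s * ?h r k (n - r)
      - (if r = s then ?B * dcoeff b k (n - r) p else 0)
      - (if k = 0 \<or> n - r < s then 0 else of_nat k * ?B * ?h r (k - 1) (n - r - s))"
      unfolding Suc lin if_heis heis_pos_avar_mult[OF r assms]
      by (simp add: cst_mult right_diff_distrib distrib_left mult_ac del: of_nat_Suc cong: if_cong)
  qed
  also have "\<dots> = avar s * dcoeff b (Suc k) n p - (if n < s then 0 else ?B * dcoeff b k (n - s) p)
      - (\<Sum>r=1..n. if k = 0 \<or> n - r < s then 0 else of_nat k * ?B * ?h r (k - 1) (n - r - s))"
    using assms by (simp add: sum_subtractf sum_distrib_left sum.delta not_less)
  also have "(\<Sum>r=1..n. if k = 0 \<or> n - r < s then 0 else of_nat k * ?B * ?h r (k - 1) (n - r - s)) =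
      (if n < s then 0 else of_nat k * ?B * dcoeff b k (n - s) p)"
  proof (cases "k = 0 \<or> n < s")
    case True
    then show ?thesis by (auto intro!: sum.neutral)
  next
    case False
    then obtain k' where k: "k = Suc k'" by (cases k) auto
    have "(\<Sum>r=1..n. if k = 0 \<or> n - r < s then 0 else of_nat k * ?B * ?h r (k - 1) (n - r - s)) =
        (\<Sum>r=1..n-s. of_nat k * ?B * ?h r (k - 1) (n - s - r))"
      by (rule sum.mono_neutral_cong_right) (use False assms in \<open>auto simp: add.commute\<close>)
    also have "\<dots> = of_nat k * ?B * dcoeff b k (n - s) p"
      unfolding k by (simp add: sum_distrib_left del: of_nat_Suc)
    finally show ?thesis using False by simp
  qed
  finally have "dcoeff b (Suc k) n (avar s * p) = avar s * dcoeff b (Suc k) n p -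
      (if n < s then 0 else ?B * dcoeff b k (n - s) p) -
      (if n < s then 0 else of_nat k * ?B * dcoeff b k (n - s) p)" .
  then show ?case
    by (cases "n < s") (simp_all add: ring_distribs del: dcoeff.simps)
qed simp

lemma inverse_fact_Suc_mult:
  "cst (inverse (of_nat (fact (Suc k)))) * (of_nat (Suc k) * q) = cst (inverse (of_nat (fact k))) * q"
proof -
  have "of_nat (fact (Suc k)) = (of_nat (Suc k) * of_nat (fact k) :: qfield)"
    by (simp only: fact_Suc of_nat_mult of_nat_id)
  then have inv: "inverse (of_nat (fact (Suc k))) * of_nat (Suc k) =
      (inverse (of_nat (fact k)) :: qfield)"
    using of_nat_qfield_nonzero[of "Suc k"] by (simp del: of_nat_Suc fact_Suc)
  have "cst (inverse (of_nat (fact (Suc k)))) * (of_nat (Suc k) * q) =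
      cst (inverse (of_nat (fact (Suc k))) * of_nat (Suc k)) * q"
    by (simp only: cst_mult cst_of_nat mult.assoc)
  then show ?thesis by (simp only: inv)
qed

text \<open>Dividing by \<open>k!\<close> and summing, conjugation by the exponential translates the
  generator \<open>avar s\<close> by a scalar multiple of the power \<open>-s\<close> of
  \<open>z\<close>.\<close>

lemma anni_avar_mult:
  assumes "s \<ge> 1"
  shows "anni b n (avar s * p) = avar s * anni b n p -
    (if n < s then 0 else cst (b (int s) * heis_norm s) * anni b (n - s) p)"
proof -
  let ?B = "cst (b (int s) * heis_norm s)"
  let ?f = "\<lambda>k. cst (inverse (of_nat (fact k)))"
  have "anni b n (avar s * p) = (\<Sum>k\<le>n. avar s * (?f k * dcoeff b k n p)) -
      (\<Sum>k\<le>n. ?f k * (if k = 0 \<or> n < s then 0 else of_nat k * ?B * dcoeff b (k - 1) (n - s) p))"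
    unfolding anni_def dcoeff_avar_mult[OF assms] sum_subtractf[symmetric]
    by (rule sum.cong) (simp_all add: right_diff_distrib mult.left_commute)
  also have "(\<Sum>k\<le>n. ?f k * (if k = 0 \<or> n < s then 0 else of_nat k * ?B * dcoeff b (k - 1) (n - s) p)) =
      (if n < s then 0 else ?B * anni b (n - s) p)"
  proof (cases "n < s")
    case False
    then obtain n' where n: "n = Suc n'" using assms by (cases n) auto
    have "(\<Sum>k\<le>n. ?f k * (if k = 0 \<or> n < s then 0 else of_nat k * ?B * dcoeff b (k - 1) (n - s) p)) =
        (\<Sum>k\<le>n'. ?f (Suc k) * (of_nat (Suc k) * (?B * dcoeff b k (n - s) p)))"
      unfolding n sum.atMost_Suc_shift using False n by (simp add: mult.assoc del: of_nat_Suc fact_Suc)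
    also have "\<dots> = ?B * (\<Sum>k\<le>n'. ?f k * dcoeff b k (n - s) p)"
      unfolding inverse_fact_Suc_mult by (simp add: sum_distrib_left mult_ac)
    also have "(\<Sum>k\<le>n'. ?f k * dcoeff b k (n - s) p) = anni b (n - s) p"
      by (rule anni_eq_sum[symmetric]) (use n assms in auto)
    finally show ?thesis using False by simp
  qed simp
  finally show ?thesis by (simp add: anni_def sum_distrib_left)
qed

unbundle fps_syntax

text \<open>The variable \<open>fps_X\<close> stands for the inverse of \<open>z\<close>, since
  annihilation operators carry negative powers.\<close>

definition annif :: "(int \<Rightarrow> qfield) \<Rightarrow> heis_module \<Rightarrow> heis_module fps" where
  "annif b p = Abs_fps (\<lambda>n. anni b n p)"

lemma annif_nth [simp]: "annif b p $ n = anni b n p"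
  by (simp add: annif_def)

lemma annif_add: "annif b (p + p') = annif b p + annif b p'"
  by (rule fps_ext) (simp add: anni_add)

lemma annif_cst: "annif b (cst c) = fps_const (cst c)"
  using anni_cst_mult[of b _ c 1] by (intro fps_ext) (simp add: anni_1)

lemma annif_avar_mult:
  assumes "s \<ge> 1"
  shows "annif b (avar s * p) =
    (fps_const (avar s) - fps_const (cst (b (int s) * heis_norm s)) * fps_X ^ s) * annif b p"
  by (rule fps_ext)
     (simp add: anni_avar_mult[OF assms] left_diff_distrib mult.assoc fps_X_power_mult_nth)

text \<open>The exponential of a derivation is an algebra homomorphism; here it suffices that each
  generator is mapped to a fixed factor.\<close>

lemma annif_mult: "annif b (p * p') = annif b p * annif b p'"
proof (induction p rule: heis_module_induct)
  case (cst c)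
  show ?case by (rule fps_ext) (simp add: annif_cst anni_cst_mult)
next
  case (add p q)
  then show ?case by (simp add: annif_add distrib_right)
next
  case (avar r p)
  then show ?case by (simp add: annif_avar_mult mult.assoc)
qed

lemma anni_mult: "anni b n (p * p') = (\<Sum>i\<le>n. anni b i p * anni b (n - i) p')"
  using annif_mult[of b p p'] by (auto simp: fps_eq_iff fps_mult_nth atMost_atLeast0)

text \<open>Local finiteness of the annihilation part: only finitely many negative powers of
  \<open>z\<close> occur, which makes the sum in \<open>Vop\<close> finite.\<close>

lemma anni_bounded: "\<exists>d. \<forall>n>d. anni b n p = 0"
proof (induction p rule: heis_module_induct)
  case (cst c)
  show ?case using anni_cst_mult[of b _ c 1] by (auto simp: anni_1)
next
  case (add p q)
  then obtain d d' where "\<forall>n>d. anni b n p = 0" "\<forall>n>d'. anni b n q = 0" by blast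
  then show ?case by (intro exI[of _ "max d d'"]) (simp add: anni_add)
next
  case (avar r p)
  then obtain d where "\<forall>n>d. anni b n p = 0" by blast
  with avar(1) show ?case by (intro exI[of _ "d + r"]) (auto simp: anni_avar_mult)
qed

lemma sum_convolution_shift:
  fixes f :: "nat \<Rightarrow> nat \<Rightarrow> 'a :: comm_monoid_add"
  shows "(\<Sum>i\<le>n. if i < s then 0 else f (i - s) (n - i)) =
      (if n < s then 0 else \<Sum>i\<le>n-s. f i (n - s - i))"
    and "(\<Sum>i\<le>n. if n - i < s then 0 else f i (n - i - s)) =
      (if n < s then 0 else \<Sum>i\<le>n-s. f i (n - s - i))"
proof -
  show "(\<Sum>i\<le>n. if i < s then 0 else f (i - s) (n - i)) =
      (if n < s then 0 else \<Sum>i\<le>n-s. f i (n - s - i))"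
  proof (cases "n < s")
    case False
    have "(\<Sum>i\<le>n. if i < s then 0 else f (i - s) (n - i)) = (\<Sum>i\<in>{s..n}. f (i - s) (n - i))"
      by (rule sum.mono_neutral_cong_right) auto
    also have "\<dots> = (\<Sum>i\<le>n-s. f i (n - s - i))"
      by (rule sum.reindex_bij_witness[of _ "\<lambda>i. i + s" "\<lambda>i. i - s"]) (use False in auto)
    finally show ?thesis using False by simp
  qed (auto intro!: sum.neutral)
  show "(\<Sum>i\<le>n. if n - i < s then 0 else f i (n - i - s)) =
      (if n < s then 0 else \<Sum>i\<le>n-s. f i (n - s - i))"
  proof (cases "n < s")
    case False
    have "(\<Sum>i\<le>n. if n - i < s then 0 else f i (n - i - s)) = (\<Sum>i\<le>n-s. f i (n - s - i))"
    proof (rule sum.mono_neutral_cong_right)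
      show "\<forall>i\<in>{..n} - {..n - s}. (if n - i < s then 0 else f i (n - i - s)) = 0"
        using False by auto
      fix i assume "i \<in> {..n - s}"
      then have "\<not> n - i < s" "n - i - s = n - s - i" using False by auto
      then show "(if n - i < s then 0 else f i (n - i - s)) = f i (n - s - i)" by simp
    qed auto
    then show ?thesis using False by simp
  qed (auto intro!: sum.neutral)
qed

text \<open>Exponentials of commuting operators multiply. Both sides translate the generator
  \<open>avar s\<close> by the same scalar and fix constants, so the induction over generators
  identifies them.\<close>

lemma anni_comp:
  "(\<Sum>i\<le>n. anni b i (anni b' (n - i) p)) = anni (\<lambda>r. b r + b' r) n p"
proof -
  define g where "g p = Abs_fps (\<lambda>n. \<Sum>i\<le>n. anni b i (anni b' (n - i) p))" for p
  have g_add: "g (p + q) = g p + g q" for p q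
    by (rule fps_ext) (simp add: g_def anni_add sum.distrib)
  have g_cst: "g (cst c) = fps_const (cst c)" for c
  proof (rule fps_ext)
    fix n
    have "anni b' m (cst c) = (if m = 0 then cst c else 0)" for b' m
      using anni_cst_mult[of b' m c 1] by (simp add: anni_1)
    then have "g (cst c) $ n = (\<Sum>i\<le>n. if i = n then if n = 0 then cst c else 0 else 0)"
      unfolding g_def fps_nth_Abs_fps by (intro sum.cong) auto
    then show "g (cst c) $ n = fps_const (cst c) $ n" by simp
  qed
  have g_avar: "g (avar s * p) = (fps_const (avar s) -
      fps_const (cst ((b (int s) + b' (int s)) * heis_norm s)) * fps_X ^ s) * g p"
    if s: "s \<ge> 1" for s p
  proof (rule fps_ext)
    fix n
    let ?B = "cst (b (int s) * heis_norm s)" and ?B' = "cst (b' (int s) * heis_norm s)"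
    have minus: "anni b i (q - q') = anni b i q - anni b i q'" for i q q'
      using anni_add[of b i q "cst (-1) * q'"] anni_cst_mult[of b i "-1" q']
      by (simp add: cst_uminus)
    have "g (avar s * p) $ n =
       (\<Sum>i\<le>n. avar s * anni b i (anni b' (n - i) p)) -
       (\<Sum>i\<le>n. if i < s then 0 else ?B * anni b (i - s) (anni b' (n - i) p)) -
       (\<Sum>i\<le>n. if n - i < s then 0 else ?B' * anni b i (anni b' (n - i - s) p))"
      unfolding g_def
      by (auto simp: anni_avar_mult[OF s] minus anni_cst_mult simp flip: sum_subtractf intro!: sum.cong)
    also have "\<dots> = avar s * g p $ n - (if n < s then 0 else (?B + ?B') * g p $ (n - s))"
      unfolding sum_convolution_shift[where f = "\<lambda>i j. ?B * anni b i (anni b' j p)"]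
        sum_convolution_shift[where f = "\<lambda>i j. ?B' * anni b i (anni b' j p)"]
      by (simp add: g_def sum_distrib_left distrib_right sum.distrib)
    finally show "g (avar s * p) $ n = ((fps_const (avar s) -
      fps_const (cst ((b (int s) + b' (int s)) * heis_norm s)) * fps_X ^ s) * g p) $ n"
      by (simp add: left_diff_distrib distrib_right cst_add mult.assoc fps_X_power_mult_nth)
  qed
  have "g p = annif (\<lambda>r. b r + b' r) p"
  proof (induction p rule: heis_module_induct)
    case (cst c)
    show ?case by (simp add: g_cst annif_cst)
  next
    case (add p q)
    then show ?case by (simp add: g_add annif_add)
  next
    case (avar r p)
    then show ?case by (simp add: g_avar annif_avar_mult)
  qed
  then show ?thesis by (simp add: g_def fps_eq_iff)
qed


section \<open>Exponentials of creation operators\<close>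

definition cseries :: "(int \<Rightarrow> qfield) \<Rightarrow> heis_module fps" where
  "cseries a = Abs_fps (\<lambda>n. if n = 0 then 0 else cst (a (int n)) * avar n)"

definition crea :: "(int \<Rightarrow> qfield) \<Rightarrow> heis_module fps" where
  "crea a = Abs_fps (\<lambda>n. \<Sum>k\<le>n. cst (inverse (of_nat (fact k))) * (cseries a ^ k) $ n)"

lemma cseries_power_nth_eq_0: "n < k \<Longrightarrow> (cseries a ^ k) $ n = 0"
  by (rule startsby_zero_power_prefix[rule_format]) (simp_all add: cseries_def)

lemma crea_nth_eq_sum:
  assumes "n \<le> N"
  shows "crea a $ n = (\<Sum>k\<le>N. cst (inverse (of_nat (fact k))) * (cseries a ^ k) $ n)"
  unfolding crea_def fps_nth_Abs_fps
  by (rule sum.mono_neutral_left) (use assms in \<open>auto simp: cseries_power_nth_eq_0 not_le\<close>)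

lemma crea_0 [simp]: "crea a $ 0 = 1"
  by (simp add: crea_def)

text \<open>The differential equation of the exponential; additivity of \<open>crea\<close> and the
  recursion \<open>crea_rec\<close> are both read off from it.\<close>

lemma fps_deriv_crea: "fps_deriv (crea a) = fps_deriv (cseries a) * crea a"
proof (rule fps_ext)
  fix n
  let ?f = "\<lambda>k. cst (inverse (of_nat (fact k)))"
  let ?H = "cseries a"
  have "fps_deriv (crea a) $ n = (\<Sum>k\<le>Suc n. ?f k * fps_deriv (?H ^ k) $ n)"
    by (simp add: crea_nth_eq_sum[of "Suc n" "Suc n"] sum_distrib_left mult.left_commute
        del: sum.atMost_Suc)
  also have "\<dots> = (\<Sum>k\<le>n. ?f (Suc k) * (of_nat (Suc k) * (fps_deriv ?H * ?H ^ k) $ n))"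
    unfolding sum.atMost_Suc_shift
    by (simp add: fps_deriv_power mult.assoc del: of_nat_Suc fact_Suc power_Suc)
  also have "\<dots> = (\<Sum>k\<le>n. \<Sum>i=0..n. fps_deriv ?H $ i * (?f k * (?H ^ k) $ (n - i)))"
    unfolding inverse_fact_Suc_mult
    by (simp add: fps_mult_nth sum_distrib_left mult_ac)
  also have "\<dots> = (\<Sum>i=0..n. fps_deriv ?H $ i * crea a $ (n - i))"
  proof -
    have "crea a $ (n - i) = (\<Sum>k\<le>n. ?f k * (?H ^ k) $ (n - i))" for i
      by (rule crea_nth_eq_sum) simp
    then show ?thesis
      by (simp only: sum_distrib_left) (rule sum.swap)
  qed
  finally show "fps_deriv (crea a) $ n = (fps_deriv ?H * crea a) $ n"
    by (simp only: fps_mult_nth)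
qed

text \<open>The equation determines the coefficient of index \<open>m + 1\<close>, up to the
  invertible factor \<open>m + 1\<close>, from the earlier ones.\<close>

lemma fps_linear_ode_unique:
  fixes f g :: "heis_module fps"
  assumes "fps_deriv f = h * f" "fps_deriv g = h * g" "f $ 0 = g $ 0"
  shows "f = g"
proof (rule fps_ext)
  fix n
  show "f $ n = g $ n"
  proof (induction n rule: less_induct)
    case (less n)
    show ?case
    proof (cases n)
      case (Suc m)
      have "(h * f) $ m = (h * g) $ m"
        unfolding fps_mult_nth using less Suc by (intro sum.cong) auto
      then have *: "of_nat (Suc m) * f $ Suc m = of_nat (Suc m) * g $ Suc m"
        using arg_cong[OF assms(1), of "\<lambda>f. f $ m"] arg_cong[OF assms(2), of "\<lambda>f. f $ m"]
        by (simp only: fps_deriv_nth Suc_eq_plus1)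
      show ?thesis
        unfolding Suc by (rule of_nat_mult_cancel_heis_module[OF *]) simp
    qed (simp add: assms(3))
  qed
qed

lemma crea_add: "crea (\<lambda>r. a r + a' r) = crea a * crea a'"
proof (rule fps_linear_ode_unique)
  have "cseries (\<lambda>r. a r + a' r) = cseries a + cseries a'"
    by (rule fps_ext) (simp add: cseries_def cst_add distrib_right)
  then show "fps_deriv (crea (\<lambda>r. a r + a' r)) =
      fps_deriv (cseries a + cseries a') * crea (\<lambda>r. a r + a' r)"
    by (simp only: fps_deriv_crea)
  show "fps_deriv (crea a * crea a') = fps_deriv (cseries a + cseries a') * (crea a * crea a')"
    by (simp add: fps_deriv_crea algebra_simps)
qed simp

lemma crea_dilate: "crea (\<lambda>r. a r * t powi r) $ n = cst (t ^ n) * crea a $ n"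
proof -
  have "(cseries (\<lambda>r. a r * t powi r) ^ k) $ n = cst (t ^ n) * (cseries a ^ k) $ n" for k n
  proof (induction k arbitrary: n)
    case (Suc k)
    have "(cseries (\<lambda>r. a r * t powi r) ^ Suc k) $ n =
        (\<Sum>i=0..n. cseries (\<lambda>r. a r * t powi r) $ i * (cst (t ^ (n - i)) * (cseries a ^ k) $ (n - i)))"
      by (simp add: fps_mult_nth Suc)
    also have "\<dots> = (\<Sum>i=0..n. cst (t ^ n) * (cseries a $ i * (cseries a ^ k) $ (n - i)))"
    proof (rule sum.cong[OF refl])
      fix i assume "i \<in> {0..n}"
      then have "t ^ n = t ^ i * t ^ (n - i)"
        by (simp only: power_add[symmetric]) simp
      then have t: "cst (t ^ n) = cst (t ^ i) * cst (t ^ (n - i))"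
        by (simp only: cst_mult)
      show "cseries (\<lambda>r. a r * t powi r) $ i * (cst (t ^ (n - i)) * (cseries a ^ k) $ (n - i)) =
          cst (t ^ n) * (cseries a $ i * (cseries a ^ k) $ (n - i))"
        unfolding t by (simp add: cseries_def cst_mult)
    qed
    finally show ?case by (simp add: fps_mult_nth sum_distrib_left)
  qed simp
  then show ?thesis by (simp add: crea_def sum_distrib_left mult.left_commute)
qed

lemma crea_rec:
  "of_nat n * crea a $ n = (\<Sum>r=1..n. of_nat r * cst (a (int r)) * (avar r * crea a $ (n - r)))"
proof (cases n)
  case (Suc m)
  have "of_nat n * crea a $ n = (\<Sum>i=0..m. fps_deriv (cseries a) $ i * crea a $ (m - i))"
    using arg_cong[OF fps_deriv_crea[of a], of "\<lambda>f. f $ m"] Suc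
    by (simp add: fps_mult_nth del: of_nat_Suc)
  also have "\<dots> = (\<Sum>r=1..n. of_nat r * cst (a (int r)) * (avar r * crea a $ (n - r)))"
    by (rule sum.reindex_bij_witness[of _ "\<lambda>r. r - 1" Suc])
       (use Suc in \<open>auto simp: cseries_def mult.assoc\<close>)
  finally show ?thesis .
qed simp

text \<open>\<open>P\<close> is the exponential of the series with coefficients
  \<open>- heis_norm r * b r * a r\<close>, expressed by its logarithmic derivative. Asking for a
  polynomial allows evaluation at 1.\<close>

definition contraction :: "(int \<Rightarrow> qfield) \<Rightarrow> (int \<Rightarrow> qfield) \<Rightarrow> qfield poly \<Rightarrow> bool" where
  "contraction b a P \<longleftrightarrow> coeff P 0 = 1 \<and> (\<forall>i. of_nat i * coeff P i =
     - (\<Sum>r=1..i. of_nat r * heis_norm r * b (int r) * a (int r) * coeff P (i - r)))"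

text \<open>Annihilation past creation costs the factor \<open>P\<close>. In the recursion for
  \<open>n * crea a $ n\<close>, the terms where \<open>anni\<close> passes \<open>avar r\<close>
  add up with weight \<open>n - i\<close>, and the commutator terms, by the recursion for
  \<open>P\<close>, with weight \<open>i\<close>; the total weight \<open>n\<close> cancels.\<close>

lemma anni_crea:
  assumes "contraction b a P"
  shows "anni b i (crea a $ n) = (if i \<le> n then cst (coeff P i) * crea a $ (n - i) else 0)"
proof (induction n arbitrary: i rule: less_induct)
  case (less n)
  let ?p = "\<lambda>i. cst (coeff P i)"
  show ?case
  proof (cases "n = 0")
    case True
    then show ?thesis using assms by (simp add: anni_1 contraction_def)
  next
    case False
    let ?c = "\<lambda>r. of_nat r * cst (a (int r)) :: heis_module"
    let ?B = "\<lambda>r. cst (b (int r) * heis_norm r)"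
    have anni_of_nat: "anni b i (of_nat k * cst c * q) = of_nat k * cst c * anni b i q" for i k c q
      using anni_cst_mult[of b i "of_nat k * c" q] by (simp add: cst_mult cst_of_nat)
    have "of_nat n * anni b i (crea a $ n) = anni b i (of_nat n * crea a $ n)"
      using anni_of_nat[of i n 1] by simp
    also have "\<dots> = (\<Sum>r=1..n. ?c r * (avar r * anni b i (crea a $ (n - r)))) -
        (\<Sum>r=1..n. if i < r then 0 else ?c r * (?B r * anni b (i - r) (crea a $ (n - r))))"
      unfolding crea_rec anni_sum anni_of_nat sum_subtractf[symmetric]
      by (rule sum.cong) (auto simp: anni_avar_mult right_diff_distrib)
    also have "(\<Sum>r=1..n. ?c r * (avar r * anni b i (crea a $ (n - r)))) =
        (if i \<le> n then ?p i * (of_nat (n - i) * crea a $ (n - i)) else 0)"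
    proof (cases "i \<le> n")
      case True
      have "(\<Sum>r=1..n. ?c r * (avar r * anni b i (crea a $ (n - r)))) =
          (\<Sum>r=1..n-i. ?p i * (?c r * (avar r * crea a $ (n - i - r))))"
      proof (rule sum.mono_neutral_cong_right)
        fix r assume "r \<in> {1..n - i}"
        then have "n - r < n" "i \<le> n - r" "n - r - i = n - i - r" using True by auto
        then show "?c r * (avar r * anni b i (crea a $ (n - r))) =
            ?p i * (?c r * (avar r * crea a $ (n - i - r)))"
          by (simp add: less)
      qed (use True in \<open>auto simp: less\<close>)
      also have "\<dots> = ?p i * (of_nat (n - i) * crea a $ (n - i))"
        unfolding crea_rec by (simp only: sum_distrib_left)
      finally show ?thesis using True by (simp only: if_True)
    qed (auto intro!: sum.neutral simp: less)
    also have "(\<Sum>r=1..n. if i < r then 0 else ?c r * (?B r * anni b (i - r) (crea a $ (n - r)))) =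
        (if i \<le> n then - (of_nat i * ?p i) * crea a $ (n - i) else 0)"
    proof (cases "i \<le> n")
      case True
      have "(\<Sum>r=1..n. if i < r then 0 else ?c r * (?B r * anni b (i - r) (crea a $ (n - r)))) =
          (\<Sum>r=1..i. cst (of_nat r * heis_norm r * b (int r) * a (int r) * coeff P (i - r))
            * crea a $ (n - i))"
      proof (rule sum.mono_neutral_cong_right)
        fix r assume "r \<in> {1..i}"
        then have r: "n - r < n" "\<not> i < r" "i - r \<le> n - r" "n - r - (i - r) = n - i"
          using True by auto
        show "(if i < r then 0 else ?c r * (?B r * anni b (i - r) (crea a $ (n - r)))) =
            cst (of_nat r * heis_norm r * b (int r) * a (int r) * coeff P (i - r)) * crea a $ (n - i)"
          using r(2,3) by (simp only: less[OF r(1)] r(4) cst_mult cst_of_nat if_True if_False mult_ac)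
      qed (use True in \<open>auto simp: less\<close>)
      also have "\<dots> = - cst (of_nat i * coeff P i) * crea a $ (n - i)"
        using assms unfolding contraction_def
        by (simp add: cst_sum cst_uminus flip: sum_distrib_right)
      finally show ?thesis using True by (simp add: cst_mult cst_of_nat)
    qed (auto intro!: sum.neutral simp: less)
    also have "(if i \<le> n then ?p i * (of_nat (n - i) * crea a $ (n - i)) else 0) -
        (if i \<le> n then - (of_nat i * ?p i) * crea a $ (n - i) else 0) =
        of_nat n * (if i \<le> n then ?p i * crea a $ (n - i) else 0)"
      by (auto simp: of_nat_diff algebra_simps)
    finally show ?thesis
      by (rule of_nat_mult_cancel_heis_module) (rule False)
  qed
qed

section \<open>Vertex operators in normally ordered form\<close>

definition creaI :: "(int \<Rightarrow> qfield) \<Rightarrow> int \<Rightarrow> heis_module" where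
  "creaI a n = (if n < 0 then 0 else crea a $ nat n)"

text \<open>The coefficient of \<open>z^n\<close> in the creation exponential times the annihilation
  exponential: the latter contributes \<open>z^(-i)\<close>, the former must supply
  \<open>z^(n+i)\<close>.\<close>

definition Vop :: "(int \<Rightarrow> qfield) \<Rightarrow> (int \<Rightarrow> qfield) \<Rightarrow> int \<Rightarrow> heis_module \<Rightarrow> heis_module" where
  "Vop a b n p = Sum_any (\<lambda>i::nat. creaI a (n + int i) * anni b i p)"

lemma Vop_eq_sum:
  assumes "\<And>i. i > d \<Longrightarrow> anni b i p = 0"
  shows "Vop a b n p = (\<Sum>i\<le>d. creaI a (n + int i) * anni b i p)"
  unfolding Vop_def
  by (rule Sum_any.expand_superset) (use assms in \<open>auto simp: not_le[symmetric]\<close>)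

lemma Vop_add: "Vop a b n (p + p') = Vop a b n p + Vop a b n p'"
proof -
  obtain d d' where d: "\<forall>i>d. anni b i p = 0" "\<forall>i>d'. anni b i p' = 0"
    using anni_bounded by metis
  then show ?thesis
    by (subst (1 2 3) Vop_eq_sum[where d = "max d d'"])
       (simp_all add: anni_add distrib_left sum.distrib)
qed

lemma Vop_cst_mult: "Vop a b n (cst c * p) = cst c * Vop a b n p"
proof -
  obtain d where "\<forall>i>d. anni b i p = 0"
    using anni_bounded by metis
  then show ?thesis
    by (subst (1 2) Vop_eq_sum[where d = d])
       (simp_all add: anni_cst_mult sum_distrib_left mult.left_commute)
qed

lemma Vop_0 [simp]: "Vop a b n 0 = 0"
  using Vop_cst_mult[of a b n 0 0] by simp

lemma Vop_sum: "Vop a b n (sum f A) = (\<Sum>x\<in>A. Vop a b n (f x))"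
  by (induction A rule: infinite_finite_induct) (simp_all add: Vop_add)

lemma creaI_convolution:
  shows "(\<lambda>j. creaI a (N - j) * creaI a' (j + M)) j \<noteq> 0 \<Longrightarrow> - M \<le> j \<and> j \<le> N"
    and "Sum_any (\<lambda>j. creaI a (N - j) * creaI a' (j + M)) = creaI (\<lambda>r. a r + a' r) (N + M)"
proof -
  show supp: "- M \<le> j \<and> j \<le> N" if "(\<lambda>j. creaI a (N - j) * creaI a' (j + M)) j \<noteq> 0" for j
    using that by (auto simp: creaI_def split: if_splits)
  have "Sum_any (\<lambda>j. creaI a (N - j) * creaI a' (j + M)) =
      (\<Sum>j\<in>{-M..N}. creaI a (N - j) * creaI a' (j + M))"
    by (rule Sum_any.expand_superset) (use supp in auto)
  also have "\<dots> = creaI (\<lambda>r. a r + a' r) (N + M)"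
  proof (cases "N + M < 0")
    case False
    have "(\<Sum>j\<in>{-M..N}. creaI a (N - j) * creaI a' (j + M)) =
        (\<Sum>i=0..nat (N + M). crea a $ i * crea a' $ (nat (N + M) - i))"
    proof (rule sum.reindex_bij_witness[of _ "\<lambda>i. N - int i" "\<lambda>j. nat (N - j)"])
      fix j assume "j \<in> {-M..N}"
      then have "nat (N + M) - nat (N - j) = nat (j + M)" "\<not> N - j < 0" "\<not> j + M < 0" by auto
      then show "crea a $ nat (N - j) * crea a' $ (nat (N + M) - nat (N - j)) =
          creaI a (N - j) * creaI a' (j + M)"
        by (simp add: creaI_def)
    qed (use False in auto)
    then show ?thesis using False by (simp add: creaI_def crea_add fps_mult_nth)
  qed (simp add: creaI_def)
  finally show "Sum_any (\<lambda>j. creaI a (N - j) * creaI a' (j + M)) =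
    creaI (\<lambda>r. a r + a' r) (N + M)" .
qed

lemma sum_antidiagonals_eq_sum_box:
  fixes F :: "nat \<Rightarrow> nat \<Rightarrow> 'a :: comm_monoid_add"
  assumes "\<And>l i. l > L \<or> i > d \<Longrightarrow> F l i = 0"
  shows "(\<Sum>t\<le>L+d. \<Sum>l\<le>t. F l (t - l)) = (\<Sum>l\<le>L. \<Sum>i\<le>d. F l i)"
proof -
  have "(\<Sum>t\<le>L+d. \<Sum>l\<le>t. F l (t - l)) = (\<Sum>(l, i)\<in>{(l, i). l + i \<le> L + d}. F l i)"
    by (rule sum.triangle_reindex_eq[symmetric])
  also have "\<dots> = (\<Sum>(l, i)\<in>{..L} \<times> {..d}. F l i)"
  proof (rule sum.mono_neutral_right)
    show "finite {(l, i). l + i \<le> L + d}"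
      by (rule finite_subset[of _ "{..L+d} \<times> {..L+d}"]) auto
    show "\<forall>x\<in>{(l, i). l + i \<le> L + d} - {..L} \<times> {..d}. (case x of (l, i) \<Rightarrow> F l i) = 0"
    proof
      fix x assume "x \<in> {(l, i). l + i \<le> L + d} - {..L} \<times> {..d}"
      then show "(case x of (l, i) \<Rightarrow> F l i) = 0"
        using assms[of "fst x" "snd x"] by (auto simp: split_beta mem_Times_iff)
    qed
  qed auto
  finally show ?thesis by (simp add: sum.cartesian_product)
qed

lemma anni_creaI_mult:
  assumes "contraction b a P"
  shows "anni b t (creaI a M * q) =
    (\<Sum>l\<le>t. cst (coeff P l) * creaI a (M - int l) * anni b (t - l) q)"
proof (cases "M < 0")
  case False
  then show ?thesis
    unfolding creaI_def anni_mult
    by (auto simp: anni_crea[OF assms] anni_mult nat_diff_distrib' intro!: sum.cong)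
qed (simp add: creaI_def)

lemma Vop_creaI_mult:
  assumes "contraction b a' P" and d: "\<And>i. i > d \<Longrightarrow> anni b i q = 0"
  shows "Vop a b N (creaI a' M * q) = (\<Sum>l\<le>degree P. \<Sum>i\<le>d.
    creaI a (N + int (l + i)) * (cst (coeff P l) * creaI a' (M - int l) * anni b i q))"
proof -
  let ?F = "\<lambda>l i. cst (coeff P l) * creaI a' (M - int l) * anni b i q"
  have F0: "?F l i = 0" if "l > degree P \<or> i > d" for l i
    using that d by (auto simp: coeff_eq_0)
  have "anni b t (creaI a' M * q) = 0" if "t > degree P + d" for t
    unfolding anni_creaI_mult[OF assms(1)]
    by (intro sum.neutral ballI F0) (use that in auto)
  then have "Vop a b N (creaI a' M * q) =
      (\<Sum>t\<le>degree P + d. \<Sum>l\<le>t. creaI a (N + int (l + (t - l))) * ?F l (t - l))"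
    by (subst Vop_eq_sum[where d = "degree P + d"])
       (auto simp: anni_creaI_mult[OF assms(1)] sum_distrib_left intro!: sum.cong)
  also have "\<dots> = (\<Sum>l\<le>degree P. \<Sum>i\<le>d. creaI a (N + int (l + i)) * ?F l i)"
    by (rule sum_antidiagonals_eq_sum_box) (use F0 in auto)
  finally show ?thesis .
qed

text \<open>Moving the outer annihilation exponential past the inner creation exponential produces
  \<open>P\<close> in the ratio of the two arguments. Both arguments are \<open>z\<close>, dilations
  being absorbed into the coefficients, so the value is \<open>poly P 1\<close>. Since
  \<open>P\<close> is a polynomial, only finitely many \<open>j\<close> contribute.\<close>

lemma Vop_comp:
  assumes "contraction b a' P"
  shows "finite {j. Vop a b (n - j) (Vop a' b' j p) \<noteq> 0}" (is ?fin)
    and "Sum_any (\<lambda>j. Vop a b (n - j) (Vop a' b' j p)) =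
      cst (poly P 1) * Vop (\<lambda>r. a r + a' r) (\<lambda>r. b r + b' r) n p" (is ?eq)
proof -
  obtain d' where d': "\<And>i. i > d' \<Longrightarrow> anni b' i p = 0"
    using anni_bounded by metis
  define q where "q i = anni b' i p" for i
  have "\<forall>i'. \<exists>d. \<forall>i>d. anni b i (q i') = 0"
    using anni_bounded by blast
  then obtain D where D: "\<And>i' i. i > D i' \<Longrightarrow> anni b i (q i') = 0"
    by metis
  define d where "d = Max (D ` {..d'})"
  have d: "anni b i (q i') = 0" if "i > d \<or> i' > d'" for i i'
  proof (cases "i' > d'")
    case False
    then have "D i' \<le> d" unfolding d_def by (intro Max_ge) auto
    with that False D show ?thesis by auto
  qed (simp add: q_def d')
  let ?c = "\<lambda>l. cst (coeff P l)"
  let ?a = "\<lambda>r. a r + a' r" and ?b = "\<lambda>r. b r + b' r"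
  define T where "T j i' l i = creaI a (n - j + int (l + i)) *
    (?c l * creaI a' (j + int i' - int l) * anni b i (q i'))" for j i' l i
  have V: "Vop a b (n - j) (Vop a' b' j p) = (\<Sum>i'\<le>d'. \<Sum>l\<le>degree P. \<Sum>i\<le>d. T j i' l i)" for j
  proof -
    have "Vop a' b' j p = (\<Sum>i'\<le>d'. creaI a' (j + int i') * q i')"
      unfolding q_def by (rule Vop_eq_sum) (rule d')
    then show ?thesis
      unfolding T_def
      by (simp only: Vop_sum) (intro sum.cong refl Vop_creaI_mult[OF assms] d disjI1)
  qed
  \<comment> \<open>Outside this window one of the two creation coefficients has a negative
    index.\<close>
  define J where "J = {- int d' .. n + int (degree P) + int d}"
  have T0: "T j i' l i = 0" if "j \<notin> J" "i' \<le> d'" "l \<le> degree P" "i \<le> d" for j i' l i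
    using that unfolding T_def J_def creaI_def by auto
  have supp: "{j. Vop a b (n - j) (Vop a' b' j p) \<noteq> 0} \<subseteq> J"
  proof (rule subsetI, rule ccontr)
    fix j assume j: "j \<in> {j. Vop a b (n - j) (Vop a' b' j p) \<noteq> 0}" "j \<notin> J"
    have "Vop a b (n - j) (Vop a' b' j p) = 0"
      unfolding V by (intro sum.neutral ballI) (use T0 j in auto)
    with j show False by simp
  qed
  then show ?fin by (rule finite_subset) (simp add: J_def)
  \<comment> \<open>The index \<open>l\<close> enters the two creation coefficients with opposite
    signs and disappears after summation over \<open>j\<close>. What remains of \<open>P\<close> is
    therefore the sum of its coefficients.\<close>
  have conv: "(\<Sum>j\<in>J. T j i' l i) = ?c l * (creaI ?a (n + int (i + i')) * anni b i (q i'))"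
    if "i' \<le> d'" "l \<le> degree P" "i \<le> d" for i' l i
  proof -
    let ?f = "\<lambda>j. creaI a (n + int (l + i) - j) * creaI a' (j + (int i' - int l))"
    have "(\<Sum>j\<in>J. T j i' l i) = (\<Sum>j\<in>J. ?f j) * (?c l * anni b i (q i'))"
      unfolding T_def sum_distrib_right by (intro sum.cong refl) (simp add: algebra_simps)
    also have "(\<Sum>j\<in>J. ?f j) = Sum_any ?f"
    proof (rule Sum_any.expand_superset[symmetric])
      show "{j. ?f j \<noteq> 0} \<subseteq> J"
      proof
        fix j assume "j \<in> {j. ?f j \<noteq> 0}"
        then have "?f j \<noteq> 0" by simp
        from creaI_convolution(1)[OF this] that show "j \<in> J" by (simp add: J_def)
      qed
    qed (simp add: J_def)
    also have "\<dots> = creaI ?a (n + int (l + i) + (int i' - int l))"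
      by (rule creaI_convolution)
    finally show ?thesis by (simp add: algebra_simps)
  qed
  have "Sum_any (\<lambda>j. Vop a b (n - j) (Vop a' b' j p)) =
      (\<Sum>j\<in>J. \<Sum>i'\<le>d'. \<Sum>l\<le>degree P. \<Sum>i\<le>d. T j i' l i)"
    unfolding V[symmetric] by (rule Sum_any.expand_superset[OF _ supp]) (simp add: J_def)
  also have "\<dots> = (\<Sum>i'\<le>d'. \<Sum>l\<le>degree P. \<Sum>i\<le>d. \<Sum>j\<in>J. T j i' l i)"
    by (simp only: sum.swap[of _ _ J])
  also have "\<dots> = (\<Sum>i'\<le>d'. \<Sum>l\<le>degree P. \<Sum>i\<le>d. ?c l * (creaI ?a (n + int (i + i')) * anni b i (q i')))"
    by (intro sum.cong refl conv) auto
  also have "\<dots> = (\<Sum>i'\<le>d'. (\<Sum>l\<le>degree P. ?c l) * (\<Sum>i\<le>d. creaI ?a (n + int (i + i')) * anni b i (q i')))"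
    by (simp only: sum_product)
  also have "(\<Sum>l\<le>degree P. ?c l) = cst (poly P 1)"
    by (simp add: poly_altdef cst_sum)
  also have "(\<Sum>i'\<le>d'. cst (poly P 1) * (\<Sum>i\<le>d. creaI ?a (n + int (i + i')) * anni b i (q i'))) =
     cst (poly P 1) * (\<Sum>i\<le>d. \<Sum>i'\<le>d'. creaI ?a (n + int (i + i')) * anni b i (q i'))"
    by (subst sum.swap) (simp only: sum_distrib_left)
  also have "(\<Sum>i\<le>d. \<Sum>i'\<le>d'. creaI ?a (n + int (i + i')) * anni b i (q i')) =
      (\<Sum>t\<le>d+d'. \<Sum>i\<le>t. creaI ?a (n + int (i + (t - i))) * anni b i (q (t - i)))"
    by (rule sum_antidiagonals_eq_sum_box[symmetric]) (use d in auto)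
  also have "\<dots> = (\<Sum>t\<le>d+d'. creaI ?a (n + int t) * anni ?b t p)"
    unfolding anni_comp[symmetric] q_def sum_distrib_left by (intro sum.cong refl) auto
  also have "\<dots> = Vop ?a ?b n p"
  proof (rule Vop_eq_sum[symmetric])
    fix t assume "t > d + d'"
    then have "anni b i (q (t - i)) = 0" if "i \<le> t" for i
      using that by (intro d) auto
    then show "anni ?b t p = 0"
      unfolding anni_comp[symmetric] by (intro sum.neutral) (auto simp: q_def)
  qed
  finally show ?eq .
qed

section \<open>Coefficients of the exponentials on the Fock spaces\<close>

lemma lookup_scaleL: "Poly_Mapping.lookup (scaleL c v) k = cst c * Poly_Mapping.lookup v k"
  by (simp add: scaleL_def cst_def lookup_single_0_mult)

lemma lookup_heisL: "n \<noteq> 0 \<Longrightarrow> Poly_Mapping.lookup (heisL n v) k = heis n (Poly_Mapping.lookup v k)"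
  by (simp add: heisL_def Poly_Mapping.map.rep_eq when_def heis_0)

lemma lookup_Sum_any:
  assumes "finite {j. f j \<noteq> 0}"
  shows "Poly_Mapping.lookup (Sum_any f) k = Sum_any (\<lambda>j. Poly_Mapping.lookup (f j) k)"
proof -
  have "{j. Poly_Mapping.lookup (f j) k \<noteq> 0} \<subseteq> {j. f j \<noteq> 0}" by auto
  from Sum_any.expand_superset[OF assms this] show ?thesis
    by (simp add: Sum_any.expand_set[of f] lookup_sum)
qed

lemma Sum_any_int_eq_sum_nat:
  fixes f :: "int \<Rightarrow> 'a :: comm_monoid_add"
  assumes "\<And>j. f j \<noteq> 0 \<Longrightarrow> 0 \<le> j \<and> j \<le> n"
  shows "finite {j. f j \<noteq> 0}" "Sum_any f = (if n < 0 then 0 else \<Sum>i\<le>nat n. f (int i))"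
proof -
  have sub: "{j. f j \<noteq> 0} \<subseteq> {0..n}" using assms by auto
  then show "finite {j. f j \<noteq> 0}" by (rule finite_subset) simp
  have "Sum_any f = (\<Sum>j\<in>{0..n}. f j)"
    by (rule Sum_any.expand_superset[OF _ sub]) simp
  also have "\<dots> = (if n < 0 then 0 else \<Sum>i\<le>nat n. f (int i))"
  proof (cases "n < 0")
    case False
    have "(\<Sum>j\<in>{0..n}. f j) = (\<Sum>i\<le>nat n. f (int i))"
      by (rule sum.reindex_bij_witness[of _ int nat]) (use False in auto)
    with False show ?thesis by simp
  qed simp
  finally show "Sum_any f = (if n < 0 then 0 else \<Sum>i\<le>nat n. f (int i))" .
qed

lemma Sum_any_uminus_reindex:
  "Sum_any (\<lambda>j::int. f (- j)) = Sum_any f"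
  by (rule Sum_any.reindex_cong[symmetric, of uminus])
     (auto simp: bij_def inj_def fun_eq_iff intro!: surjI[of _ uminus])

definition creation_series :: "(int \<Rightarrow> qfield) \<Rightarrow> fseries" where
  "creation_series c = (\<lambda>v n. if n \<ge> 1 then scaleL (c n) (heisL (- n) v) else 0)"

definition annihilation_series :: "(int \<Rightarrow> qfield) \<Rightarrow> fseries" where
  "annihilation_series c = (\<lambda>v n. if n \<le> - 1 then - scaleL (c (- n)) (heisL (- n) v) else 0)"

lemma lookup_creation_series:
  "Poly_Mapping.lookup (creation_series c v n) k =
    (if n \<ge> 1 then cseries c $ nat n * Poly_Mapping.lookup v k else 0)"
  using heis_neg[of "nat n"] by (auto simp: creation_series_def lookup_scaleL lookup_heisL cseries_def)

lemma lookup_annihilation_series: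
  "Poly_Mapping.lookup (annihilation_series c v n) k =
    (if n \<le> - 1 then - cst (c (- n)) * heis (- n) (Poly_Mapping.lookup v k) else 0)"
  by (simp add: annihilation_series_def lookup_scaleL lookup_heisL)

lemma creation_series_0: "creation_series c 0 n = 0"
  by (rule poly_mapping_eqI) (simp add: lookup_creation_series)

lemma annihilation_series_0: "annihilation_series c 0 n = 0"
  by (rule poly_mapping_eqI) (simp add: lookup_annihilation_series heis_0)

text \<open>The creation series acts by multiplication with \<open>cseries c\<close>, so its powers
  are ordinary powers of a formal power series.\<close>

lemma lookup_fpow_creation_series:
  "Poly_Mapping.lookup (fpow (creation_series c) k v n) l =
    (if n < 0 then 0 else (cseries c ^ k) $ nat n * Poly_Mapping.lookup v l)"
proof (induction k arbitrary: n l)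
  case 0
  show ?case by (auto simp: fone_def)
next
  case (Suc k)
  let ?f = "\<lambda>j. creation_series c (fpow (creation_series c) k v j) (n - j)"
  have neg: "fpow (creation_series c) k v j = 0" if "j < 0" for j
    by (rule poly_mapping_eqI) (use that in \<open>simp add: Suc\<close>)
  have supp: "0 \<le> j \<and> j \<le> n" if "?f j \<noteq> 0" for j
  proof -
    have "n - j \<ge> 1" using that by (auto simp: creation_series_def split: if_splits)
    moreover have "j \<ge> 0" using that neg[of j] creation_series_0 by (cases "j < 0") auto
    ultimately show ?thesis by simp
  qed
  have supp': "0 \<le> j \<and> j \<le> n" if "Poly_Mapping.lookup (?f j) l \<noteq> 0" for j
    by (rule supp) (use that in auto)
  have "Poly_Mapping.lookup (fpow (creation_series c) (Suc k) v n) l =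
      Sum_any (\<lambda>j. Poly_Mapping.lookup (?f j) l)"
    unfolding fpow.simps fmult_def by (rule lookup_Sum_any[OF Sum_any_int_eq_sum_nat(1)[OF supp]])
  also have "\<dots> = (if n < 0 then 0 else \<Sum>i\<le>nat n. Poly_Mapping.lookup (?f (int i)) l)"
    by (rule Sum_any_int_eq_sum_nat(2)[OF supp'])
  also have "\<dots> = (if n < 0 then 0 else \<Sum>i\<le>nat n.
      (cseries c ^ k) $ i * cseries c $ (nat n - i) * Poly_Mapping.lookup v l)"
  proof (cases "n < 0")
    case False
    have "Poly_Mapping.lookup (?f (int i)) l =
        (cseries c ^ k) $ i * cseries c $ (nat n - i) * Poly_Mapping.lookup v l" if "i \<le> nat n" for i
    proof (cases "n - int i \<ge> 1")
      case True
      then show ?thesis by (simp add: lookup_creation_series Suc nat_diff_distrib')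
    next
      case False
      then have "nat n - i = 0" by linarith
      with False show ?thesis by (simp add: lookup_creation_series cseries_def)
    qed
    with False show ?thesis by simp
  qed simp
  also have "\<dots> = (if n < 0 then 0 else (cseries c ^ Suc k) $ nat n * Poly_Mapping.lookup v l)"
    by (simp add: fps_mult_nth sum_distrib_right atMost_atLeast0 power_Suc2 del: power_Suc)
  finally show ?case .
qed

lemma lookup_fexp_creation_series:
  "Poly_Mapping.lookup (fexp (creation_series c) v n) l = creaI c n * Poly_Mapping.lookup v l"
proof -
  let ?f = "\<lambda>k. scaleL (inverse (of_nat (fact k))) (fpow (creation_series c) k v n)"
  have supp: "{k. ?f k \<noteq> 0} \<subseteq> {..nat n}"
  proof (rule subsetI, rule ccontr)
    fix k assume k: "k \<in> {k. ?f k \<noteq> 0}" "k \<notin> {..nat n}"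
    have "?f k = 0"
      by (rule poly_mapping_eqI)
         (use k in \<open>simp add: lookup_scaleL lookup_fpow_creation_series cseries_power_nth_eq_0\<close>)
    with k show False by simp
  qed
  have "fexp (creation_series c) v n = (\<Sum>k\<le>nat n. ?f k)"
    unfolding fexp_def by (rule Sum_any.expand_superset[OF _ supp]) simp
  then show ?thesis
    by (simp add: lookup_sum lookup_scaleL lookup_fpow_creation_series creaI_def crea_def
        sum_distrib_right mult.assoc)
qed

lemma lookup_fpow_annihilation_series:
  "Poly_Mapping.lookup (fpow (annihilation_series c) k v n) l =
    (if n > 0 then 0 else dcoeff c k (nat (- n)) (Poly_Mapping.lookup v l))"
proof (induction k arbitrary: n l)
  case 0
  show ?case by (auto simp: fone_def)
next
  case (Suc k)
  \<comment> \<open>All exponents of \<open>z\<close> are nonpositive; negating the summation index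
    gives a support inside an initial segment of the naturals.\<close>
  let ?f = "\<lambda>j. annihilation_series c (fpow (annihilation_series c) k v (- j)) (n + j)"
  have pos: "fpow (annihilation_series c) k v j = 0" if "j > 0" for j
    by (rule poly_mapping_eqI) (use that in \<open>simp add: Suc\<close>)
  have supp: "0 \<le> j \<and> j \<le> - n" if "?f j \<noteq> 0" for j
  proof -
    have "n + j \<le> - 1" using that by (auto simp: annihilation_series_def split: if_splits)
    moreover have "j \<ge> 0" using that pos[of "- j"] annihilation_series_0 by (cases "j < 0") auto
    ultimately show ?thesis by simp
  qed
  have supp': "0 \<le> j \<and> j \<le> - n" if "Poly_Mapping.lookup (?f j) l \<noteq> 0" for j
    by (rule supp) (use that in auto)
  have "fpow (annihilation_series c) (Suc k) v n = Sum_any ?f"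
    using Sum_any_uminus_reindex[of "\<lambda>j. annihilation_series c (fpow (annihilation_series c) k v j) (n - j)"]
    by (simp add: fmult_def)
  then have "Poly_Mapping.lookup (fpow (annihilation_series c) (Suc k) v n) l =
      Sum_any (\<lambda>j. Poly_Mapping.lookup (?f j) l)"
    using lookup_Sum_any[OF Sum_any_int_eq_sum_nat(1)[OF supp]] by simp
  also have "\<dots> = (if - n < 0 then 0 else \<Sum>i\<le>nat (- n). Poly_Mapping.lookup (?f (int i)) l)"
    by (rule Sum_any_int_eq_sum_nat(2)[OF supp'])
  also have "\<dots> = (if n > 0 then 0 else dcoeff c (Suc k) (nat (- n)) (Poly_Mapping.lookup v l))"
  proof (cases "n > 0")
    case False
    let ?N = "nat (- n)"
    have "(\<Sum>i\<le>?N. Poly_Mapping.lookup (?f (int i)) l) = (\<Sum>i<?N. Poly_Mapping.lookup (?f (int i)) l)"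
      by (rule sum.mono_neutral_right) (auto simp: lookup_annihilation_series)
    also have "\<dots> = (\<Sum>r=1..?N. - cst (c (int r)) *
        heis (int r) (dcoeff c k (?N - r) (Poly_Mapping.lookup v l)))"
      by (rule sum.reindex_bij_witness[of _ "\<lambda>r. ?N - r" "\<lambda>i. ?N - i"])
         (use False in \<open>auto simp: lookup_annihilation_series Suc of_nat_diff algebra_simps\<close>)
    finally show ?thesis using False by simp
  qed simp
  finally show ?case .
qed

lemma lookup_fexp_annihilation_series:
  "Poly_Mapping.lookup (fexp (annihilation_series c) v n) l =
    (if n > 0 then 0 else anni c (nat (- n)) (Poly_Mapping.lookup v l))"
proof -
  let ?f = "\<lambda>k. scaleL (inverse (of_nat (fact k))) (fpow (annihilation_series c) k v n)"
  have supp: "{k. ?f k \<noteq> 0} \<subseteq> {..nat (- n)}"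
  proof (rule subsetI, rule ccontr)
    fix k assume k: "k \<in> {k. ?f k \<noteq> 0}" "k \<notin> {..nat (- n)}"
    have "?f k = 0"
      by (rule poly_mapping_eqI)
         (use k in \<open>simp add: lookup_scaleL lookup_fpow_annihilation_series dcoeff_eq_0\<close>)
    with k show False by simp
  qed
  have "fexp (annihilation_series c) v n = (\<Sum>k\<le>nat (- n). ?f k)"
    unfolding fexp_def by (rule Sum_any.expand_superset[OF _ supp]) simp
  then show ?thesis
    by (simp add: lookup_sum lookup_scaleL lookup_fpow_annihilation_series anni_def)
qed

lemma anni_bounded_fock: "\<exists>d. \<forall>n>d. \<forall>l. anni b n (Poly_Mapping.lookup v l) = 0"
proof -
  have "\<forall>l. \<exists>d. \<forall>n>d. anni b n (Poly_Mapping.lookup v l) = 0"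
    using anni_bounded by blast
  then obtain D where D: "\<And>l n. n > D l \<Longrightarrow> anni b n (Poly_Mapping.lookup v l) = 0"
    by metis
  have "anni b n (Poly_Mapping.lookup v l) = 0"
    if "n > Max (insert 0 (D ` Poly_Mapping.keys v))" for n l
  proof (cases "l \<in> Poly_Mapping.keys v")
    case True
    then have "D l \<le> Max (insert 0 (D ` Poly_Mapping.keys v))" by (intro Max_ge) auto
    also note that
    finally show ?thesis by (rule D)
  qed (simp add: in_keys_iff)
  then show ?thesis by blast
qed

lemma lookup_heis_exp:
  "Poly_Mapping.lookup (heis_exp c v n) l = Vop c c n (Poly_Mapping.lookup v l)"
proof -
  obtain d where d: "\<And>i l. i > d \<Longrightarrow> anni c i (Poly_Mapping.lookup v l) = 0"
    using anni_bounded_fock[of c v] by blast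
  let ?f = "\<lambda>j. fexp (creation_series c) (fexp (annihilation_series c) v (- j)) (n + j)"
  have lf: "Poly_Mapping.lookup (?f j) l =
      (if j < 0 then 0 else creaI c (n + j) * anni c (nat j) (Poly_Mapping.lookup v l))" for j l
    by (simp add: lookup_fexp_creation_series lookup_fexp_annihilation_series)
  have supp: "0 \<le> j \<and> j \<le> int d" if "?f j \<noteq> 0" for j
  proof (rule ccontr)
    assume "\<not> ?thesis"
    then have "?f j = 0"
      by (intro poly_mapping_eqI) (auto simp: lf d)
    with that show False by simp
  qed
  have supp': "0 \<le> j \<and> j \<le> int d" if "Poly_Mapping.lookup (?f j) l \<noteq> 0" for j
    by (rule supp) (use that in auto)
  have "heis_exp c v n = Sum_any ?f"
    using Sum_any_uminus_reindex[of "\<lambda>j. fexp (creation_series c) (fexp (annihilation_series c) v j) (n - j)"]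
    by (simp add: heis_exp_def fmult_def creation_series_def annihilation_series_def)
  then have "Poly_Mapping.lookup (heis_exp c v n) l = Sum_any (\<lambda>j. Poly_Mapping.lookup (?f j) l)"
    using lookup_Sum_any[OF Sum_any_int_eq_sum_nat(1)[OF supp]] by simp
  also have "\<dots> = (\<Sum>i\<le>d. Poly_Mapping.lookup (?f (int i)) l)"
    using Sum_any_int_eq_sum_nat(2)[OF supp'] by simp
  also have "\<dots> = Vop c c n (Poly_Mapping.lookup v l)"
    unfolding lf by (subst Vop_eq_sum[OF d]) simp_all
  finally show ?thesis .
qed

text \<open>\<open>VO a b m s w\<close> maps \<open>p \<otimes> e\<^bsup>k\<alpha>\<^esup>\<close> to
  \<open>w\<^sub>k z\<^bsup>s\<^sub>k\<^esup> exp (\<Sum>r\<ge>1. a\<^sub>r a(-r) z\<^sup>r) exp (- \<Sum>r\<ge>1. b\<^sub>r a(r) z\<^sup>-\<^sup>r) p \<otimes> e\<^bsup>(k+m)\<alpha>\<^esup>\<close>.\<close>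

definition VO :: "(int \<Rightarrow> qfield) \<Rightarrow> (int \<Rightarrow> qfield) \<Rightarrow> int \<Rightarrow> (int \<Rightarrow> int) \<Rightarrow> (int \<Rightarrow> qfield) \<Rightarrow> fseries"
  where "VO a b m s w v n = (\<Sum>k\<in>Poly_Mapping.keys v.
    Poly_Mapping.single (k + m) (cst (w k) * Vop a b (n - s k) (Poly_Mapping.lookup v k)))"

lemma lookup_VO:
  "Poly_Mapping.lookup (VO a b m s w v n) k =
    cst (w (k - m)) * Vop a b (n - s (k - m)) (Poly_Mapping.lookup v (k - m))"
proof -
  have "Poly_Mapping.lookup (VO a b m s w v n) k = (\<Sum>k'\<in>Poly_Mapping.keys v. if k' = k - m then
      cst (w k') * Vop a b (n - s k') (Poly_Mapping.lookup v k') else 0)"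
    unfolding VO_def lookup_sum by (intro sum.cong refl) (auto simp: lookup_single when_def)
  then show ?thesis by (simp add: in_keys_iff)
qed

lemma fseries_eqI:
  assumes "\<And>v n k. Poly_Mapping.lookup (A v n) k = Poly_Mapping.lookup (B v n) k"
  shows "(A :: fseries) = B"
  by (rule ext, rule ext, rule poly_mapping_eqI, rule assms)

lemma VO_add: "VO a b m s w (v + v') n = VO a b m s w v n + VO a b m s w v' n"
  by (rule poly_mapping_eqI) (simp add: lookup_VO lookup_add Vop_add distrib_left)

lemma VO_scaleL: "VO a b m s w (scaleL c v) n = scaleL c (VO a b m s w v n)"
  by (rule poly_mapping_eqI) (simp add: lookup_VO lookup_scaleL Vop_cst_mult mult.left_commute)

lemma VO_0: "VO a b m s w 0 n = 0"
  by (rule poly_mapping_eqI) (simp add: lookup_VO)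

lemma lookup_lattice_alpha:
  "Poly_Mapping.lookup (lattice_alpha i v n) k =
    (if 2 * (k - 1) + i = n then Poly_Mapping.lookup v (k - 1) else 0)"
proof -
  have "Poly_Mapping.lookup (lattice_alpha i v n) k =
      (\<Sum>k'\<in>{k\<in>Poly_Mapping.keys v. 2 * k + i = n}. if k' = k - 1 then Poly_Mapping.lookup v k' else 0)"
    unfolding lattice_alpha_def lookup_sum by (intro sum.cong refl) (auto simp: lookup_single when_def)
  then show ?thesis by (auto simp: in_keys_iff)
qed

lemma lookup_lattice_lambda:
  "Poly_Mapping.lookup (lattice_lambda v n) k =
    (if k = n then cst ((- 1) powi k) * Poly_Mapping.lookup v k else 0)"
proof -
  have "Poly_Mapping.lookup (lattice_lambda v n) k =
      (\<Sum>k'\<in>{k\<in>Poly_Mapping.keys v. k = n}. if k' = k then cst ((- 1) powi k') * Poly_Mapping.lookup v k' else 0)"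
    unfolding lattice_lambda_def lookup_sum
    by (intro sum.cong refl) (auto simp: lookup_single when_def scaleK_eq_cst_mult)
  then show ?thesis by (auto simp: in_keys_iff)
qed

text \<open>A lattice factor puts each component of \<open>v\<close> into a single power of
  \<open>z\<close>, so in each component only one term of the product survives.\<close>

lemma fmult_heis_exp:
  assumes "\<And>k. Poly_Mapping.lookup (B v (s k)) (k + m) = cst (w k) * Poly_Mapping.lookup v k"
    and "\<And>k j. j \<noteq> s k \<Longrightarrow> Poly_Mapping.lookup (B v j) (k + m) = 0"
  shows "fmult (heis_exp c) B v n = VO c c m s w v n"
proof (rule poly_mapping_eqI)
  fix l
  let ?f = "\<lambda>j. heis_exp c (B v j) (n - j)"
  have B: "Poly_Mapping.lookup (B v j) l' =
     (if j = s (l' - m) then cst (w (l' - m)) * Poly_Mapping.lookup v (l' - m) else 0)" for j l'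
    using assms(1)[of "l' - m"] assms(2)[of j "l' - m"] by auto
  have fin: "finite {j. ?f j \<noteq> 0}"
  proof (rule finite_subset)
    show "{j. ?f j \<noteq> 0} \<subseteq> s ` Poly_Mapping.keys v"
    proof (rule subsetI, rule ccontr)
      fix j assume j: "j \<in> {j. ?f j \<noteq> 0}" "j \<notin> s ` Poly_Mapping.keys v"
      then have "Poly_Mapping.lookup v k = 0" if "j = s k" for k
        using that by (auto simp: in_keys_iff)
      then have "?f j = 0"
        by (intro poly_mapping_eqI) (simp add: lookup_heis_exp B)
      with j show False by simp
    qed
  qed simp
  have "Poly_Mapping.lookup (fmult (heis_exp c) B v n) l =
      Sum_any (\<lambda>j. if j = s (l - m) then
        Vop c c (n - j) (cst (w (l - m)) * Poly_Mapping.lookup v (l - m)) else 0)"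
    unfolding fmult_def lookup_Sum_any[OF fin] by (rule Sum_any.cong) (simp add: lookup_heis_exp B)
  then show "Poly_Mapping.lookup (fmult (heis_exp c) B v n) l = Poly_Mapping.lookup (VO c c m s w v n) l"
    by (simp add: lookup_VO Vop_cst_mult)
qed

definition xcoeff :: "int \<Rightarrow> qfield" where
  "xcoeff r = qhalf powi (- r) / qint r"

definition ycoeff :: "int \<Rightarrow> qfield" where
  "ycoeff r = qhalf powi r / qint (2 * r)"

lemma frenkel_jing_eq_VO: "frenkel_jing 1 = VO xcoeff xcoeff 1 (\<lambda>k. 2 * k + 1) (\<lambda>_. 1)"
  unfolding frenkel_jing_def xcoeff_def
  by (intro ext fmult_heis_exp) (simp_all add: lookup_lattice_alpha)

lemma koyama_eq_VO: "koyama = VO ycoeff ycoeff 0 (\<lambda>k. k) (\<lambda>k. (- 1) powi k)"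
  unfolding koyama_def ycoeff_def
  by (intro ext fmult_heis_exp) (simp_all add: lookup_lattice_lambda)

lemma VO_comp:
  assumes "contraction b a' P"
  shows "finite {j. VO a b m s w (VO a' b' m' s' w' v j) (n - j) \<noteq> 0}" (is "finite {j. ?f j \<noteq> 0}")
    and "fmult (VO a b m s w) (VO a' b' m' s' w') =
      VO (\<lambda>r. a r + a' r) (\<lambda>r. b r + b' r) (m + m') (\<lambda>k. s' k + s (k + m'))
        (\<lambda>k. w' k * w (k + m') * poly P 1)"
proof -
  \<comment> \<open>Here \<open>k\<close> is the lattice index of the input and \<open>j\<close> is
    counted from the power \<open>s' k\<close> of the inner lattice factor; with this shift the
    claim reduces to \<open>Vop_comp\<close>.\<close>
  define g where "g v n k j = Vop a b (n - s (k + m') - s' k - j) (Vop a' b' j (Poly_Mapping.lookup v k))"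
    for v n k j
  have lf: "Poly_Mapping.lookup (VO a b m s w (VO a' b' m' s' w' v j) (n - j)) l =
      cst (w' (l - (m + m')) * w (l - (m + m') + m')) * g v n (l - (m + m')) (j - s' (l - (m + m')))"
    for v n j l
    by (simp add: lookup_VO Vop_cst_mult cst_mult g_def algebra_simps)
  have fin_g: "finite {j. g v n k j \<noteq> 0}" for v n k
    unfolding g_def by (rule Vop_comp(1)[OF assms])
  show fin: "finite {j. VO a b m s w (VO a' b' m' s' w' v j) (n - j) \<noteq> 0}" for v n
  proof (rule finite_subset)
    show "{j. VO a b m s w (VO a' b' m' s' w' v j) (n - j) \<noteq> 0} \<subseteq>
        (\<Union>k\<in>Poly_Mapping.keys v. (\<lambda>j. j + s' k) ` {j. g v n k j \<noteq> 0})"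
    proof
      fix j assume "j \<in> {j. VO a b m s w (VO a' b' m' s' w' v j) (n - j) \<noteq> 0}"
      then obtain l where "Poly_Mapping.lookup (VO a b m s w (VO a' b' m' s' w' v j) (n - j)) l \<noteq> 0"
        using poly_mapping_eqI[of "VO a b m s w (VO a' b' m' s' w' v j) (n - j)" 0] by auto
      then have "g v n (l - (m + m')) (j - s' (l - (m + m'))) \<noteq> 0" by (auto simp: lf)
      moreover from this have "l - (m + m') \<in> Poly_Mapping.keys v"
        by (auto simp: g_def in_keys_iff intro: ccontr)
      ultimately show "j \<in> (\<Union>k\<in>Poly_Mapping.keys v. (\<lambda>j. j + s' k) ` {j. g v n k j \<noteq> 0})"
        by (intro UN_I[of "l - (m + m')"]) (auto intro!: image_eqI[of _ _ "j - s' (l - (m + m'))"])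
    qed
  qed (auto simp: fin_g)
  show "fmult (VO a b m s w) (VO a' b' m' s' w') =
      VO (\<lambda>r. a r + a' r) (\<lambda>r. b r + b' r) (m + m') (\<lambda>k. s' k + s (k + m'))
        (\<lambda>k. w' k * w (k + m') * poly P 1)"
  proof (rule fseries_eqI)
    fix v n l
    let ?k = "l - (m + m')"
    have "Poly_Mapping.lookup (fmult (VO a b m s w) (VO a' b' m' s' w') v n) l =
        Sum_any (\<lambda>j. cst (w' ?k * w (?k + m')) * g v n ?k (j - s' ?k))"
      unfolding fmult_def lookup_Sum_any[OF fin] lf ..
    also have "\<dots> = Sum_any (\<lambda>j. cst (w' ?k * w (?k + m')) * g v n ?k j)"
      by (rule Sum_any.reindex_cong[of "\<lambda>j. j + s' ?k"])
         (auto simp: bij_def inj_def fun_eq_iff intro!: surjI[of _ "\<lambda>j. j - s' ?k"])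
    also have "\<dots> = cst (w' ?k * w (?k + m')) * Sum_any (g v n ?k)"
      by (rule Sum_any_right_distrib[symmetric]) (rule fin_g)
    also have "Sum_any (g v n ?k) = cst (poly P 1) *
        Vop (\<lambda>r. a r + a' r) (\<lambda>r. b r + b' r) (n - s (?k + m') - s' ?k) (Poly_Mapping.lookup v ?k)"
      unfolding g_def by (rule Vop_comp(2)[OF assms])
    finally show "Poly_Mapping.lookup (fmult (VO a b m s w) (VO a' b' m' s' w') v n) l =
        Poly_Mapping.lookup (VO (\<lambda>r. a r + a' r) (\<lambda>r. b r + b' r) (m + m')
          (\<lambda>k. s' k + s (k + m')) (\<lambda>k. w' k * w (k + m') * poly P 1) v n) l"
      by (simp add: lookup_VO cst_mult algebra_simps)
  qed
qed

section \<open>Contractions\<close>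

text \<open>A logarithmic derivative turns products of polynomials into sums of coefficient
  sequences, so a contraction can be assembled from linear factors.\<close>

definition log_deriv_eq :: "(nat \<Rightarrow> qfield) \<Rightarrow> qfield poly \<Rightarrow> bool" where
  "log_deriv_eq f P \<longleftrightarrow> coeff P 0 = 1 \<and>
     (\<forall>i. of_nat i * coeff P i = - (\<Sum>r=1..i. f r * coeff P (i - r)))"

lemma contraction_eq_log_deriv_eq:
  "contraction b a P \<longleftrightarrow> log_deriv_eq (\<lambda>r. of_nat r * heis_norm r * b (int r) * a (int r)) P"
  by (simp add: contraction_def log_deriv_eq_def)

lemma log_deriv_eq_iff_fps:
  "log_deriv_eq f P \<longleftrightarrow> coeff P 0 = 1 \<and>
    fps_X * fps_deriv (fps_of_poly P) = - Abs_fps (\<lambda>r. if r = 0 then 0 else f r) * fps_of_poly P"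
proof -
  have "(fps_X * fps_deriv (fps_of_poly P)) $ i = of_nat i * coeff P i" for i
    by (cases i) simp_all
  moreover have "(- Abs_fps (\<lambda>r. if r = 0 then 0 else f r) * fps_of_poly P) $ i =
      - (\<Sum>r=1..i. f r * coeff P (i - r))" for i
  proof -
    have "(\<Sum>r=0..i. (if r = 0 then 0 else f r) * coeff P (i - r)) = (\<Sum>r=1..i. f r * coeff P (i - r))"
      by (rule sum.mono_neutral_cong_right) auto
    then show ?thesis by (simp add: fps_mult_nth sum_negf)
  qed
  ultimately show ?thesis by (simp add: log_deriv_eq_def fps_eq_iff)
qed

lemma log_deriv_eq_mult:
  assumes "log_deriv_eq f P" "log_deriv_eq g Q"
  shows "log_deriv_eq (\<lambda>r. f r + g r) (P * Q)"
proof -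
  let ?F = "\<lambda>f. Abs_fps (\<lambda>r. if r = 0 then 0 else f r) :: qfield fps"
  have FG: "?F (\<lambda>r. f r + g r) = ?F f + ?F g"
    by (rule fps_ext) simp
  have "fps_X * fps_deriv (fps_of_poly P * fps_of_poly Q) =
      (fps_X * fps_deriv (fps_of_poly P)) * fps_of_poly Q +
      fps_of_poly P * (fps_X * fps_deriv (fps_of_poly Q))"
    by (simp add: algebra_simps)
  also have "\<dots> = - ?F (\<lambda>r. f r + g r) * (fps_of_poly P * fps_of_poly Q)"
    using assms unfolding log_deriv_eq_iff_fps FG by (simp add: algebra_simps)
  finally show ?thesis
    using assms unfolding log_deriv_eq_iff_fps fps_of_poly_mult by (simp add: coeff_mult_0)
qed

text \<open>This is the geometric series for \<open>c X / (1 - c X)\<close>: a sequence of powers of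
  one scalar corresponds to one linear factor.\<close>

lemma log_deriv_eq_linear: "log_deriv_eq (\<lambda>r. c ^ r) [:1, - c:]"
proof -
  have "of_nat i * coeff [:1, - c:] i = - (\<Sum>r=1..i. c ^ r * coeff [:1, - c:] (i - r))" for i
  proof (cases i)
    case 0
    then show ?thesis by simp
  next
    case (Suc m)
    have "(\<Sum>r=1..i. c ^ r * coeff [:1, - c:] (i - r)) =
        (\<Sum>r\<in>{1..i} \<inter> {m, Suc m}. c ^ r * coeff [:1, - c:] (i - r))"
    proof (rule sum.mono_neutral_right)
      show "\<forall>r\<in>{1..i} - {1..i} \<inter> {m, Suc m}. c ^ r * coeff [:1, - c:] (i - r) = 0"
      proof
        fix r assume "r \<in> {1..i} - {1..i} \<inter> {m, Suc m}"
        then have "i - r \<ge> 2" using Suc by auto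
        then have "coeff [:1, - c:] (i - r) = 0"
          by (intro coeff_eq_0) (auto simp: degree_pCons_eq_if)
        then show "c ^ r * coeff [:1, - c:] (i - r) = 0" by simp
      qed
    qed auto
    also have "{1..i} \<inter> {m, Suc m} = (if m = 0 then {1} else {m, Suc m})"
      using Suc by auto
    finally show ?thesis
      using Suc by (cases m) (auto simp: coeff_pCons)
  qed
  then show ?thesis by (simp add: log_deriv_eq_def)
qed

lemma log_deriv_eq_cong:
  "(\<And>r. r \<ge> 1 \<Longrightarrow> f r = g r) \<Longrightarrow> log_deriv_eq f P \<Longrightarrow> log_deriv_eq g P"
  by (simp add: log_deriv_eq_def)

text \<open>The half powers of \<open>q\<close> cancel. The constant sequence 1 means a single
  linear factor between \<open>x\<close> and \<open>Y\<close>.\<close>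

lemma heis_norm_xcoeff_ycoeff:
  assumes "r \<ge> 1"
  shows "of_nat r * heis_norm r * xcoeff (int r) * ycoeff (int r) = 1"
proof -
  have "qint (int r) \<noteq> 0" "qint (2 * int r) \<noteq> 0"
    using qint_nonzero[OF assms] qint_nonzero[of "2 * r"] assms by simp_all
  moreover have "qhalf powi (- int r) * qhalf powi int r = 1"
    by (simp add: power_int_minus)
  moreover have "of_nat r * heis_norm r = qint (2 * int r) * qint (int r)"
    using assms by (simp add: heis_norm_def)
  ultimately show ?thesis by (simp add: xcoeff_def ycoeff_def)
qed

text \<open>Here the half powers combine to \<open>q^(-r)\<close>, and
  \<open>[2r]/[r] = q^r + q^(-r)\<close>. The result is a sum of two \<open>r\<close>-th powers,
  hence two linear factors; this is the origin of the zeros \<open>v = u\<close> and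
  \<open>v = qq * u\<close>.\<close>

lemma heis_norm_xcoeff_xcoeff:
  assumes "r \<ge> 1"
  shows "of_nat r * heis_norm r * xcoeff (int r) * xcoeff (int r) = 1 + inverse qq ^ r"
proof -
  have nz: "qint (int r) \<noteq> 0"
    using qint_nonzero[OF assms] .
  have q: "qvar ^ r = qhalf ^ r * qhalf ^ r" "qq ^ r = qvar ^ r * qvar ^ r"
    by (simp_all add: qvar_def qq_def power2_eq_square power_mult_distrib)
  have "of_nat r * heis_norm r = qint (2 * int r) * qint (int r)"
    using assms by (simp add: heis_norm_def)
  then have "of_nat r * heis_norm r * xcoeff (int r) * xcoeff (int r) =
      (qvar ^ r + inverse (qvar ^ r)) * inverse (qvar ^ r)"
    using nz by (simp add: qint_double[OF assms] xcoeff_def power_int_minus q(1))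
  also have "\<dots> = 1 + inverse qq ^ r"
    by (simp add: distrib_right power_inverse q(2))
  finally show ?thesis .
qed


section \<open>Normally ordered products\<close>

text \<open>The scalar contributed by the dilated lattice operators on the component
  \<open>k\<close>. A factor \<open>x(uz)\<close> meets a component already raised by the
  \<open>length us\<close> factors to its right, and its exponent is the pairing of \<alpha> with
  \<open>(k + length us)\<close> \<alpha> + \<lambda>.\<close>

primrec latw :: "qfield list \<Rightarrow> qfield \<Rightarrow> int \<Rightarrow> qfield" where
  "latw [] w k = (- w) powi k"
| "latw (u # us) w k = latw us w k * u powi (2 * (k + int (length us)) + 1)"

text \<open>\<open>nord [u\<^sub>1, \<dots>, u\<^sub>m] w s\<close> is \<open>z\<^sup>-\<^sup>s\<close> times the normally ordered product of
  \<open>x(u\<^sub>1z), \<dots>, x(u\<^sub>mz)\<close> and \<open>Y(wz)\<close>.\<close>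

definition nord :: "qfield list \<Rightarrow> qfield \<Rightarrow> int \<Rightarrow> fseries" where
  "nord us w s = VO (\<lambda>r. xcoeff r * (\<Sum>u\<leftarrow>us. u powi r) + ycoeff r * w powi r)
     (\<lambda>r. xcoeff r * (\<Sum>u\<leftarrow>us. u powi (- r)) + ycoeff r * w powi (- r))
     (int (length us)) (\<lambda>k. (2 * int (length us) + 1) * k + int (length us) ^ 2 - s) (latw us w)"

primrec contr_poly :: "qfield \<Rightarrow> qfield list \<Rightarrow> qfield \<Rightarrow> qfield poly" where
  "contr_poly u [] w = [:1, - (w / u):]"
| "contr_poly u (v # us) w = [:1, - (v / u):] * [:1, - (v / (qq * u)):] * contr_poly u us w"

primrec contr :: "qfield \<Rightarrow> qfield list \<Rightarrow> qfield \<Rightarrow> qfield" where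
  "contr u [] w = 1 - w / u"
| "contr u (v # us) w = (1 - v / u) * (1 - v / (qq * u)) * contr u us w"

lemma poly_contr_poly: "poly (contr_poly u us w) 1 = contr u us w"
proof (induction us)
  case (Cons v us)
  then show ?case by (simp only: contr_poly.simps contr.simps poly_mult) simp
qed simp

lemma contraction_contr_poly:
  assumes "u \<noteq> 0"
  shows "contraction (\<lambda>r. xcoeff r * u powi (- r))
    (\<lambda>r. xcoeff r * (\<Sum>v\<leftarrow>us. v powi r) + ycoeff r * w powi r) (contr_poly u us w)"
  unfolding contraction_eq_log_deriv_eq
proof (induction us)
  case Nil
  show ?case
    unfolding contr_poly.simps
  proof (rule log_deriv_eq_cong[OF _ log_deriv_eq_linear])
    fix r :: nat assume r: "r \<ge> 1"
    have "of_nat r * heis_norm r * (xcoeff (int r) * u powi - int r) * (ycoeff (int r) * w powi int r) =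
        (of_nat r * heis_norm r * xcoeff (int r) * ycoeff (int r)) * (w ^ r / u ^ r)"
      by (simp add: power_int_minus divide_inverse)
    then show "(w / u) ^ r = of_nat r * heis_norm r * (xcoeff (int r) * u powi - int r) *
        (xcoeff (int r) * (\<Sum>v\<leftarrow>[]. v powi int r) + ycoeff (int r) * w powi int r)"
      using heis_norm_xcoeff_ycoeff[OF r] by (simp add: power_divide)
  qed
next
  case (Cons v us)
  let ?f = "\<lambda>us r. of_nat r * heis_norm r * (xcoeff (int r) * u powi - int r) *
        (xcoeff (int r) * (\<Sum>v\<leftarrow>us. v powi int r) + ycoeff (int r) * w powi int r)"
  have "log_deriv_eq (\<lambda>r. (v / u) ^ r + (v / (qq * u)) ^ r + ?f us r) (contr_poly u (v # us) w)"
    unfolding contr_poly.simps by (intro log_deriv_eq_mult log_deriv_eq_linear Cons.IH)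
  then show ?case
  proof (rule log_deriv_eq_cong[rotated])
    fix r :: nat assume r: "r \<ge> 1"
    have "?f (v # us) r = (of_nat r * heis_norm r * xcoeff (int r) * xcoeff (int r)) * (v ^ r / u ^ r) + ?f us r"
      by (simp add: power_int_minus divide_inverse algebra_simps)
    also have "(of_nat r * heis_norm r * xcoeff (int r) * xcoeff (int r)) * (v ^ r / u ^ r) =
        (v / u) ^ r + (v / (qq * u)) ^ r"
      unfolding heis_norm_xcoeff_xcoeff[OF r]
      by (simp add: power_divide power_mult_distrib distrib_right power_inverse divide_inverse)
    finally show "(v / u) ^ r + (v / (qq * u)) ^ r + ?f us r = ?f (v # us) r" ..
  qed
qed

lemma anni_dilate: "anni (\<lambda>r. b r * t powi (- r)) n p = cst (inverse t ^ n) * anni b n p"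
proof -
  have "dcoeff (\<lambda>r. b r * t powi (- r)) k n p = cst (inverse t ^ n) * dcoeff b k n p" for k
  proof (induction k arbitrary: n)
    case (Suc k)
    have "- cst (b (int r) * t powi (- int r)) *
          heis (int r) (dcoeff (\<lambda>r. b r * t powi (- r)) k (n - r) p) =
        cst (inverse t ^ n) * (- cst (b (int r)) * heis (int r) (dcoeff b k (n - r) p))"
      if "r \<in> {1..n}" for r
    proof -
      have "inverse t ^ r * inverse t ^ (n - r) = inverse t ^ n"
        using that by (simp only: power_add[symmetric]) simp
      then have "cst (inverse t ^ n) = cst (inverse t ^ r) * cst (inverse t ^ (n - r))"
        by (simp only: cst_mult[symmetric])
      then show ?thesis
        using that unfolding Suc
        by (simp add: heis_pos_cst_mult cst_mult power_int_minus power_inverse)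
    qed
    then show ?case by (simp add: sum_distrib_left)
  qed simp
  then show ?thesis by (simp add: anni_def sum_distrib_left mult.left_commute)
qed

lemma creaI_dilate: "creaI (\<lambda>r. a r * t powi r) n = cst (t powi n) * creaI a n"
proof (cases "n < 0")
  case False
  then have "t powi n = t ^ nat n" using power_int_of_nat[of t "nat n"] by simp
  then show ?thesis using False by (simp add: creaI_def crea_dilate)
qed (simp add: creaI_def)

lemma Vop_dilate:
  assumes "t \<noteq> 0"
  shows "Vop (\<lambda>r. a r * t powi r) (\<lambda>r. b r * t powi (- r)) n p = cst (t powi n) * Vop a b n p"
proof -
  obtain d where d: "\<And>i. i > d \<Longrightarrow> anni b i p = 0"
    using anni_bounded[of b p] by blast
  have "t powi n = t powi (n + int i) * inverse t ^ i" for i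
    using assms by (simp add: power_int_add power_inverse)
  then have t: "cst (t powi n) = cst (t powi (n + int i)) * cst (inverse t ^ i)" for i
    by (simp only: cst_mult[symmetric])
  have "Vop (\<lambda>r. a r * t powi r) (\<lambda>r. b r * t powi (- r)) n p =
      (\<Sum>i\<le>d. cst (t powi (n + int i)) * creaI a (n + int i) * (cst (inverse t ^ i) * anni b i p))"
    by (subst Vop_eq_sum[where d = d]) (simp_all only: d anni_dilate creaI_dilate mult_zero_right)
  also have "\<dots> = (\<Sum>i\<le>d. cst (t powi n) * (creaI a (n + int i) * anni b i p))"
  proof (intro sum.cong refl)
    fix i
    show "cst (t powi (n + int i)) * creaI a (n + int i) * (cst (inverse t ^ i) * anni b i p) =
        cst (t powi n) * (creaI a (n + int i) * anni b i p)"
      unfolding t[of i] by (simp only: mult_ac)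
  qed
  also have "\<dots> = cst (t powi n) * Vop a b n p"
    by (subst Vop_eq_sum[where d = d]) (simp_all only: d sum_distrib_left)
  finally show ?thesis .
qed

lemma dilate_VO:
  assumes "t \<noteq> 0"
  shows "dilate t (VO a b m s w) =
    VO (\<lambda>r. a r * t powi r) (\<lambda>r. b r * t powi (- r)) m s (\<lambda>k. w k * t powi (s k))"
proof (rule fseries_eqI)
  fix v n k
  have "t powi n = t powi (s (k - m)) * t powi (n - s (k - m))"
    using assms by (simp flip: power_int_add)
  then show "Poly_Mapping.lookup (dilate t (VO a b m s w) v n) k = Poly_Mapping.lookup
      (VO (\<lambda>r. a r * t powi r) (\<lambda>r. b r * t powi (- r)) m s (\<lambda>k. w k * t powi (s k)) v n) k"
    by (simp add: dilate_def lookup_scaleL lookup_VO Vop_dilate[OF assms] cst_mult mult_ac)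
qed

lemma fscale_VO: "fscale c (VO a b m s w) = VO a b m s (\<lambda>k. c * w k)"
  by (rule fseries_eqI) (simp add: fscale_def lookup_scaleL lookup_VO cst_mult mult.assoc)

lemma sum_list_powi_dilate:
  "(\<Sum>u\<leftarrow>map ((*) t) us. u powi r) = (\<Sum>u\<leftarrow>us. u powi r) * t powi r" for t :: qfield
  by (induction us) (simp_all add: distrib_right power_int_mult_distrib)

text \<open>The exponent is the total power of \<open>z\<close> of the lattice part:
  \<open>k\<close> from \<open>Y\<close> and \<open>2 * (k + i) + 1\<close> from the factor
  \<open>x\<close> preceded by \<open>i\<close> others.\<close>

lemma latw_dilate:
  assumes "t \<noteq> 0"
  shows "latw (map ((*) t) us) (t * w) k =
    latw us w k * t powi ((2 * int (length us) + 1) * k + int (length us) ^ 2)"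
proof (induction us)
  case Nil
  have "(- (t * w)) powi k = (t * - w) powi k" by simp
  then show ?case by (simp only: latw.simps list.map power_int_mult_distrib) simp
next
  case (Cons u us)
  let ?L = "int (length us)"
  have "(2 * int (length (u # us)) + 1) * k + int (length (u # us)) ^ 2 =
     ((2 * ?L + 1) * k + ?L ^ 2) + (2 * (k + ?L) + 1)"
    by (simp add: algebra_simps power2_eq_square)
  then have "t powi ((2 * int (length (u # us)) + 1) * k + int (length (u # us)) ^ 2) =
     t powi ((2 * ?L + 1) * k + ?L ^ 2) * t powi (2 * (k + ?L) + 1)"
    by (simp only: power_int_add[OF disjI1[OF assms]])
  then show ?case
    unfolding latw.simps list.map Cons power_int_mult_distrib length_map by simp
qed

lemma dilate_nord:
  assumes "t \<noteq> 0"
  shows "dilate t (nord us w s) = fscale (t powi (- s)) (nord (map ((*) t) us) (t * w) s)"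
proof -
  have "latw us w k * t powi ((2 * int (length us) + 1) * k + int (length us) ^ 2 - s) =
      t powi (- s) * latw (map ((*) t) us) (t * w) k" for k
    using assms by (simp add: latw_dilate power_int_diff power_int_minus divide_inverse)
  moreover have "(c * (\<Sum>u\<leftarrow>us. u powi r) + d * w powi r) * t powi r =
      c * (\<Sum>u\<leftarrow>map ((*) t) us. u powi r) + d * (t * w) powi r" for c d r
    unfolding sum_list_powi_dilate power_int_mult_distrib by (simp add: algebra_simps)
  ultimately show ?thesis
    unfolding nord_def dilate_VO[OF assms] fscale_VO
    by (simp del: map_map)
qed

lemma koyama_eq_nord: "koyama = nord [] 1 0"
proof -
  have "latw [] 1 = (\<lambda>k. (- 1) powi k)" by (rule ext) simp
  then show ?thesis by (simp add: koyama_eq_VO nord_def)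
qed


section \<open>Products with the Frenkel--Jing operator\<close>

text \<open>Multiplication by \<open>z^(-n)\<close>.\<close>

definition fshift :: "nat \<Rightarrow> fseries \<Rightarrow> fseries" where
  "fshift n A v j = A v (j + int n)"

lemma fshift_nord: "fshift n (nord us w s) = nord us w (s + int n)"
  by (rule fseries_eqI) (simp add: fshift_def nord_def lookup_VO algebra_simps)

definition Xop :: "qfield \<Rightarrow> fseries \<Rightarrow> fseries" where
  "Xop u b = fmult (dilate u (frenkel_jing 1)) b"

text \<open>Local finiteness, which \<open>Sum_any\<close> needs to be the sum of the whole family
  (it is \<open>0\<close> on infinite supports).\<close>

definition regular :: "fseries \<Rightarrow> bool" where
  "regular b \<longleftrightarrow> (\<forall>v n. finite {j. frenkel_jing 1 (b v j) (n - j) \<noteq> 0})"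

lemma scaleL_eq_0_iff: "scaleL c v = 0 \<longleftrightarrow> c = 0 \<or> v = 0"
proof
  assume *: "scaleL c v = 0"
  show "c = 0 \<or> v = 0"
  proof (rule disjCI)
    assume "v \<noteq> 0"
    show "c = 0"
    proof (rule ccontr)
      assume "c \<noteq> 0"
      have "Poly_Mapping.lookup v k = cst (inverse c) * Poly_Mapping.lookup (scaleL c v) k" for k
        using \<open>c \<noteq> 0\<close> by (simp add: lookup_scaleL mult.assoc[symmetric] flip: cst_mult)
      with * have "v = 0" by (intro poly_mapping_eqI) simp
      with \<open>v \<noteq> 0\<close> show False by simp
    qed
  qed
next
  assume "c = 0 \<or> v = 0"
  then show "scaleL c v = 0" by (intro poly_mapping_eqI) (auto simp: lookup_scaleL)
qed

lemma frenkel_jing_linear: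
  shows "frenkel_jing 1 (v + v') n = frenkel_jing 1 v n + frenkel_jing 1 v' n"
    and "frenkel_jing 1 (scaleL c v) n = scaleL c (frenkel_jing 1 v n)"
    and "frenkel_jing 1 0 n = 0"
  unfolding frenkel_jing_eq_VO by (rule VO_add VO_scaleL VO_0)+

lemma regular_0: "regular 0"
  by (simp add: regular_def frenkel_jing_linear)

lemma regular_add:
  assumes "regular b" "regular b'"
  shows "regular (b + b')"
  unfolding regular_def
proof (intro allI)
  fix v n
  have "{j. frenkel_jing 1 ((b + b') v j) (n - j) \<noteq> 0} \<subseteq>
      {j. frenkel_jing 1 (b v j) (n - j) \<noteq> 0} \<union> {j. frenkel_jing 1 (b' v j) (n - j) \<noteq> 0}"
    by (auto simp: frenkel_jing_linear)
  then show "finite {j. frenkel_jing 1 ((b + b') v j) (n - j) \<noteq> 0}"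
    by (rule finite_subset) (use assms in \<open>simp add: regular_def\<close>)
qed

lemma regular_fscale:
  assumes "regular b"
  shows "regular (fscale c b)"
  unfolding regular_def
proof (intro allI)
  fix v n
  have "{j. frenkel_jing 1 (fscale c b v j) (n - j) \<noteq> 0} \<subseteq> {j. frenkel_jing 1 (b v j) (n - j) \<noteq> 0}"
    by (auto simp: frenkel_jing_linear fscale_def scaleL_eq_0_iff)
  then show "finite {j. frenkel_jing 1 (fscale c b v j) (n - j) \<noteq> 0}"
    by (rule finite_subset) (use assms in \<open>simp add: regular_def\<close>)
qed

lemma regular_dilate:
  assumes "regular b" "t \<noteq> 0"
  shows "regular (dilate t b)"
  using assms by (simp add: regular_def dilate_def frenkel_jing_linear scaleL_eq_0_iff)

lemma Xop_add:
  assumes "regular b" "regular b'"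
  shows "Xop u (b + b') = Xop u b + Xop u b'"
proof (intro ext)
  fix v n
  have sub: "{j. dilate u (frenkel_jing 1) (b v j) (n - j) \<noteq> 0} \<subseteq> {j. frenkel_jing 1 (b v j) (n - j) \<noteq> 0}"
    for b :: fseries by (auto simp: dilate_def scaleL_eq_0_iff)
  have fin: "finite {j. dilate u (frenkel_jing 1) (b v j) (n - j) \<noteq> 0}" if "regular b" for b
    by (rule finite_subset[OF sub]) (use that in \<open>simp add: regular_def\<close>)
  have lin: "dilate u (frenkel_jing 1) (x + y) k =
      dilate u (frenkel_jing 1) x k + dilate u (frenkel_jing 1) y k" for x y k
    unfolding dilate_def frenkel_jing_linear by (simp add: scaleL_def distrib_left)
  show "Xop u (b + b') v n = (Xop u b + Xop u b') v n"
    unfolding Xop_def fmult_def plus_fun_apply lin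
    by (rule Sum_any.distrib[OF fin fin]) (use assms in auto)
qed

lemma scaleL_Sum_any:
  assumes "finite {j. f j \<noteq> 0}"
  shows "scaleL c (Sum_any f) = Sum_any (\<lambda>j. scaleL c (f j))"
  unfolding scaleL_def by (rule Sum_any_right_distrib[OF assms])

lemma Xop_fscale:
  assumes "regular b"
  shows "Xop u (fscale c b) = fscale c (Xop u b)"
proof (intro ext)
  fix v n
  have sub: "{j. dilate u (frenkel_jing 1) (b v j) (n - j) \<noteq> 0} \<subseteq> {j. frenkel_jing 1 (b v j) (n - j) \<noteq> 0}"
    by (auto simp: dilate_def scaleL_eq_0_iff)
  have fin: "finite {j. dilate u (frenkel_jing 1) (b v j) (n - j) \<noteq> 0}"
    by (rule finite_subset[OF sub]) (use assms in \<open>simp add: regular_def\<close>)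
  have lin: "dilate u (frenkel_jing 1) (scaleL c x) k = scaleL c (dilate u (frenkel_jing 1) x k)" for x k
    unfolding dilate_def frenkel_jing_linear by (simp add: scaleL_def mult.left_commute)
  show "Xop u (fscale c b) v n = fscale c (Xop u b) v n"
    unfolding Xop_def fmult_def fscale_def lin by (rule scaleL_Sum_any[OF fin, symmetric])
qed

lemma dilate_linear:
  shows "dilate t (b + b') = dilate t b + dilate t b'" "dilate t (fscale c b) = fscale c (dilate t b)"
  by (intro ext, simp add: dilate_def scaleL_def fscale_def algebra_simps)+

lemma fshift_linear:
  shows "fshift n (b + b') = fshift n b + fshift n b'" "fshift n (fscale c b) = fscale c (fshift n b)"
  by (intro ext, simp add: fshift_def fscale_def)+

lemma regular_nord: "regular (nord us w s)"
proof -
  \<comment> \<open>The undilated operator \<open>x(z)\<close> is the case \<open>u = 1\<close>; the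
    finiteness in \<open>VO_comp\<close> then gives regularity.\<close>
  have "contraction xcoeff (\<lambda>r. xcoeff r * (\<Sum>v\<leftarrow>us. v powi r) + ycoeff r * w powi r) (contr_poly 1 us w)"
    using contraction_contr_poly[of 1 us w] by simp
  from VO_comp(1)[OF this] show ?thesis
    unfolding regular_def frenkel_jing_eq_VO nord_def by blast
qed

lemma Xop_nord:
  assumes "u \<noteq> 0"
  shows "Xop u (nord us w s) = fscale (contr u us w) (nord (u # us) w s)"
proof -
  have VO_cong: "VO a b m f g = VO a' b' m' f' g'"
    if "\<And>r. a r = a' r" "\<And>r. b r = b' r" "m = m'" "\<And>k. f k = f' k" "\<And>k. g k = g' k"
    for a b m f g a' b' m' f' g'
    using that by presburger
  show ?thesis
    unfolding Xop_def frenkel_jing_eq_VO dilate_VO[OF assms] nord_def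
      VO_comp(2)[OF contraction_contr_poly[OF assms]] fscale_VO poly_contr_poly
    by (rule VO_cong) (simp_all add: algebra_simps power2_eq_square)
qed

section \<open>Quantum derivatives as divided differences\<close>

lemma fseries_sum_apply: "(sum f A :: fseries) v n = (\<Sum>x\<in>A. f x v n)"
  by (induction A rule: infinite_finite_induct) auto

lemma scaleL_sum: "scaleL c (sum f A) = (\<Sum>x\<in>A. scaleL c (f x))"
  by (simp add: scaleL_def sum_distrib_left)

lemma scaleL_sum_left: "scaleL (sum f A) v = (\<Sum>x\<in>A. scaleL (f x) v)"
proof (induction A rule: infinite_finite_induct)
  case (insert x A)
  then show ?case by (simp add: scaleL_def single_add distrib_right)
qed (simp_all add: scaleL_def)

lemma scaleL_scaleL: "scaleL c (scaleL d v) = scaleL (c * d) v"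
  by (simp add: scaleL_def mult_single mult.assoc[symmetric])

text \<open>The barycentric weights at the nodes \<open>1, qq, ..., qq^n\<close>: the divided
  difference of \<open>f\<close> there is the sum of \<open>wt n i * f (qq^i)\<close>.\<close>

definition wt :: "nat \<Rightarrow> nat \<Rightarrow> qfield" where
  "wt n i = inverse (\<Prod>j\<in>{..n} - {i}. qq ^ i - qq ^ j)"

lemma wt_nonzero: "wt n i \<noteq> 0"
  by (simp add: wt_def)

lemma wt_Suc_left:
  "wt (Suc n) i * (qq ^ i - qq ^ Suc n) = (if i \<le> n then wt n i else 0)" if "i \<le> Suc n"
proof (cases "i = Suc n")
  case False
  with that have i: "i \<le> n" by simp
  then have "{..Suc n} - {i} = insert (Suc n) ({..n} - {i})" by auto
  then have "(\<Prod>j\<in>{..Suc n} - {i}. qq ^ i - qq ^ j) =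
      (qq ^ i - qq ^ Suc n) * (\<Prod>j\<in>{..n} - {i}. qq ^ i - qq ^ j)"
    by simp
  moreover have "qq ^ i - qq ^ Suc n \<noteq> 0"
    using i by (simp only: right_minus_eq qq_power_eq_iff)
  ultimately show ?thesis using i by (simp add: wt_def del: power_Suc)
qed simp

lemma wt_Suc_right:
  "wt (Suc n) (Suc i) * (qq ^ Suc i - 1) = inverse (qq ^ n) * wt n i" if "i \<le> n"
proof -
  have set: "{..Suc n} - {Suc i} = insert 0 (Suc ` ({..n} - {i}))"
    unfolding atMost_Suc_eq_insert_0 by auto
  have "(\<Prod>j\<in>{..Suc n} - {Suc i}. qq ^ Suc i - qq ^ j) =
      (qq ^ Suc i - 1) * (\<Prod>j\<in>{..n} - {i}. qq ^ Suc i - qq ^ Suc j)"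
    unfolding set by (subst prod.insert) (auto simp: prod.reindex)
  also have "(\<Prod>j\<in>{..n} - {i}. qq ^ Suc i - qq ^ Suc j) = (\<Prod>j\<in>{..n} - {i}. qq * (qq ^ i - qq ^ j))"
    by (simp add: algebra_simps)
  also have "\<dots> = qq ^ n * (\<Prod>j\<in>{..n} - {i}. qq ^ i - qq ^ j)"
    using that by (simp add: prod.distrib)
  finally have "wt (Suc n) (Suc i) = inverse (qq ^ Suc i - 1) * (inverse (qq ^ n) * wt n i)"
    unfolding wt_def by (simp del: power_Suc)
  moreover have "qq ^ Suc i - 1 \<noteq> 0"
    by (simp only: right_minus_eq qq_power_eq_1_iff nat.simps not_False_eq_True)
  ultimately show ?thesis by (simp del: power_Suc)
qed

text \<open>For \<open>y = qq^k\<close> this is the recursion of divided differences of the function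
  \<open>u^k\<close>, because \<open>y^i = (qq^i)^k\<close>. The nodes without the first are
  \<open>qq\<close> times the nodes \<open>1, ..., qq^n\<close>, which accounts for the factor
  \<open>y * inverse (qq^n)\<close>.\<close>

lemma wt_generating_rec:
  "(qq ^ Suc n - 1) * (\<Sum>i\<le>Suc n. wt (Suc n) i * y ^ i) =
    (y * inverse (qq ^ n) - 1) * (\<Sum>i\<le>n. wt n i * y ^ i)"
proof -
  have "(qq ^ Suc n - 1) * (\<Sum>i\<le>Suc n. wt (Suc n) i * y ^ i) =
      (\<Sum>i\<le>Suc n. (wt (Suc n) i * (qq ^ i - 1)) * y ^ i) -
      (\<Sum>i\<le>Suc n. (wt (Suc n) i * (qq ^ i - qq ^ Suc n)) * y ^ i)"
    unfolding sum_distrib_left sum_subtractf[symmetric] by (intro sum.cong refl) (simp add: algebra_simps)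
  also have "(\<Sum>i\<le>Suc n. (wt (Suc n) i * (qq ^ i - 1)) * y ^ i) =
      (\<Sum>i\<le>n. (wt (Suc n) (Suc i) * (qq ^ Suc i - 1)) * y ^ Suc i)"
    unfolding sum.atMost_Suc_shift by simp
  also have "\<dots> = (\<Sum>i\<le>n. inverse (qq ^ n) * wt n i * y ^ Suc i)"
    by (intro sum.cong refl) (simp only: wt_Suc_right atMost_iff)
  also have "(\<Sum>i\<le>Suc n. (wt (Suc n) i * (qq ^ i - qq ^ Suc n)) * y ^ i) =
      (\<Sum>i\<le>Suc n. (if i \<le> n then wt n i else 0) * y ^ i)"
    by (intro sum.cong refl) (simp only: wt_Suc_left atMost_iff)
  also have "\<dots> = (\<Sum>i\<le>n. wt n i * y ^ i)"
    by (simp add: sum.atMost_Suc)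
  also have "(\<Sum>i\<le>n. inverse (qq ^ n) * wt n i * y ^ Suc i) - (\<Sum>i\<le>n. wt n i * y ^ i) =
      (y * inverse (qq ^ n) - 1) * (\<Sum>i\<le>n. wt n i * y ^ i)"
    unfolding sum_distrib_left sum_subtractf[symmetric] by (intro sum.cong refl) (simp add: algebra_simps)
  finally show ?thesis .
qed

text \<open>The normalised \<open>n\<close>-th \<open>qq\<close>-derivative is \<open>z\<^sup>-\<^sup>n\<close> times the divided difference
  in the dilation parameter at the nodes \<open>1, qq, \<dots>, qq\<^sup>n\<close>.\<close>

lemma qderiv_funpow:
  "(qderiv ^^ n) A v j =
    scaleL (qqfact n * (\<Sum>i\<le>n. wt n i * (qq powi (j + int n)) ^ i)) (A v (j + int n))"
proof (induction n arbitrary: j)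
  case 0
  show ?case by (simp add: qqfact_def wt_def scaleL_def)
next
  case (Suc n)
  define y where "y = qq powi (j + int (Suc n))"
  have y: "qq powi (j + 1) = y * inverse (qq ^ n)"
    unfolding y_def by (simp add: power_int_add field_simps)
  have nz: "qq - 1 \<noteq> 0"
    using qq_power_eq_1_iff[of 1] by simp
  have qderiv: "qderiv B v j = scaleL ((qq powi (j + 1) - 1) / (qq - 1)) (B v (j + 1))" for B
  proof -
    have "dilate qq B v (j + 1) - B v (j + 1) = scaleL (qq powi (j + 1) - 1) (B v (j + 1))"
      by (simp add: dilate_def scaleL_def single_diff left_diff_distrib)
    then show ?thesis by (simp add: qderiv_def scaleL_scaleL)
  qed
  have fact: "qqfact (Suc n) = qqfact n * ((qq ^ Suc n - 1) / (qq - 1))"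
    by (simp add: qqfact_def qqint_def prod.atLeast1_atMost_eq)
  have "(qderiv ^^ Suc n) A v j = scaleL ((y * inverse (qq ^ n) - 1) / (qq - 1) *
      (qqfact n * (\<Sum>i\<le>n. wt n i * y ^ i))) (A v (j + int (Suc n)))"
  proof -
    have "j + 1 + int n = j + int (Suc n)" by simp
    then show ?thesis
      by (simp only: funpow.simps o_apply qderiv Suc scaleL_scaleL y y_def)
  qed
  also have "(y * inverse (qq ^ n) - 1) / (qq - 1) * (qqfact n * (\<Sum>i\<le>n. wt n i * y ^ i)) =
      qqfact n / (qq - 1) * ((y * inverse (qq ^ n) - 1) * (\<Sum>i\<le>n. wt n i * y ^ i))"
    by simp
  also have "\<dots> = qqfact (Suc n) * (\<Sum>i\<le>Suc n. wt (Suc n) i * y ^ i)"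
    unfolding wt_generating_rec[symmetric] fact by simp
  finally show ?case by (simp only: y_def)
qed

lemma qqfact_nonzero: "qqfact n \<noteq> 0"
proof -
  have "qqint m \<noteq> 0" if "m \<ge> 1" for m
    using that qq_power_eq_1_iff[of 1] by (simp add: qqint_def)
  then show ?thesis by (simp add: qqfact_def)
qed

text \<open>The index \<open>n = -l - 1\<close> is the order of the derivative.\<close>

abbreviation XP :: "nat \<Rightarrow> fseries \<Rightarrow> fseries" where
  "XP n \<equiv> xprod (- int n - 1)"

lemma XP_regular:
  assumes "regular b"
  shows "XP n b = fshift n (\<Sum>i\<le>n. fscale (wt n i) (Xop (qq ^ i) (dilate (qq ^ n) b)))"
proof (intro ext)
  fix v j
  define B where "B = dilate (qq ^ n) b"
  have "regular B"
    unfolding B_def by (rule regular_dilate[OF assms]) simp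
  \<comment> \<open>Dilating \<open>x(z)\<close> only rescales its coefficients, so this finite set
    carries the summands for all the nodes at once and the sums may be exchanged.\<close>
  define S where "S = {i. frenkel_jing 1 (B v i) (j + int n - i) \<noteq> 0}"
  have S: "finite S"
    using \<open>regular B\<close> unfolding S_def regular_def by blast
  let ?x = "\<lambda>i. frenkel_jing 1 (B v i) (j + int n - i)"
  let ?g = "\<lambda>i k. (qq powi (j + int n - i)) ^ k"
  have pw: "(qq ^ k) powi m = (qq powi m) ^ k" for k m
    by (simp add: power_int_power power_int_power' mult.commute)
  have "XP n b v j = scaleL (1 / qqfact n) (Sum_any (\<lambda>i.
      scaleL (qqfact n * (\<Sum>k\<le>n. wt n k * ?g i k)) (?x i)))"
    by (simp add: xprod_def fscale_def fmult_def qderiv_funpow B_def power_int_of_nat algebra_simps)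
  also have "Sum_any (\<lambda>i. scaleL (qqfact n * (\<Sum>k\<le>n. wt n k * ?g i k)) (?x i)) =
      (\<Sum>i\<in>S. scaleL (qqfact n * (\<Sum>k\<le>n. wt n k * ?g i k)) (?x i))"
    by (rule Sum_any.expand_superset[OF S]) (auto simp: S_def scaleL_eq_0_iff)
  also have "scaleL (1 / qqfact n) \<dots> = (\<Sum>i\<in>S. \<Sum>k\<le>n. scaleL (wt n k * ?g i k) (?x i))"
    using qqfact_nonzero[of n] by (simp add: scaleL_sum scaleL_scaleL flip: scaleL_sum_left)
  also have "\<dots> = (\<Sum>k\<le>n. \<Sum>i\<in>S. scaleL (wt n k * ?g i k) (?x i))"
    by (rule sum.swap)
  also have "\<dots> = (\<Sum>k\<le>n. fscale (wt n k) (Xop (qq ^ k) B) v (j + int n))"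
  proof (intro sum.cong refl)
    fix k
    have "Xop (qq ^ k) B v (j + int n) = Sum_any (\<lambda>i. scaleL (?g i k) (?x i))"
      by (simp add: Xop_def fmult_def dilate_def pw)
    also have "\<dots> = (\<Sum>i\<in>S. scaleL (?g i k) (?x i))"
      by (rule Sum_any.expand_superset[OF S]) (auto simp: S_def scaleL_eq_0_iff)
    finally show "(\<Sum>i\<in>S. scaleL (wt n k * ?g i k) (?x i)) = fscale (wt n k) (Xop (qq ^ k) B) v (j + int n)"
      by (simp add: fscale_def scaleL_sum scaleL_scaleL)
  qed
  finally show "XP n b v j = fshift n (\<Sum>i\<le>n. fscale (wt n i) (Xop (qq ^ i) (dilate (qq ^ n) b))) v j"
    by (simp add: fshift_def fseries_sum_apply B_def)
qed

text \<open>The working space: all its members are regular, and it is stable under every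
  \<open>XP n\<close>, so iterated products remain linear.\<close>

definition Reg :: "fseries set" where
  "Reg = fseries.span {nord us w s | us w s. True}"

lemma subspace_Reg: "fseries.subspace Reg"
  unfolding Reg_def by (rule fseries.subspace_span)

lemma nord_in_Reg: "nord us w s \<in> Reg"
  unfolding Reg_def by (rule fseries.span_base) blast

lemma Reg_induct [consumes 1, case_names zero step]:
  assumes "b \<in> Reg" and zero: "P 0"
    and step: "\<And>c us w s y. y \<in> Reg \<Longrightarrow> P y \<Longrightarrow> P (fscale c (nord us w s) + y)"
  shows "P b"
proof -
  have "b \<in> Reg \<and> P b"
    using assms(1)[unfolded Reg_def]
  proof (induction rule: fseries.span_induct_alt)
    case base
    show ?case using zero fseries.subspace_0[OF subspace_Reg] by blast
  next
    case (step c x y)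
    then obtain us w s where x: "x = nord us w s" by blast
    have "fscale c x + y \<in> Reg"
      unfolding x using step(2)
      by (intro fseries.subspace_add[OF subspace_Reg] fseries.subspace_scale[OF subspace_Reg]
          nord_in_Reg) blast
    moreover have "P (fscale c x + y)"
      unfolding x using step(2) assms(3) by blast
    ultimately show ?case ..
  qed
  then show ?thesis ..
qed

lemma Reg_regular:
  assumes "b \<in> Reg"
  shows "regular b"
proof -
  have "Reg \<subseteq> {b. regular b}"
    unfolding Reg_def
    by (rule fseries.span_minimal)
       (auto simp: regular_nord fseries.subspace_def regular_0 regular_add regular_fscale)
  then show ?thesis using assms by blast
qed

lemma XP_linear:
  assumes "b \<in> Reg"
  shows XP_add: "b' \<in> Reg \<Longrightarrow> XP n (b + b') = XP n b + XP n b'"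
    and XP_fscale: "XP n (fscale c b) = fscale c (XP n b)"
proof -
  have r: "regular b" by (rule Reg_regular[OF assms])
  have rd: "regular (dilate (qq ^ n) b)" if "regular b" for b
    by (rule regular_dilate[OF that]) simp
  show "XP n (b + b') = XP n b + XP n b'" if "b' \<in> Reg"
    using r Reg_regular[OF that]
    by (simp add: XP_regular regular_add dilate_linear Xop_add rd fseries.scale_right_distrib
        sum.distrib fshift_linear)
  have "XP n (fscale c b) = fshift n (\<Sum>i\<le>n. fscale c (fscale (wt n i) (Xop (qq ^ i) (dilate (qq ^ n) b))))"
    using r by (simp add: XP_regular regular_fscale dilate_linear Xop_fscale rd mult.commute)
  also have "\<dots> = fscale c (XP n b)"
    unfolding fseries.scale_sum_right[symmetric] fshift_linear XP_regular[OF r] ..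
  finally show "XP n (fscale c b) = fscale c (XP n b)" .
qed

lemma zero_in_Reg: "0 \<in> Reg"
  using subspace_Reg by (rule fseries.subspace_0)

lemma XP_0: "XP n 0 = 0"
  using XP_fscale[OF zero_in_Reg, of n 0] by (simp only: fseries.scale_zero_left)

lemma XP_sum:
  assumes "\<And>x. x \<in> A \<Longrightarrow> f x \<in> Reg"
  shows "XP n (sum f A) = (\<Sum>x\<in>A. XP n (f x))"
  using assms
proof (induction A rule: infinite_finite_induct)
  case (insert x A)
  have "sum f A \<in> Reg"
    using insert by (intro fseries.subspace_sum[OF subspace_Reg]) auto
  then have "XP n (f x + sum f A) = XP n (f x) + XP n (sum f A)"
    using insert by (intro XP_add) auto
  moreover have "XP n (sum f A) = (\<Sum>x\<in>A. XP n (f x))"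
    using insert by blast
  ultimately show ?case by (simp only: sum.insert[OF insert(1,2)])
qed (simp_all only: sum.infinite sum.empty XP_0 not_False_eq_True)

lemma fshift_sum: "fshift n (sum f A) = (\<Sum>x\<in>A. fshift n (f x))"
  by (intro ext) (simp add: fshift_def fseries_sum_apply)

text \<open>The new factor receives an exponent \<open>i\<close> between 0 and \<open>n\<close>,
  while dilation raises all earlier exponents by \<open>n\<close>. All exponent combinatorics below
  comes from this rule.\<close>

lemma XP_nord:
  "XP n (nord us w s) = (\<Sum>i\<le>n. fscale (wt n i * (qq ^ n) powi (- s) *
      contr (qq ^ i) (map ((*) (qq ^ n)) us) (qq ^ n * w))
    (nord (qq ^ i # map ((*) (qq ^ n)) us) (qq ^ n * w) (s + int n)))"
  by (simp add: XP_regular[OF regular_nord] dilate_nord Xop_fscale[OF regular_nord] Xop_nord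
      fshift_sum fshift_linear fshift_nord mult.assoc del: power_int_minus)

lemma XP_in_Reg:
  assumes "b \<in> Reg"
  shows "XP n b \<in> Reg"
  using assms
proof (induction rule: Reg_induct)
  case zero
  show ?case by (simp only: XP_0 zero_in_Reg)
next
  case (step c us w s y)
  have "XP n (nord us w s) \<in> Reg"
    unfolding XP_nord
    by (intro fseries.subspace_sum[OF subspace_Reg] fseries.subspace_scale[OF subspace_Reg] nord_in_Reg)
  with step show ?case
    by (simp only: XP_add XP_fscale nord_in_Reg fseries.subspace_scale[OF subspace_Reg]
        fseries.subspace_add[OF subspace_Reg])
qed

section \<open>Quadratic relations and spanning\<close>

text \<open>The contraction depends only on ratios of the points.\<close>

lemma contr_dilate:
  assumes "c \<noteq> 0"
  shows "contr (c * u) (map ((*) c) us) (c * w) = contr u us w"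
  using assms by (induction us) (simp_all add: mult.left_commute[of qq c])

text \<open>The coefficient of the functional taking divided differences at \<open>qq\<^sup>0, \<dots>, qq\<^sup>n\<close> in one
  variable and at \<open>qq\<^sup>n, \<dots>, qq\<^sup>N\<close> in another, relative to the common denominator of the
  divided differences at all of the nodes \<open>qq\<^sup>0, \<dots>, qq\<^sup>N\<close>.\<close>

definition chain_poly :: "nat \<Rightarrow> nat \<Rightarrow> qfield \<Rightarrow> qfield \<Rightarrow> qfield" where
  "chain_poly N n u v = (\<Prod>k\<in>{n<..N}. u - qq ^ k) * (\<Prod>k<n. v - qq ^ k)"

text \<open>Multiplication by \<open>u - v = (u - qq^n) - (v - qq^n)\<close> makes the sum
  telescope, and both ends vanish because \<open>u\<close> and \<open>v\<close> are nodes.\<close>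

lemma chain_poly_sum:
  assumes "i \<le> N" "j \<le> N" "i \<noteq> j"
  shows "(\<Sum>n\<le>N. chain_poly N n (qq ^ i) (qq ^ j)) = 0"
proof -
  define u v where "u = qq ^ i" and "v = qq ^ j"
  define R where "R n = (\<Prod>k\<in>{n..N}. u - qq ^ k) * (\<Prod>k<n. v - qq ^ k)" for n
  have step: "(u - v) * chain_poly N n u v = R n - R (Suc n)" if "n \<le> N" for n
  proof -
    have "{n..N} = insert n {n<..N}" "{Suc n..N} = {n<..N}" using that by auto
    then have "R n = (u - qq ^ n) * chain_poly N n u v" "R (Suc n) = (v - qq ^ n) * chain_poly N n u v"
      by (simp_all add: R_def chain_poly_def)
    then show ?thesis by (simp only:) (simp add: algebra_simps)
  qed
  have "(u - v) * (\<Sum>n\<le>N. chain_poly N n u v) = (\<Sum>n\<le>N. R n - R (Suc n))"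
    unfolding sum_distrib_left by (intro sum.cong refl step) simp
  also have "\<dots> = R 0 - R (Suc N)"
    by (rule sum_telescope)
  also have "R 0 = 0"
    using assms by (auto simp: R_def u_def intro: prod_zero)
  also have "R (Suc N) = 0"
    using assms by (auto simp: R_def v_def intro: prod_zero)
  finally show ?thesis
    using assms(3) by (simp add: u_def v_def)
qed

text \<open>The product \<open>(v - qq * u) * qq^(-n)\<close> equals
  \<open>qq^(-n) * (v - qq^n) - qq^(1-n) * (u - qq^n) + (1 - qq)\<close>. The first two terms
  telescope and the constant multiplies the unweighted sum, which is 0. The condition
  \<open>j \<noteq> Suc i\<close> allows division by \<open>v - qq * u\<close>.\<close>

lemma chain_poly_weighted_sum:
  assumes "i \<le> N" "j \<le> N" "i \<noteq> j" "j \<noteq> Suc i"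
  shows "(\<Sum>n\<le>N. inverse (qq ^ n) * chain_poly N n (qq ^ i) (qq ^ j)) = 0"
proof -
  define u v where "u = qq ^ i" and "v = qq ^ j"
  text \<open>\<open>S n\<close> is the term with index \<open>n - 1\<close> of the telescoping sum, so that \<open>S 0\<close> makes sense.\<close>
  define S where "S n = qq * inverse (qq ^ n) * ((\<Prod>k\<in>{n..N}. u - qq ^ k) * (\<Prod>k<n. v - qq ^ k))" for n
  have step: "(v - qq * u) * (inverse (qq ^ n) * chain_poly N n u v) =
      S (Suc n) - S n + (1 - qq) * chain_poly N n u v" if "n \<le> N" for n
  proof -
    have sets: "{n..N} = insert n {n<..N}" "{Suc n..N} = {n<..N}" using that by auto
    have "S (Suc n) = inverse (qq ^ n) * ((v - qq ^ n) * chain_poly N n u v)"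
      by (simp add: S_def chain_poly_def sets)
    moreover have "S n = qq * inverse (qq ^ n) * ((u - qq ^ n) * chain_poly N n u v)"
      by (simp add: S_def chain_poly_def sets)
    moreover have inv: "qq ^ n * (inverse (qq ^ n) * c) = c" for c
      by (simp add: mult.assoc[symmetric])
    ultimately show ?thesis by (simp only:) (simp add: algebra_simps inv)
  qed
  have "(v - qq * u) * (\<Sum>n\<le>N. inverse (qq ^ n) * chain_poly N n u v) =
      (\<Sum>n\<le>N. S (Suc n) - S n + (1 - qq) * chain_poly N n u v)"
    unfolding sum_distrib_left by (intro sum.cong refl step) simp
  also have "\<dots> = (\<Sum>n\<le>N. S (Suc n) - S n) + (1 - qq) * (\<Sum>n\<le>N. chain_poly N n u v)"
    by (simp add: sum.distrib sum_distrib_left)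
  also have "(\<Sum>n\<le>N. S (Suc n) - S n) = S (Suc N) - S 0"
    by (simp only: sum_lessThan_telescope lessThan_Suc_atMost[symmetric])
  also have "S 0 = 0"
    using assms by (auto simp: S_def u_def intro: prod_zero)
  also have "S (Suc N) = 0"
    using assms by (auto simp: S_def v_def intro: prod_zero)
  also have "(\<Sum>n\<le>N. chain_poly N n u v) = 0"
    unfolding u_def v_def by (rule chain_poly_sum) (use assms in auto)
  finally have "(v - qq * u) * (\<Sum>n\<le>N. inverse (qq ^ n) * chain_poly N n u v) = 0" by simp
  moreover have "v - qq * u \<noteq> 0"
    using assms(4) qq_power_eq_iff[of j "Suc i"] by (simp add: u_def v_def)
  ultimately show ?thesis by (simp add: u_def v_def)
qed

text \<open>These zeros extend sums over \<open>i \<le> n\<close> and \<open>n \<le> j\<close> to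
  the whole square of indices up to \<open>N\<close>.\<close>

lemma chain_poly_eq_0: "n < i \<Longrightarrow> i \<le> N \<Longrightarrow> chain_poly N n (qq ^ i) v = 0"
  "j < n \<Longrightarrow> chain_poly N n u (qq ^ j) = 0"
  by (auto simp: chain_poly_def)

text \<open>Passing to the full node set up to \<open>n + m\<close>, the first weight loses the
  differences to the nodes above \<open>n\<close>, and the second those to the nodes below
  \<open>n\<close>. These missing differences are the two products in \<open>chain_poly\<close>. The
  power of \<open>qq^n\<close> comes from the \<open>m\<close> differences between nodes shifted by
  \<open>n\<close>.\<close>

lemma wt_mult_wt_eq_chain_poly:
  assumes "i \<le> n" "j \<le> m"
  shows "wt n i * (inverse (qq ^ n) ^ m * wt m j) =
    chain_poly (n + m) n (qq ^ i) (qq ^ (n + j)) * (wt (n + m) i * wt (n + m) (n + j))"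
proof -
  define N where "N = n + m"
  have "n \<le> N" by (simp add: N_def)
  then have sets: "{..N} - {i} = ({..n} - {i}) \<union> {n<..N}"
    using assms(1) by (intro set_eqI) (simp, linarith)
  have "(\<Prod>k\<in>{..N} - {i}. qq ^ i - qq ^ k) =
      (\<Prod>k\<in>{..n} - {i}. qq ^ i - qq ^ k) * (\<Prod>k\<in>{n<..N}. qq ^ i - qq ^ k)"
    unfolding sets by (rule prod.union_disjoint) auto
  moreover have "(\<Prod>k\<in>{n<..N}. qq ^ i - qq ^ k) \<noteq> 0"
    using assms by auto
  ultimately have 1: "wt n i = (\<Prod>k\<in>{n<..N}. qq ^ i - qq ^ k) * wt N i"
    by (simp add: wt_def)
  have sets': "{..N} - {n + j} = {..<n} \<union> ((+) n ` ({..m} - {j}))"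
  proof (intro set_eqI iffI)
    fix x assume x: "x \<in> {..N} - {n + j}"
    show "x \<in> {..<n} \<union> ((+) n ` ({..m} - {j}))"
    proof (cases "x < n")
      case False
      then have "x = n + (x - n)" "x - n \<in> {..m} - {j}" using x by (auto simp: N_def)
      then show ?thesis by blast
    qed simp
  qed (auto simp: N_def)
  have "(\<Prod>k\<in>{..N} - {n + j}. qq ^ (n + j) - qq ^ k) = (\<Prod>k<n. qq ^ (n + j) - qq ^ k) *
      (\<Prod>k\<in>(+) n ` ({..m} - {j}). qq ^ (n + j) - qq ^ k)"
    unfolding sets' by (rule prod.union_disjoint) auto
  also have "(\<Prod>k\<in>(+) n ` ({..m} - {j}). qq ^ (n + j) - qq ^ k) =
      (\<Prod>k\<in>{..m} - {j}. qq ^ n * (qq ^ j - qq ^ k))"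
    by (subst prod.reindex) (auto simp: power_add right_diff_distrib)
  also have "\<dots> = (qq ^ n) ^ m * (\<Prod>k\<in>{..m} - {j}. qq ^ j - qq ^ k)"
    using assms by (simp add: prod.distrib)
  finally have eq: "(\<Prod>k\<in>{..N} - {n + j}. qq ^ (n + j) - qq ^ k) = (\<Prod>k<n. qq ^ (n + j) - qq ^ k) *
      ((qq ^ n) ^ m * (\<Prod>k\<in>{..m} - {j}. qq ^ j - qq ^ k))" .
  moreover have "(\<Prod>k<n. qq ^ (n + j) - qq ^ k) \<noteq> 0"
    by (auto simp del: power_add)
  ultimately have 2: "inverse (qq ^ n) ^ m * wt m j = (\<Prod>k<n. qq ^ (n + j) - qq ^ k) * wt N (n + j)"
    by (simp add: wt_def power_inverse)
  show ?thesis
    unfolding N_def[symmetric] chain_poly_def 1 2 by simp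
qed

text \<open>For fixed \<open>N\<close> the right-hand side depends on \<open>n\<close> only through
  \<open>chain_poly\<close>, so a relation between chain polynomials becomes a relation between
  double products.\<close>

lemma XP_XP_nord:
  fixes us w s
  assumes "n \<le> N"
  defines "us' \<equiv> map ((*) (qq ^ N)) us" and "w' \<equiv> qq ^ N * w"
  shows "XP n (XP (N - n) (nord us w s)) = (\<Sum>i\<le>N. \<Sum>j\<le>N.
    fscale (chain_poly N n (qq ^ i) (qq ^ j) * (wt N i * wt N j * (qq ^ N) powi (- s) *
      (contr (qq ^ j) us' w' * contr (qq ^ i) (qq ^ j # us') w')))
    (nord (qq ^ i # qq ^ j # us') w' (s + int N)))"
proof -
  define m where "m = N - n"
  have N: "N = n + m" using assms by (simp add: m_def)
  define G where "G i j = nord (qq ^ i # qq ^ j # us') w' (s + int N)" for i j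
  define c where "c i j = contr (qq ^ j) us' w' * contr (qq ^ i) (qq ^ j # us') w'" for i j
  let ?q = "\<lambda>n s. (qq ^ n) powi (- s)"
  have maps: "map ((*) (qq ^ n)) (map ((*) (qq ^ m)) us) = us'" "qq ^ n * (qq ^ m * w) = w'"
    by (simp_all add: us'_def w'_def N power_add mult.assoc)
  have "XP n (XP m (nord us w s)) = (\<Sum>j\<le>m. \<Sum>i\<le>n. fscale
      (wt m j * ?q m s * contr (qq ^ j) (map ((*) (qq ^ m)) us) (qq ^ m * w) *
       (wt n i * ?q n (s + int m) * contr (qq ^ i) (qq ^ (n + j) # us') w')) (G i (n + j)))"
  proof -
    have inner: "XP n (nord (qq ^ j # map ((*) (qq ^ m)) us) (qq ^ m * w) (s + int m)) =
      (\<Sum>i\<le>n. fscale (wt n i * ?q n (s + int m) * contr (qq ^ i) (qq ^ (n + j) # us') w') (G i (n + j)))" for j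
    proof -
      have "s + int m + int n = s + int N" by (simp add: N)
      then show ?thesis
        unfolding XP_nord list.map maps power_add[symmetric] G_def by (simp only:)
    qed
    have "XP n (XP m (nord us w s)) = (\<Sum>j\<le>m. fscale
       (wt m j * ?q m s * contr (qq ^ j) (map ((*) (qq ^ m)) us) (qq ^ m * w))
       (XP n (nord (qq ^ j # map ((*) (qq ^ m)) us) (qq ^ m * w) (s + int m))))"
      unfolding XP_nord[of m]
      by (subst XP_sum) (simp_all only: XP_fscale nord_in_Reg fseries.subspace_scale[OF subspace_Reg])
    then show ?thesis
      by (simp only: inner fseries.scale_sum_right fseries.scale_scale)
  qed
  also have "\<dots> = (\<Sum>j\<le>m. \<Sum>i\<le>n. fscale (chain_poly N n (qq ^ i) (qq ^ (n + j)) *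
      (wt N i * wt N (n + j) * ?q N s * c i (n + j))) (G i (n + j)))"
  proof (intro sum.cong refl arg_cong2[where f = fscale])
    fix j i assume ji: "j \<in> {..m}" "i \<in> {..n}"
    have "contr (qq ^ j) (map ((*) (qq ^ m)) us) (qq ^ m * w) = contr (qq ^ (n + j)) us' w'"
      using contr_dilate[of "qq ^ n" "qq ^ j" "map ((*) (qq ^ m)) us" "qq ^ m * w"]
      unfolding maps power_add by simp
    \<comment> \<open>The inner product carries \<open>m\<close> additional inverse powers of
      \<open>z\<close>; the outer dilation turns them into the factor expected by
      \<open>wt_mult_wt_eq_chain_poly\<close>.\<close>
    moreover have "?q m s * ?q n (s + int m) = inverse (qq ^ n) ^ m * ?q N s"
    proof -
      have "?q n (s + int m) = ?q n s * inverse (qq ^ n) ^ m"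
        by (simp add: power_int_diff power_int_minus power_inverse divide_inverse)
      moreover have "?q N s = ?q m s * ?q n s"
        by (simp only: N power_add power_int_mult_distrib mult.commute)
      ultimately show ?thesis by simp
    qed
    moreover have wt: "wt n i * (inverse (qq ^ n) ^ m * wt m j) =
        chain_poly N n (qq ^ i) (qq ^ (n + j)) * (wt N i * wt N (n + j))"
      unfolding N by (rule wt_mult_wt_eq_chain_poly) (use ji in auto)
    moreover have "wt m j * a * b * (wt n i * d * e) = (wt n i * wt m j) * (a * d) * (b * e)" for a b d e
      by simp
    moreover have "(wt n i * wt m j) * (inverse (qq ^ n) ^ m * a) * d =
        (wt n i * (inverse (qq ^ n) ^ m * wt m j)) * (a * d)" for a d
      by simp
    ultimately show "wt m j * ?q m s * contr (qq ^ j) (map ((*) (qq ^ m)) us) (qq ^ m * w) *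
       (wt n i * ?q n (s + int m) * contr (qq ^ i) (qq ^ (n + j) # us') w') =
      chain_poly N n (qq ^ i) (qq ^ (n + j)) * (wt N i * wt N (n + j) * ?q N s * c i (n + j))"
      by (simp only: c_def) (simp only: mult.assoc)
  qed
  also have "\<dots> = (\<Sum>i\<le>n. \<Sum>j\<in>(+) n ` {..m}. fscale (chain_poly N n (qq ^ i) (qq ^ j) *
      (wt N i * wt N j * ?q N s * c i j)) (G i j))"
    by (subst sum.swap) (simp add: sum.reindex)
  also have "\<dots> = (\<Sum>i\<le>N. \<Sum>j\<le>N. fscale (chain_poly N n (qq ^ i) (qq ^ j) *
      (wt N i * wt N j * ?q N s * c i j)) (G i j))"
  proof (rule sum.mono_neutral_cong_left)
    show "\<forall>i\<in>{..N} - {..n}. (\<Sum>j\<le>N. fscale (chain_poly N n (qq ^ i) (qq ^ j) *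
      (wt N i * wt N j * ?q N s * c i j)) (G i j)) = 0"
      by (intro ballI sum.neutral)
         (simp only: chain_poly_eq_0 Diff_iff atMost_iff not_le mult_zero_left fseries.scale_zero_left)
    fix i
    have im: "(+) n ` {..m} = {n..N}"
      by (simp add: N atMost_atLeast0)
    show "(\<Sum>j\<in>(+) n ` {..m}. fscale (chain_poly N n (qq ^ i) (qq ^ j) *
        (wt N i * wt N j * ?q N s * c i j)) (G i j)) =
      (\<Sum>j\<le>N. fscale (chain_poly N n (qq ^ i) (qq ^ j) * (wt N i * wt N j * ?q N s * c i j)) (G i j))"
      unfolding im
    proof (rule sum.mono_neutral_left)
      show "\<forall>j\<in>{..N} - {n..N}. fscale (chain_poly N n (qq ^ i) (qq ^ j) *
          (wt N i * wt N j * ?q N s * c i j)) (G i j) = 0"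
      proof
        fix j assume "j \<in> {..N} - {n..N}"
        then have "j < n" by auto
        then show "fscale (chain_poly N n (qq ^ i) (qq ^ j) *
          (wt N i * wt N j * ?q N s * c i j)) (G i j) = 0"
          by (simp only: chain_poly_eq_0 mult_zero_left fseries.scale_zero_left)
      qed
    qed auto
  qed (use assms in auto)
  finally show ?thesis
    unfolding G_def c_def m_def .
qed

text \<open>At the excluded positions \<open>i = j\<close> and \<open>j = Suc i\<close> the
  contraction of the two outer factors is zero, so a relation valid elsewhere is enough.\<close>

lemma XP_XP_relation:
  assumes "b \<in> Reg"
    and "\<And>i j. i \<le> N \<Longrightarrow> j \<le> N \<Longrightarrow> i \<noteq> j \<Longrightarrow> j \<noteq> Suc i \<Longrightarrow>
      (\<Sum>n\<le>N. c n * chain_poly N n (qq ^ i) (qq ^ j)) = 0"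
  shows "(\<Sum>n\<le>N. fscale (c n) (XP n (XP (N - n) b))) = 0"
  using assms(1)
proof (induction rule: Reg_induct)
  case zero
  show ?case by (simp only: XP_0 fseries.scale_zero_right sum.neutral_const)
next
  case (step d us w s y)
  note y = step(1)
  define x where x: "x = nord us w s"
  define us' w' where "us' = map ((*) (qq ^ N)) us" and "w' = qq ^ N * w"
  define G where "G i j = nord (qq ^ i # qq ^ j # us') w' (s + int N)" for i j
  define h where "h i j = wt N i * wt N j * (qq ^ N) powi (- s) *
      (contr (qq ^ j) us' w' * contr (qq ^ i) (qq ^ j # us') w')" for i j
  have "(\<Sum>n\<le>N. fscale (c n) (XP n (XP (N - n) x))) = (\<Sum>n\<le>N. \<Sum>i\<le>N. \<Sum>j\<le>N.
      fscale (c n * chain_poly N n (qq ^ i) (qq ^ j) * h i j) (G i j))"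
    unfolding x G_def h_def us'_def w'_def
    by (intro sum.cong refl)
       (simp only: XP_XP_nord atMost_iff fseries.scale_sum_right fseries.scale_scale mult.assoc)
  also have "\<dots> = (\<Sum>i\<le>N. \<Sum>j\<le>N. \<Sum>n\<le>N.
      fscale (c n * chain_poly N n (qq ^ i) (qq ^ j) * h i j) (G i j))"
    by (subst sum.swap) (intro sum.cong refl sum.swap)
  also have "\<dots> = (\<Sum>i\<le>N. \<Sum>j\<le>N.
      fscale ((\<Sum>n\<le>N. c n * chain_poly N n (qq ^ i) (qq ^ j)) * h i j) (G i j))"
    by (simp only: fseries.scale_sum_left sum_distrib_right)
  also have "\<dots> = 0"
  proof (intro sum.neutral ballI)
    fix i j assume ij: "i \<in> {..N}" "j \<in> {..N}"
    have "(\<Sum>n\<le>N. c n * chain_poly N n (qq ^ i) (qq ^ j)) * h i j = 0"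
    proof (cases "i = j \<or> j = Suc i")
      case True
      then have "contr (qq ^ i) (qq ^ j # us') w' = 0" by auto
      then show ?thesis by (simp only: h_def mult_zero_right)
    next
      case False
      then show ?thesis using ij assms(2)[of i j] by simp
    qed
    then show "fscale ((\<Sum>n\<le>N. c n * chain_poly N n (qq ^ i) (qq ^ j)) * h i j) (G i j) = 0"
      by (simp only: fseries.scale_zero_left)
  qed
  finally have x0: "(\<Sum>n\<le>N. fscale (c n) (XP n (XP (N - n) x))) = 0" .
  have xr: "x \<in> Reg" "fscale d x \<in> Reg"
    unfolding x by (intro nord_in_Reg fseries.subspace_scale[OF subspace_Reg])+
  have "(\<Sum>n\<le>N. fscale (c n) (XP n (XP (N - n) (fscale d x + y)))) =
      fscale d (\<Sum>n\<le>N. fscale (c n) (XP n (XP (N - n) x))) + (\<Sum>n\<le>N. fscale (c n) (XP n (XP (N - n) y)))"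
    by (simp only: XP_add XP_fscale xr y XP_in_Reg fseries.subspace_scale[OF subspace_Reg]
        fseries.scale_right_distrib fseries.scale_sum_right fseries.scale_scale sum.distrib mult.commute)
  then show ?case
    unfolding x[symmetric] by (simp only: x0 step(2) fseries.scale_zero_right add_0)
qed

lemma XP_XP_sum:
  assumes "b \<in> Reg"
  shows "(\<Sum>n\<le>N. XP n (XP (N - n) b)) = 0"
proof -
  have "(\<Sum>n\<le>N. fscale 1 (XP n (XP (N - n) b))) = 0"
  proof (rule XP_XP_relation[OF assms])
    fix i j assume "i \<le> N" "j \<le> N" "i \<noteq> j"
    from chain_poly_sum[OF this] show "(\<Sum>n\<le>N. 1 * chain_poly N n (qq ^ i) (qq ^ j)) = 0"
      by (simp only: mult_1)
  qed
  then show ?thesis by (simp only: fseries.scale_one)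
qed

lemma XP_XP_weighted_sum:
  assumes "b \<in> Reg"
  shows "(\<Sum>n\<le>N. fscale (inverse (qq ^ n)) (XP n (XP (N - n) b))) = 0"
  using assms chain_poly_weighted_sum by (rule XP_XP_relation)

section \<open>Reduction of arbitrary monomials to admissible ones\<close>

definition xmono :: "nat list \<Rightarrow> fseries" where
  "xmono ns = foldr XP ns koyama"

lemma xmono_Nil: "xmono [] = koyama" and xmono_Cons: "xmono (n # ns) = XP n (xmono ns)"
  by (simp_all add: xmono_def)

lemma xmono_in_Reg: "xmono ns \<in> Reg"
  by (induction ns) (simp_all only: xmono_Nil xmono_Cons koyama_eq_nord nord_in_Reg XP_in_Reg)

text \<open>Both points are 1, so the factor \<open>1 - w/u\<close> vanishes.\<close>

lemma XP_0_koyama: "XP 0 koyama = 0"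
proof -
  have "contr (qq ^ 0) (map ((*) (qq ^ 0)) []) (qq ^ 0 * 1) = 0" by simp
  then show ?thesis
    unfolding koyama_eq_nord XP_nord
    by (simp only: atMost_0 sum.insert sum.empty finite.emptyI empty_iff not_False_eq_True
        mult_zero_right fseries.scale_zero_left add_0)
qed

text \<open>The head of the list is the outermost index, so the last entry belongs to \<open>l\<^sub>1\<close>.\<close>

primrec adm :: "nat list \<Rightarrow> bool" where
  "adm [] \<longleftrightarrow> True"
| "adm (n # ns) \<longleftrightarrow> (if ns = [] then n \<ge> 1 else n \<ge> 2) \<and> adm ns"

lemma XP_in_subspace:
  assumes "b \<in> fseries.span S" "S \<subseteq> Reg" "fseries.subspace V" "\<And>x. x \<in> S \<Longrightarrow> XP n x \<in> V"
  shows "XP n b \<in> V"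
proof -
  have "b \<in> Reg \<and> XP n b \<in> V"
    using assms(1)
  proof (induction rule: fseries.span_induct_alt)
    case base
    show ?case
      using fseries.subspace_0[OF assms(3)] by (simp only: XP_0 zero_in_Reg simp_thms)
  next
    case (step c x y)
    then have x: "x \<in> Reg" "fscale c x \<in> Reg"
      using assms(2) by (auto intro: fseries.subspace_scale[OF subspace_Reg])
    have "XP n (fscale c x + y) = fscale c (XP n x) + XP n y"
      using step x by (simp only: XP_add XP_fscale)
    moreover have "fscale c (XP n x) + XP n y \<in> V"
      using step assms(4) by (intro fseries.subspace_add[OF assms(3)] fseries.subspace_scale[OF assms(3)]) auto
    moreover have "fscale c x + y \<in> Reg"
      using step x by (intro fseries.subspace_add[OF subspace_Reg]) auto
    ultimately show ?case by (simp only: simp_thms)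
  qed
  then show ?thesis ..
qed

text \<open>Induction on the length alone. An outer index at least 2 can be put in front of any
  admissible expansion of the tail. For an outer index 0 or 1, the two quadratic relations with the
  same \<open>N\<close> and the same inner tail express \<open>e 0\<close> and \<open>e 1\<close>
  through the \<open>e k\<close> with \<open>k \<ge> 2\<close>; the tails of these are arbitrary but
  shorter.\<close>

lemma xmono_in_span_adm: "xmono ns \<in> fseries.span {xmono ms | ms. adm ms \<and> length ms = length ns}"
proof (induction ns rule: length_induct)
  case (1 ns)
  let ?S = "\<lambda>L. {xmono ms | ms. adm ms \<and> length ms = L}"
  let ?V = "\<lambda>L. fseries.span (?S L)"
  note IH = 1[rule_format]
  have big: "xmono (n # ns') \<in> ?V (length ns)" if "n \<ge> 2" "length ns = Suc (length ns')" for n ns'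
    unfolding xmono_Cons
  proof (rule XP_in_subspace)
    show "xmono ns' \<in> ?V (length ns')" by (rule IH) (use that in simp)
    show "?S (length ns') \<subseteq> Reg" using xmono_in_Reg by blast
    show "fseries.subspace (?V (length ns))" by (rule fseries.subspace_span)
    fix x assume "x \<in> ?S (length ns')"
    then obtain ms where ms: "x = xmono ms" "adm ms" "length ms = length ns'" by blast
    have "adm (n # ms)" "length (n # ms) = length ns" using ms that by auto
    then show "XP n x \<in> ?V (length ns)"
      unfolding ms(1) xmono_Cons[symmetric] by (intro fseries.span_base) blast
  qed
  consider "ns = []" | n where "ns = [n]" | n n1 ns' where "ns = n # n1 # ns'"
    by (metis list.exhaust)
  then show ?case
  proof cases
    case 1
    then have "xmono ns \<in> ?S (length ns)" by (intro CollectI exI[of _ ns]) simp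
    then show ?thesis by (rule fseries.span_base)
  next
    case (2 n)
    show ?thesis
    proof (cases "n = 0")
      case True
      then have "xmono ns = 0" unfolding 2 by (simp only: xmono_Cons xmono_Nil XP_0_koyama)
      then show ?thesis by (simp only: fseries.span_zero)
    next
      case False
      then have "xmono ns \<in> ?S (length ns)" using 2 by (intro CollectI exI[of _ ns]) simp
      then show ?thesis by (rule fseries.span_base)
    qed
  next
    case (3 n n1 ns')
    define N where "N = n + n1"
    define e where "e k = XP k (XP (N - k) (xmono ns'))" for k
    have V: "fseries.subspace (?V (length ns))" by (rule fseries.subspace_span)
    have e_big: "e k \<in> ?V (length ns)" if "k \<ge> 2" for k
      unfolding e_def xmono_Cons[symmetric] by (rule big[OF that]) (simp add: 3)
    have r1: "(\<Sum>k\<le>N. e k) = 0" and r2: "(\<Sum>k\<le>N. fscale (inverse (qq ^ k)) (e k)) = 0"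
      unfolding e_def by (rule XP_XP_sum[OF xmono_in_Reg] XP_XP_weighted_sum[OF xmono_in_Reg])+
    have en: "xmono ns = e n"
      by (simp add: 3 e_def N_def xmono_Cons)
    show ?thesis
    proof (cases "n \<ge> 2")
      case True
      then show ?thesis unfolding en by (rule e_big)
    next
      case False
      show ?thesis
      \<comment> \<open>Only \<open>e 0\<close> exists here, and the first relation says that it is
        0.\<close>
      proof (cases "N = 0")
        case True
        with r1 have "e 0 = 0" by (simp only: atMost_0 sum.insert sum.empty finite.emptyI
            empty_iff not_False_eq_True add_0_right)
        moreover have "n = 0" using True by (simp add: N_def)
        ultimately show ?thesis unfolding en by (simp only: fseries.span_zero)
      next
        case N: False
        have split: "(\<Sum>k\<le>N. f k) = f 0 + (f 1 + (\<Sum>k\<in>{2..N}. f k))" for f :: "nat \<Rightarrow> fseries"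
        proof -
          have "{..N} = insert 0 (insert 1 {2..N})" using N by auto
          then show ?thesis by (simp only:) (subst sum.insert, auto simp del: plus_fun_apply)
        qed
        \<comment> \<open>The difference of the two relations eliminates \<open>e 0\<close> and
          leaves this coefficient at \<open>e 1\<close>.\<close>
        let ?d = "1 - inverse qq"
        have nz: "?d \<noteq> 0"
          using qq_power_eq_1_iff[of 1] by simp
        have "fscale ?d (e 1) + (\<Sum>k\<in>{2..N}. fscale (1 - inverse (qq ^ k)) (e k)) =
            (\<Sum>k\<le>N. fscale (1 - inverse (qq ^ k)) (e k))"
          unfolding split[of "\<lambda>k. fscale (1 - inverse (qq ^ k)) (e k)"]
          by (simp only: power_0 power_one_right inverse_1 diff_self fseries.scale_zero_left add_0)
        also have "\<dots> = 0"
          by (simp only: fseries.scale_left_diff_distrib fseries.scale_one sum_subtractf r1 r2 diff_self)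
        finally have e1': "fscale ?d (e 1) = - (\<Sum>k\<in>{2..N}. fscale (1 - inverse (qq ^ k)) (e k))"
          by (simp only: eq_neg_iff_add_eq_0)
        have "e 1 = fscale (inverse ?d) (fscale ?d (e 1))"
          by (simp only: fseries.scale_scale left_inverse[OF nz] fseries.scale_one)
        also have "\<dots> \<in> ?V (length ns)"
          unfolding e1'
          by (intro fseries.subspace_scale[OF V] fseries.subspace_neg[OF V] fseries.subspace_sum[OF V] e_big) simp
        finally have e1: "e 1 \<in> ?V (length ns)" .
        have "e 0 = - (e 1 + (\<Sum>k\<in>{2..N}. e k))"
          using r1 unfolding split[of e] by (simp only: eq_neg_iff_add_eq_0)
        also have "\<dots> \<in> ?V (length ns)"
          by (intro fseries.subspace_neg[OF V] fseries.subspace_add[OF V] fseries.subspace_sum[OF V] e1 e_big) simp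
        finally have e0: "e 0 \<in> ?V (length ns)" .
        from False have "n = 0 \<or> n = 1" by auto
        with e0 e1 show ?thesis unfolding en by blast
      qed
    qed
  qed
qed

section \<open>Linear independence\<close>

text \<open>The exponent lists occurring in \<open>xmono ns\<close>: each entry lies between two
  consecutive partial sums of \<open>ns\<close>.\<close>

primrec ES :: "nat list \<Rightarrow> nat list set" where
  "ES [] = {[]}"
| "ES (n # ns) = (\<lambda>(i, es). i # map ((+) n) es) ` ({..n} \<times> ES ns)"

text \<open>Coefficients of the expansion \<open>xmono_eq_sum\<close>. Subtracting \<open>n\<close>
  from the tail undoes the dilation and recovers the exponents of the inner monomial.\<close>

primrec mcoeff :: "nat list \<Rightarrow> nat list \<Rightarrow> qfield" where
  "mcoeff [] es = 1"
| "mcoeff (n # ns) es = wt n (hd es) * (qq ^ n) powi (- int (sum_list ns)) *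
     contr (qq ^ hd es) (map ((^) qq) (tl es)) (qq ^ (n + sum_list ns)) *
     mcoeff ns (map (\<lambda>e. e - n) (tl es))"

text \<open>The partial sums of \<open>ns\<close> without the last one; this is the entrywise
  smallest member of \<open>ES ns\<close>.\<close>

primrec emin :: "nat list \<Rightarrow> nat list" where
  "emin [] = []"
| "emin (n # ns) = 0 # map ((+) n) (emin ns)"

lemma finite_ES: "finite (ES ns)"
  by (induction ns) auto

lemma length_ES: "es \<in> ES ns \<Longrightarrow> length es = length ns"
  by (induction ns arbitrary: es) auto

abbreviation nordE :: "nat list \<Rightarrow> nat \<Rightarrow> fseries" where
  "nordE es N \<equiv> nord (map ((^) qq) es) (qq ^ N) (int N)"

lemma xmono_eq_sum:
  "xmono ns = (\<Sum>es\<in>ES ns. fscale (mcoeff ns es) (nordE es (sum_list ns)))"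
proof (induction ns)
  case Nil
  show ?case
    by (simp add: xmono_Nil koyama_eq_nord scaleL_def fscale_def)
next
  case (Cons n ns)
  let ?N = "sum_list ns"
  let ?h = "\<lambda>(i, es). i # map ((+) n) es"
  have map: "map ((*) (qq ^ n)) (map ((^) qq) es) = map ((^) qq) (map ((+) n) es)" for es
    by (simp add: power_add)
  have "xmono (n # ns) = (\<Sum>es\<in>ES ns. fscale (mcoeff ns es) (XP n (nordE es ?N)))"
    unfolding xmono_Cons Cons
    by (subst XP_sum) (simp_all only: XP_fscale nord_in_Reg fseries.subspace_scale[OF subspace_Reg])
  also have "\<dots> = (\<Sum>es\<in>ES ns. \<Sum>i\<le>n. fscale (mcoeff (n # ns) (i # map ((+) n) es))
      (nordE (i # map ((+) n) es) (sum_list (n # ns))))"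
  proof (intro sum.cong refl)
    fix es
    have id: "map (\<lambda>e. e - n) (map ((+) n) es) = es" by (simp add: o_def)
    have "mcoeff ns es * (wt n i * (qq ^ n) powi (- int ?N) * c) =
        wt n i * (qq ^ n) powi (- int ?N) * c * mcoeff ns es" for i c
      by (rule mult.commute)
    moreover have "int ?N + int n = int (n + ?N)" by simp
    ultimately show "fscale (mcoeff ns es) (XP n (nordE es ?N)) =
        (\<Sum>i\<le>n. fscale (mcoeff (n # ns) (i # map ((+) n) es))
          (nordE (i # map ((+) n) es) (sum_list (n # ns))))"
      unfolding XP_nord map
      by (simp only: fseries.scale_sum_right fseries.scale_scale mcoeff.simps list.sel id
          list.map(2) sum_list.Cons power_add[symmetric])
  qed
  also have "\<dots> = (\<Sum>(i, es)\<in>{..n} \<times> ES ns. fscale (mcoeff (n # ns) (i # map ((+) n) es))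
      (nordE (i # map ((+) n) es) (sum_list (n # ns))))"
    by (subst sum.swap) (rule sum.cartesian_product)
  also have "\<dots> = (\<Sum>es\<in>?h ` ({..n} \<times> ES ns). fscale (mcoeff (n # ns) es) (nordE es (sum_list (n # ns))))"
    by (subst sum.reindex) (auto simp: inj_on_def intro!: sum.cong)
  finally show ?case by (simp only: ES.simps)
qed

lemma contr_eq_0: "v \<in> set us \<Longrightarrow> u \<noteq> 0 \<Longrightarrow> v = u \<Longrightarrow> contr u us w = 0"
  by (induction us) auto

text \<open>Exponents in \<open>ES ns\<close> are weakly increasing by construction, and an equality
  makes the contraction vanish. Hence a list that survives is determined by its set of
  entries.\<close>

lemma ES_sorted:
  assumes "es \<in> ES ns" "mcoeff ns es \<noteq> 0"
  shows "sorted_wrt (<) es"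
  using assms
proof (induction ns arbitrary: es)
  case (Cons n ns)
  then obtain i es' where es: "es = i # map ((+) n) es'" "i \<le> n" "es' \<in> ES ns" by auto
  have "map (\<lambda>e. e - n) (map ((+) n) es') = es'" by (simp add: o_def)
  then have "mcoeff ns es' \<noteq> 0" and c: "contr (qq ^ i) (map ((^) qq) (map ((+) n) es')) (qq ^ (n + sum_list ns)) \<noteq> 0"
    using Cons.prems(2) unfolding es(1) mcoeff.simps list.sel by (simp_all del: list.map map_map)
  then have "sorted_wrt (<) es'" using Cons.IH es(3) by blast
  moreover have "i < n + e" if "e \<in> set es'" for e
  proof -
    have "i \<noteq> n + e"
    proof
      assume "i = n + e"
      then have "contr (qq ^ i) (map ((^) qq) (map ((+) n) es')) (qq ^ (n + sum_list ns)) = 0"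
        using that by (intro contr_eq_0[of "qq ^ (n + e)"]) auto
      with c show False by simp
    qed
    with es(2) show ?thesis by simp
  qed
  ultimately show ?case by (auto simp: es(1) sorted_wrt_map)
qed simp

lemma emin_in_ES: "emin ns \<in> ES ns"
  by (induction ns) (auto intro!: image_eqI[of _ _ "(0, emin _)"])

lemma length_emin [simp]: "length (emin ns) = length ns"
  by (induction ns) simp_all

lemma contr_1_nonzero:
  assumes "\<And>e. e \<in> set es \<Longrightarrow> e \<ge> 2" "M \<ge> 1"
  shows "contr 1 (map ((^) qq) es) (qq ^ M) \<noteq> 0"
  using assms(1)
proof (induction es)
  case Nil
  show ?case using assms(2) by simp
next
  case (Cons e es)
  then have e: "e \<ge> 2" by simp
  have "qq ^ e \<noteq> qq ^ 1" by (simp only: qq_power_eq_iff) (use e in simp)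
  moreover have "qq ^ e \<noteq> 1" using e by simp
  ultimately show ?case using Cons by simp
qed

text \<open>Admissibility enters here. Against the outer exponent 0, all later exponents are at
  least \<open>n \<ge> 2\<close> and so avoid the zeros at 0 and 1; the factor with \<open>Y\<close>
  is nonzero because the total index is positive.\<close>

lemma mcoeff_emin_nonzero: "adm ns \<Longrightarrow> mcoeff ns (emin ns) \<noteq> 0"
proof (induction ns)
  case (Cons n ns)
  have "map (\<lambda>e. e - n) (map ((+) n) (emin ns)) = emin ns" by (simp add: o_def)
  moreover have "contr 1 (map ((^) qq) (map ((+) n) (emin ns))) (qq ^ (n + sum_list ns)) \<noteq> 0"
    by (rule contr_1_nonzero) (use Cons.prems in \<open>auto split: if_splits\<close>)
  ultimately show ?case
    using Cons wt_nonzero by (simp del: map_map)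
qed simp

lemma sum_list_emin_le:
  assumes "es \<in> ES ns"
  shows "sum_list (emin ns) \<le> sum_list es \<and> (sum_list (emin ns) = sum_list es \<longrightarrow> es = emin ns)"
  using assms
proof (induction ns arbitrary: es)
  case (Cons n ns)
  then obtain i es' where es: "es = i # map ((+) n) es'" "es' \<in> ES ns" by auto
  have "sum_list (map ((+) n) xs) = n * length xs + sum_list xs" for xs :: "nat list"
    by (induction xs) simp_all
  then show ?case using Cons.IH[OF es(2)] length_ES[OF es(2)] by (auto simp: es(1))
qed simp

text \<open>Consecutive differences of the partial sums give every index but the last, and the total
  gives the last.\<close>

lemma emin_inject:
  assumes "emin ns = emin ms" "sum_list ns = sum_list ms"
  shows "ns = ms"
  using assms
proof (induction ns arbitrary: ms)
  case Nil
  then show ?case by (cases ms) auto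
next
  case (Cons n ns)
  then obtain m ms' where ms: "ms = m # ms'" by (cases ms) auto
  have eq: "map ((+) n) (emin ns) = map ((+) m) (emin ms')" using Cons.prems(1) ms by simp
  have len: "length ns = length ms'" using arg_cong[OF eq, of length] by simp
  have nm: "n = m"
  proof (cases ns)
    case Nil
    then show ?thesis using len Cons.prems(2) ms by simp
  next
    case (Cons k ks)
    with len eq show ?thesis by (cases ms') auto
  qed
  then have "emin ns = emin ms'" using eq by (simp add: inj_map_eq_map)
  then have "ns = ms'" using Cons.IH Cons.prems(2) ms nm by simp
  with nm ms show ?case by simp
qed

text \<open>Vanishing on all powers means vanishing on all polynomials; one with roots at all other
  points isolates \<open>D s\<close>.\<close>

lemma power_sums_eq_0:
  fixes f :: "'a \<Rightarrow> 'b :: field"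
  assumes "finite S" "inj_on f S" "\<And>j. (\<Sum>s\<in>S. D s * f s ^ j) = 0" "s \<in> S"
  shows "D s = 0"
proof -
  define p where "p = (\<Prod>x\<in>S - {s}. [:- f x, 1:])"
  have "(\<Sum>x\<in>S. D x * poly p (f x)) = (\<Sum>x\<in>S. \<Sum>i\<le>degree p. coeff p i * (D x * f x ^ i))"
    by (simp add: poly_altdef sum_distrib_left mult_ac)
  also have "\<dots> = (\<Sum>i\<le>degree p. coeff p i * (\<Sum>x\<in>S. D x * f x ^ i))"
    by (subst sum.swap) (simp add: sum_distrib_left)
  also have "\<dots> = 0" by (simp add: assms(3))
  finally have "(\<Sum>x\<in>S. D x * poly p (f x)) = 0" .
  moreover have "(\<Sum>x\<in>S. D x * poly p (f x)) = (\<Sum>x\<in>{s}. D x * poly p (f x))"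
  proof (rule sum.mono_neutral_right)
    show "\<forall>x\<in>S - {s}. D x * poly p (f x) = 0"
      using assms(1) by (auto simp: p_def poly_prod intro!: prod_zero)
  qed (use assms in auto)
  moreover have "poly p (f s) \<noteq> 0"
    using assms by (auto simp: p_def poly_prod inj_on_def)
  ultimately show ?thesis by simp
qed

text \<open>Since \<open>qq = qhalf^4\<close> with \<open>qhalf\<close> an indeterminate, the
  coefficient at degree \<open>4 * k\<close> counts how often \<open>k\<close> occurs.\<close>

lemma sum_list_qq_powers_inject:
  assumes "sorted_wrt (<) es" "sorted_wrt (<) es'"
    and "(\<Sum>e\<leftarrow>es. qq ^ e) = (\<Sum>e\<leftarrow>es'. qq ^ e)"
  shows "es = es'"
proof -
  let ?p = "\<lambda>es. \<Sum>e\<leftarrow>es. monom 1 (4 * e) :: complex poly"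
  have Fract: "(\<Sum>e\<leftarrow>es. qq ^ e) = Fraction_Field.Fract (?p es) 1" for es
  proof (induction es)
    case Nil
    show ?case by (simp only: list.map sum_list.Nil Zero_fract_def)
  next
    case (Cons e es)
    have "qq ^ e = Fraction_Field.Fract (monom 1 (4 * e)) 1"
      unfolding qq_eq_qhalf_power power_mult[symmetric] by (rule qhalf_power)
    with Cons show ?case by simp
  qed
  have coeff: "coeff (?p es) (4 * k) = of_nat (count_list es k)" for es k
    by (induction es) auto
  have "?p es = ?p es'"
    using assms(3) by (simp add: Fract eq_fract)
  then have "of_nat (count_list es k) = (of_nat (count_list es' k) :: complex)" for k
    using coeff[of es k] coeff[of es' k] by simp
  then have "count_list es k = count_list es' k" for k by simp
  then have "set es = set es'"
    by (metis count_list_0_iff subsetI subset_antisym)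
  with assms(1,2) show ?thesis
    by (simp add: strict_sorted_equal)
qed

text \<open>The monomial \<open>single 0 j\<close> is the \<open>j\<close>-th power of
  \<open>a(-1)\<close>, whose variable has index 0.\<close>

lemma lookup_avar_mult:
  assumes "r \<ge> 1"
  shows "Poly_Mapping.lookup (avar r * p) (Poly_Mapping.single 0 j) =
    (if r = 1 \<and> j \<ge> 1 then Poly_Mapping.lookup p (Poly_Mapping.single 0 (j - 1)) else 0)"
proof (induction p rule: update_induct)
  case (update f k b)
  let ?s = "Poly_Mapping.single :: nat \<Rightarrow> nat \<Rightarrow> (nat \<Rightarrow>\<^sub>0 nat)"
  have "?s (r - 1) 1 + k = ?s 0 j \<longleftrightarrow> r = 1 \<and> j \<ge> 1 \<and> k = ?s 0 (j - 1)"
  proof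
    assume eq: "?s (r - 1) 1 + k = ?s 0 j"
    have l: "Poly_Mapping.lookup (?s (r - 1) 1) x + Poly_Mapping.lookup k x = Poly_Mapping.lookup (?s 0 j) x" for x
      using arg_cong[OF eq, of "\<lambda>m. Poly_Mapping.lookup m x"] by (simp add: lookup_add)
    have r: "r = 1" using l[of "r - 1"] assms by (auto simp: lookup_single when_def split: if_splits)
    have j: "j \<ge> 1" using l[of 0] r by (simp add: lookup_single)
    have "k = ?s 0 (j - 1)"
    proof (rule poly_mapping_eqI)
      fix x
      show "Poly_Mapping.lookup k x = Poly_Mapping.lookup (?s 0 (j - 1)) x"
        using l[of x] r j by (auto simp: lookup_single when_def split: if_splits)
    qed
    with r j show "r = 1 \<and> j \<ge> 1 \<and> k = ?s 0 (j - 1)" by simp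
  next
    assume "r = 1 \<and> j \<ge> 1 \<and> k = ?s 0 (j - 1)"
    then show "?s (r - 1) 1 + k = ?s 0 j" by (simp flip: single_add)
  qed
  then have "Poly_Mapping.lookup (avar r * Poly_Mapping.single k b) (?s 0 j) =
      (if r = 1 \<and> j \<ge> 1 then Poly_Mapping.lookup (Poly_Mapping.single k b) (?s 0 (j - 1)) else 0)"
    by (auto simp: avar_def mult_single lookup_single when_def)
  with update show ?case
    by (simp add: update_eq_add_single distrib_left lookup_add)
qed simp

text \<open>Pure powers of \<open>a(-1)\<close> arise only from the term
  \<open>a 1 * a(-1) * z\<close> of the exponent, so power of \<open>a(-1)\<close> and power of
  \<open>z\<close> agree.\<close>

lemma lookup_crea:
  "Poly_Mapping.lookup (crea a $ n) (Poly_Mapping.single 0 j) =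
    (if n = j then a 1 ^ j / of_nat (fact j) else 0)"
proof (induction n arbitrary: j rule: less_induct)
  case (less n)
  show ?case
  proof (cases n)
    case 0
    have "Poly_Mapping.single (0 :: nat) j = 0 \<longleftrightarrow> j = 0"
      by (metis lookup_single_eq lookup_zero single_zero)
    with 0 show ?thesis by (auto simp: lookup_one when_def)
  next
    case (Suc m)
    let ?l = "\<lambda>p j. Poly_Mapping.lookup p (Poly_Mapping.single 0 j)"
    have "of_nat n * ?l (crea a $ n) j = ?l (of_nat n * crea a $ n) j"
      using lookup_cst_mult[of "of_nat n" "crea a $ n"] by (simp only: cst_of_nat)
    also have "\<dots> = (\<Sum>r=1..n. of_nat r * a (int r) * ?l (avar r * crea a $ (n - r)) j)"
    proof -
      have "of_nat r * cst (a (int r)) * q = cst (of_nat r * a (int r)) * q" for r q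
        by (simp only: cst_mult cst_of_nat)
      then show ?thesis by (simp only: crea_rec lookup_sum lookup_cst_mult)
    qed
    also have "\<dots> = (\<Sum>r=1..n. if r = 1 then if j \<ge> 1 then a 1 * ?l (crea a $ m) (j - 1) else 0 else 0)"
      by (intro sum.cong refl) (use Suc in \<open>auto simp: lookup_avar_mult\<close>)
    also have "\<dots> = (if j \<ge> 1 then a 1 * ?l (crea a $ m) (j - 1) else 0)"
      using Suc by simp
    also have "\<dots> = of_nat n * (if n = j then a 1 ^ j / of_nat (fact j) else 0)"
    proof (cases "n = j")
      case True
      have "of_nat (fact n) = (of_nat n * of_nat (fact m) :: qfield)"
        by (simp only: Suc fact_Suc of_nat_mult of_nat_id)
      moreover have "j - 1 = m" "a 1 ^ j = a 1 * a 1 ^ m" using True Suc by auto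
      ultimately show ?thesis
        using True less[of m m] Suc of_nat_qfield_nonzero[of n] by (simp del: of_nat_Suc fact_Suc)
    next
      case False
      then show ?thesis using less[of m "j - 1"] Suc by auto
    qed
    finally show ?thesis
      using of_nat_qfield_nonzero[of n] Suc by (simp del: of_nat_Suc)
  qed
qed

lemma Vop_1: "Vop a b n 1 = creaI a n"
  by (subst Vop_eq_sum[where d = 0]) (simp_all add: anni_1)

text \<open>The coefficient of \<open>a(-1)\<^sup>j \<otimes> e\<^bsup>L\<alpha>+\<lambda>\<^esup> z\<^bsup>j+L\<^sup>2-N\<^esup>\<close> in \<open>b(z)(1 \<otimes> e\<^sup>0)\<close>. It isolates the
  products of \<open>L\<close> factors with total index \<open>N\<close>, and as a function of \<open>j\<close> it is a combination of
  powers of distinct scalars.\<close>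

definition vac_coeff :: "nat \<Rightarrow> nat \<Rightarrow> nat \<Rightarrow> fseries \<Rightarrow> qfield" where
  "vac_coeff L N j b = Poly_Mapping.lookup (Poly_Mapping.lookup
     (b (Poly_Mapping.single 0 1) (int j + int L ^ 2 - int N)) (int L)) (Poly_Mapping.single 0 j)"

lemma vac_coeff_linear:
  shows "vac_coeff L N j (fscale c b) = c * vac_coeff L N j b"
    and "vac_coeff L N j (sum f A) = (\<Sum>x\<in>A. vac_coeff L N j (f x))"
  by (simp_all add: vac_coeff_def fscale_def lookup_scaleL lookup_cst_mult fseries_sum_apply lookup_sum)

text \<open>The coefficient of \<open>a(-1) * z\<close> in the creation exponent of
  \<open>nordE es N\<close>.\<close>

definition lam :: "nat \<Rightarrow> nat list \<Rightarrow> qfield" where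
  "lam N es = xcoeff 1 * (\<Sum>e\<leftarrow>es. qq ^ e) + ycoeff 1 * qq ^ N"

text \<open>On the vacuum the lattice part gives \<open>z^(L^2 - M)\<close>, so the creation part
  must supply \<open>z^(j + M - N)\<close>. By \<open>lookup_crea\<close> this contains the
  \<open>j\<close>-th power of \<open>a(-1)\<close> only for \<open>M = N\<close>.\<close>

lemma vac_coeff_nordE:
  "vac_coeff L N j (nordE es M) = (if length es = L \<and> M = N
     then latw (map ((^) qq) es) (qq ^ N) 0 * (lam N es ^ j / of_nat (fact j)) else 0)"
proof (cases "length es = L")
  case False
  then have "int L - int (length es) \<noteq> 0" by simp
  then show ?thesis
    using False by (simp add: vac_coeff_def nord_def lookup_VO lookup_one when_def)
next
  case True
  let ?a = "\<lambda>r. xcoeff r * (\<Sum>u\<leftarrow>map ((^) qq) es. u powi r) + ycoeff r * (qq ^ M) powi r"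
  have a1: "?a 1 = lam M es"
    by (simp add: lam_def o_def)
  have "vac_coeff L N j (nordE es M) = latw (map ((^) qq) es) (qq ^ M) 0 *
      Poly_Mapping.lookup (creaI ?a (int j + int M - int N)) (Poly_Mapping.single 0 j)"
    using True by (simp add: vac_coeff_def nord_def lookup_VO lookup_one Vop_1 lookup_cst_mult
        algebra_simps del: map_map)
  also have "Poly_Mapping.lookup (creaI ?a (int j + int M - int N)) (Poly_Mapping.single 0 j) =
      (if M = N then lam N es ^ j / of_nat (fact j) else 0)"
  proof (cases "int j + int M - int N < 0")
    case True
    then show ?thesis by (auto simp: creaI_def)
  next
    case False
    then have "nat (int j + int M - int N) = j \<longleftrightarrow> M = N" by auto
    with False show ?thesis
      by (simp only: creaI_def lookup_crea a1 if_False) auto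
  qed
  finally show ?thesis using True by simp
qed

lemma latw_nonzero: "0 \<notin> set us \<Longrightarrow> latw us w 0 \<noteq> 0"
  by (induction us) auto

lemma lam_inject:
  assumes "sorted_wrt (<) es" "sorted_wrt (<) es'" "lam N es = lam N es'"
  shows "es = es'"
proof -
  have "xcoeff 1 \<noteq> 0"
    using qint_nonzero[of 1] by (simp add: xcoeff_def)
  with assms show ?thesis
    by (intro sum_list_qq_powers_inject) (simp_all add: lam_def)
qed

text \<open>A triangularity argument. Among the monomials with nonzero coefficient,
  \<open>ns0\<close> has the least sum of minimal exponents; within its length and total index, the
  exponent list \<open>emin ns0\<close> can come from \<open>ns0\<close> alone.\<close>

lemma xmono_linear_independent:
  assumes "finite T" "\<And>ns. ns \<in> T \<Longrightarrow> adm ns" "(\<Sum>ns\<in>T. fscale (c ns) (xmono ns)) = 0" "ns \<in> T"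
  shows "c ns = 0"
proof (rule ccontr)
  assume "c ns \<noteq> 0"
  define T' where "T' = {ns \<in> T. c ns \<noteq> 0}"
  have "finite T'" "T' \<noteq> {}" using assms(1,4) \<open>c ns \<noteq> 0\<close> by (auto simp: T'_def)
  let ?f = "\<lambda>ns. sum_list (emin ns)"
  have "Min (?f ` T') \<in> ?f ` T'"
    using \<open>finite T'\<close> \<open>T' \<noteq> {}\<close> by (intro Min_in) auto
  then obtain ns0 where ns0: "ns0 \<in> T'" and "?f ns0 = Min (?f ` T')"
    by (auto simp del: Min_in)
  then have min: "?f ns0 \<le> ?f ms" if "ms \<in> T'" for ms
    using that \<open>finite T'\<close> by (simp only: Min_le finite_imageI image_eqI)
  define L N where "L = length ns0" and "N = sum_list ns0"
  define R where "R = {ms \<in> T. length ms = L \<and> sum_list ms = N}"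
  have R: "finite R" "ns0 \<in> R" using assms(1) ns0 by (auto simp: R_def T'_def L_def N_def)
  \<comment> \<open>Unsorted lists have coefficient 0 by \<open>ES_sorted\<close>; on the sorted
    ones \<open>lam N\<close> is injective.\<close>
  define E where "E = {es \<in> \<Union> (ES ` R). sorted_wrt (<) es}"
  have E: "finite E" using R(1) by (auto simp: E_def finite_ES)
  define cf where "cf ms es = (if es \<in> ES ms then mcoeff ms es else 0)" for ms es
  define D where "D es = latw (map ((^) qq) es) (qq ^ N) 0 * (\<Sum>ms\<in>R. c ms * cf ms es)" for es
  have vac: "vac_coeff L N j (xmono ms) =
      (if ms \<in> R then \<Sum>es\<in>E. cf ms es * (latw (map ((^) qq) es) (qq ^ N) 0 * (lam N es ^ j / of_nat (fact j))) else 0)"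
    if "ms \<in> T" for ms j
  proof -
    have "vac_coeff L N j (xmono ms) = (\<Sum>es\<in>ES ms. mcoeff ms es * (if ms \<in> R then
        latw (map ((^) qq) es) (qq ^ N) 0 * (lam N es ^ j / of_nat (fact j)) else 0))"
      unfolding xmono_eq_sum vac_coeff_linear vac_coeff_nordE
      by (intro sum.cong refl) (use that in \<open>auto simp: R_def length_ES\<close>)
    also have "\<dots> = (if ms \<in> R then \<Sum>es\<in>ES ms. mcoeff ms es *
        (latw (map ((^) qq) es) (qq ^ N) 0 * (lam N es ^ j / of_nat (fact j))) else 0)"
      by simp
    also have "\<dots> = (if ms \<in> R then \<Sum>es\<in>E. cf ms es *
        (latw (map ((^) qq) es) (qq ^ N) 0 * (lam N es ^ j / of_nat (fact j))) else 0)"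
    proof (intro if_cong refl sum.mono_neutral_cong)
      fix es assume "es \<in> ES ms - E" "ms \<in> R"
      then show "mcoeff ms es * (latw (map ((^) qq) es) (qq ^ N) 0 * (lam N es ^ j / of_nat (fact j))) = 0"
        using ES_sorted[of es ms] by (auto simp: E_def)
    qed (auto simp: cf_def finite_ES E)
    finally show ?thesis .
  qed
  have "(\<Sum>es\<in>E. D es * lam N es ^ j) = 0" for j
  proof -
    have "0 = vac_coeff L N j (\<Sum>ns\<in>T. fscale (c ns) (xmono ns))"
      unfolding assms(3) by (simp add: vac_coeff_def)
    also have "\<dots> = (\<Sum>ms\<in>T. c ms * vac_coeff L N j (xmono ms))"
      by (simp only: vac_coeff_linear)
    also have "\<dots> = (\<Sum>ms\<in>R. c ms * (\<Sum>es\<in>E. cf ms es *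
        (latw (map ((^) qq) es) (qq ^ N) 0 * (lam N es ^ j / of_nat (fact j)))))"
      by (rule sum.mono_neutral_cong_right) (use assms(1) in \<open>auto simp: vac R_def\<close>)
    also have "\<dots> = (\<Sum>ms\<in>R. \<Sum>es\<in>E. c ms * (cf ms es *
        (latw (map ((^) qq) es) (qq ^ N) 0 * (lam N es ^ j / of_nat (fact j)))))"
      by (simp only: sum_distrib_left)
    also have "\<dots> = (\<Sum>es\<in>E. D es * lam N es ^ j) / of_nat (fact j)"
      unfolding D_def sum_distrib_left sum_distrib_right sum_divide_distrib
      by (subst sum.swap) (intro sum.cong refl, simp)
    finally show ?thesis by simp
  qed
  moreover have "inj_on (lam N) E"
    by (rule inj_onI) (auto simp: E_def intro: lam_inject)
  moreover have "emin ns0 \<in> E"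
  proof -
    have "adm ns0" using assms(2) ns0 by (simp add: T'_def)
    then have "sorted_wrt (<) (emin ns0)"
      using ES_sorted[OF emin_in_ES mcoeff_emin_nonzero] by blast
    then show ?thesis using R(2) emin_in_ES by (auto simp: E_def)
  qed
  ultimately have "D (emin ns0) = 0"
    using power_sums_eq_0[OF E, of "lam N" D] by blast
  moreover have "latw (map ((^) qq) (emin ns0)) (qq ^ N) 0 \<noteq> 0"
    by (rule latw_nonzero) auto
  ultimately have "(\<Sum>ms\<in>R. c ms * cf ms (emin ns0)) = 0"
    by (simp add: D_def)
  \<comment> \<open>If another \<open>ms\<close> contributed, \<open>emin ns0\<close> would belong
    to \<open>ES ms\<close>, so the sum of \<open>emin ms\<close> would be at most that of
    \<open>emin ns0\<close>. The choice of \<open>ns0\<close> forces equality, hence equal minimal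
    exponents, and the common total index gives \<open>ms = ns0\<close>.\<close>
  moreover have "(\<Sum>ms\<in>R. c ms * cf ms (emin ns0)) = (\<Sum>ms\<in>{ns0}. c ms * cf ms (emin ns0))"
  proof (rule sum.mono_neutral_right)
    show "\<forall>ms\<in>R - {ns0}. c ms * cf ms (emin ns0) = 0"
    proof
      fix ms assume ms: "ms \<in> R - {ns0}"
      show "c ms * cf ms (emin ns0) = 0"
      proof (rule ccontr)
        assume "c ms * cf ms (emin ns0) \<noteq> 0"
        then have "ms \<in> T'" "emin ns0 \<in> ES ms"
          using ms by (auto simp: T'_def R_def cf_def split: if_splits)
        then have "emin ns0 = emin ms"
          using min[of ms] sum_list_emin_le[of "emin ns0" ms] by auto
        moreover have "sum_list ns0 = sum_list ms" using ms by (simp add: R_def N_def)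
        ultimately show False using emin_inject ms by blast
      qed
    qed
  qed (use R in auto)
  moreover have "cf ns0 (emin ns0) \<noteq> 0"
    using mcoeff_emin_nonzero[of ns0] assms(2) ns0 emin_in_ES by (simp add: cf_def T'_def)
  moreover have "c ns0 \<noteq> 0" using ns0 by (simp add: T'_def)
  ultimately show False by simp
qed

section \<open>Translation to the index lists of the statement\<close>

lemma xmonomial_eq_xmono:
  assumes "\<forall>l\<in>set ls. l \<le> - 1"
  shows "xmonomial ls = xmono (rev (map (\<lambda>l. nat (- l - 1)) ls))"
proof -
  have "fold xprod ls b = fold XP (map (\<lambda>l. nat (- l - 1)) ls) b" for b
    using assms by (induction ls arbitrary: b) auto
  \<comment> \<open>The list is reversed because \<open>xmonomial\<close> applies its first entry
    innermost, whereas \<open>xmono\<close> has the outermost index at the head.\<close>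
  then show ?thesis by (simp add: xmonomial_def xmono_def foldr_conv_fold)
qed

lemma xmono_eq_xmonomial: "xmono ns = xmonomial (rev (map (\<lambda>n. - int n - 1) ns))"
proof -
  have "map (nat \<circ> (\<lambda>l. - l - 1) \<circ> (\<lambda>n. - int n - 1)) ns = ns" by (induction ns) simp_all
  then show ?thesis
    by (subst xmonomial_eq_xmono) (auto simp: rev_map o_def)
qed

lemma adm_iff: "adm ns \<longleftrightarrow> (\<forall>j<length ns. if j = length ns - 1 then ns ! j \<ge> 1 else ns ! j \<ge> 2)"
proof (induction ns)
  case (Cons n ns)
  show ?case
    unfolding adm.simps Cons
    by (cases ns) (auto simp: All_less_Suc2 split: if_splits)
qed simp

lemma basisW1_eq: "basisW1 = {xmono ns | ns. adm ns}"
proof (intro set_eqI iffI)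
  fix b assume "b \<in> basisW1"
  then obtain ls where b: "b = xmonomial ls"
    and ls: "\<forall>j<length ls. if j = 0 then ls ! j \<le> - 2 else ls ! j \<le> - 3"
    unfolding basisW1_def by blast
  have "\<forall>l\<in>set ls. l \<le> - 1"
  proof
    fix l assume "l \<in> set ls"
    then obtain j where "j < length ls" "ls ! j = l" by (auto simp: in_set_conv_nth)
    then show "l \<le> - 1" using ls[rule_format, of j] by (cases "j = 0") simp_all
  qed
  moreover have "adm (rev (map (\<lambda>l. nat (- l - 1)) ls))"
    unfolding adm_iff
  proof (intro allI impI)
    fix j assume "j < length (rev (map (\<lambda>l. nat (- l - 1)) ls))"
    then have j: "j < length ls" by simp
    define k where "k = length ls - Suc j"
    have k: "k < length ls" "j = length ls - 1 \<longleftrightarrow> k = 0" using j by (auto simp: k_def)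
    have nth: "rev (map (\<lambda>l. nat (- l - 1)) ls) ! j = nat (- (ls ! k) - 1)"
      using j k(1) by (simp add: rev_nth k_def)
    show "if j = length (rev (map (\<lambda>l. nat (- l - 1)) ls)) - 1
        then 1 \<le> rev (map (\<lambda>l. nat (- l - 1)) ls) ! j else 2 \<le> rev (map (\<lambda>l. nat (- l - 1)) ls) ! j"
      using ls[rule_format, OF k(1)] k(2) unfolding nth length_rev length_map
      by (cases "k = 0") simp_all
  qed
  ultimately show "b \<in> {xmono ns | ns. adm ns}"
    using b xmonomial_eq_xmono by blast
next
  fix b assume "b \<in> {xmono ns | ns. adm ns}"
  then obtain ns where b: "b = xmono ns" "adm ns" by blast
  let ?ls = "rev (map (\<lambda>n. - int n - 1) ns)"
  have "if j = 0 then ?ls ! j \<le> - 2 else ?ls ! j \<le> - 3" if "j < length ?ls" for j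
  proof -
    define k where "k = length ns - Suc j"
    have k: "k < length ns" "k = length ns - 1 \<longleftrightarrow> j = 0" using that by (auto simp: k_def)
    have nth: "?ls ! j = - int (ns ! k) - 1"
      using that k(1) by (simp add: rev_nth k_def)
    show ?thesis
      using b(2)[unfolded adm_iff, rule_format, OF k(1)] k(2) unfolding nth by (cases "j = 0") simp_all
  qed
  then show "b \<in> basisW1"
    unfolding basisW1_def b(1) xmono_eq_xmonomial by blast
qed

lemma W1_eq: "W1 = fseries.span (range xmono)"
proof -
  have "{xmonomial ls | ls. \<forall>l\<in>set ls. l \<le> - 1} = range xmono"
  proof (intro set_eqI iffI)
    fix b assume "b \<in> {xmonomial ls | ls. \<forall>l\<in>set ls. l \<le> - 1}"
    then show "b \<in> range xmono" using xmonomial_eq_xmono by auto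
  next
    fix b assume "b \<in> range xmono"
    then obtain ns where b: "b = xmono ns" by blast
    have "\<forall>l\<in>set (rev (map (\<lambda>n. - int n - 1) ns)). l \<le> - 1" by auto
    then show "b \<in> {xmonomial ls | ls. \<forall>l\<in>set ls. l \<le> - 1}"
      unfolding b xmono_eq_xmonomial by blast
  qed
  then show ?thesis by (simp only: W1_def)
qed

lemma independent_basisW1: "fseries.independent basisW1"
  unfolding fseries.independent_explicit_finite_subsets
proof (intro allI impI ballI)
  fix A c b
  assume A: "A \<subseteq> basisW1" "finite A" "(\<Sum>b\<in>A. fscale (c b) b) = 0" and b: "b \<in> A"
  \<comment> \<open>Choosing one index list for each element turns a relation between series into a
    relation indexed by distinct lists.\<close>
  have "\<forall>b\<in>A. \<exists>ns. adm ns \<and> xmono ns = b"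
    using A(1) unfolding basisW1_eq by blast
  then obtain g where g: "\<And>b. b \<in> A \<Longrightarrow> adm (g b) \<and> xmono (g b) = b"
    by metis
  have "inj_on g A" using g by (metis inj_onI)
  have "(\<Sum>ns\<in>g ` A. fscale (c (xmono ns)) (xmono ns)) = (\<Sum>b\<in>A. fscale (c b) b)"
    unfolding sum.reindex[OF \<open>inj_on g A\<close>] o_def using g by (intro sum.cong refl) (simp only:)
  then have "c (xmono (g b)) = 0"
    using A b g by (intro xmono_linear_independent[of "g ` A" "\<lambda>ns. c (xmono ns)"]) auto
  then show "c b = 0" using g[OF b] by simp
qed

theorem theorem4p12:
  shows "basisW1 \<subseteq> W1 \<and> fseries.independent basisW1 \<and> fseries.span basisW1 = W1"
proof (intro conjI)
  show sub: "basisW1 \<subseteq> W1"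
    unfolding basisW1_eq W1_eq by (auto intro: fseries.span_base)
  show "fseries.independent basisW1"
    by (rule independent_basisW1)
  have "xmono ns \<in> fseries.span basisW1" for ns
  proof -
    have "{xmono ms | ms. adm ms \<and> length ms = length ns} \<subseteq> basisW1"
      unfolding basisW1_eq by blast
    from fseries.span_mono[OF this] xmono_in_span_adm show ?thesis by blast
  qed
  then have "W1 \<subseteq> fseries.span basisW1"
    unfolding W1_eq by (intro fseries.span_minimal fseries.subspace_span) auto
  moreover have "fseries.span basisW1 \<subseteq> W1"
    by (rule fseries.span_minimal[OF sub]) (simp add: W1_def fseries.subspace_span)
  ultimately show "fseries.span basisW1 = W1" by blast
qed

end
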